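(* Let $\Xi\in C^2(\mathbb T^n)$ and $P\in\mathbb R^n$. Let $\nu\in\mathcal M_L$ be a Mather measure for $P$, i.e. $\nu$ minimizes $\int_{\mathbb T^n\times\mathbb R^n}\big(\frac{|p|^2}{2}-\Xi(x)-p\cdot P\big)\,d\nu(x,p)$ over $\mathcal M_L$, and let $\mu$ be the marginal of $\nu$ on $\mathbb T^n$. Then $\nu$ is a weak solution of $F(\mu,P)$, and $\mu$ is a maximizer in the definition of $\widehat H_\Xi(P)$, i.e. $\widehat H_\Xi(P)=\int_{\mathbb T^n}\Xi\,d\mu+F(\mu,P)$. Moreover, with $J:=\int_{\mathbb T^n\times\mathbb R^n}p\,d\nu(x,p)$ the rotation vector of $\nu$, the measure $\nu$ minimizes $\int_{\mathbb T^n\times\mathbb R^n}\big(\frac{|p|^2}{2}-\Xi(x)\big)\,d\nu$ over $\mathcal M_L^{J}$.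
   Context: $\mathbb T^n=\mathbb R^n/\mathbb Z^n$ is the flat torus and $\overline{\mathcal M}$ is the set of Borel probability measures on $\mathbb T^n$. For $\Xi\in C^2(\mathbb T^n)$, let $L(p,x)=\frac{|p|^2}{2}-\Xi(x)$. $\mathcal M_L$ is the set of Borel probability measures on $\mathbb T^n\times\mathbb R^n$ (points $(x,p)$) invariant under the Euler–Lagrange flow $\dot x=p$, $\dot p=-\nabla\Xi(x)$. The rotation vector of $\nu\in\mathcal M_L$ is $\int p\,d\nu(x,p)\in\mathbb R^n$, and $\mathcal M_L^J$ is the set of $\nu\in\mathcal M_L$ with rotation vector $J$. For $\mu\in\overline{\mathcal M}$ and $P\in\mathbb R^n$: $$F(\mu,P)=\frac12\inf_{\phi\in C^1(\mathbb T^n)}\int_{\mathbb T^n}|\nabla\phi+P|^2\,d\mu,\qquad \widehat H_\Xi(P)=\sup_{\mu\in\overline{\mathcal M}}\Big[\int_{\mathbb T^n}\Xi\,d\mu+F(\mu,P)\Big].$$ $\Lambda_\mu$ is the set of Borel probability measures $\nu$ on $\mathbb T^n\times\mathbb R^n$ with marginal $\mu$ on $\mathbb T^n$, $\int|p|^2d\nu<\infty$, and $\int p\cdot\nabla\theta(x)\,d\nu=0$ for all $\theta\in C^1(\mathbb T^n)$. A measure $\nu\in\Lambda_\mu$ is a weak solution of $F(\mu,P)$ if $\int[\frac{|p|^2}{2}-p\cdot P]\,d\nu\le\int[\frac{|p|^2}{2}-p\cdot P]\,d\xi$ for all $\xi\in\Lambda_\mu$. *)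

theory Defs
  imports "HOL-Probability.Probability"
begin

section \<open>The flat torus\<close>

definition lattice_rel :: "real ^ 'n \<Rightarrow> real ^ 'n \<Rightarrow> bool"
  where "lattice_rel x y \<longleftrightarrow> (\<forall>i. x $ i - y $ i \<in> \<int>)"

lemma equivp_lattice_rel: "equivp lattice_rel"
proof (rule equivpI)
  show "reflp lattice_rel"
    by (simp add: reflp_def lattice_rel_def)
  show "symp lattice_rel"
    unfolding symp_def lattice_rel_def by (metis Ints_minus minus_diff_eq)
  show "transp lattice_rel"
  proof (rule transpI)
    fix x y z :: "real ^ 'n"
    assume xy: "lattice_rel x y" and yz: "lattice_rel y z"
    have "x $ i - z $ i \<in> \<int>" for i
    proof -
      have "(x $ i - y $ i) + (y $ i - z $ i) \<in> \<int>"
        using xy yz unfolding lattice_rel_def by (intro Ints_add) auto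
      then show ?thesis by simp
    qed
    then show "lattice_rel x z"
      by (simp add: lattice_rel_def)
  qed
qed

quotient_type (overloaded) 'n torus = "real ^ ('n::finite)" / lattice_rel
  morphisms rep_torus tproj
  by (rule equivp_lattice_rel)

instantiation torus :: (finite) topological_space
begin

definition open_torus :: "'a torus set \<Rightarrow> bool"
  where "open_torus U \<longleftrightarrow> open (tproj -` U)"

instance
proof
  show "open (UNIV :: 'a torus set)"
    by (simp add: open_torus_def)
  show "open (S \<inter> T)" if "open S" "open T" for S T :: "'a torus set"
    using that by (simp add: open_torus_def vimage_Int open_Int)
  show "open (\<Union>K)" if "\<forall>S\<in>K. open S" for K :: "'a torus set set"
    using that by (auto simp: open_torus_def vimage_Union intro!: open_UN)
qed

end

section \<open>Smooth functions on the torus\<close>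

text \<open>Differentiability is that of the periodic lift \<open>f \<circ> tproj\<close>. By periodicity, its
  gradient takes the same value at all representatives of a point.\<close>

definition torus_grad :: "('n::finite torus \<Rightarrow> real) \<Rightarrow> 'n torus \<Rightarrow> real ^ 'n"
  where "torus_grad f x = (THE D. \<forall>y. tproj y = x \<longrightarrow> (GDERIV (\<lambda>z. f (tproj z)) y :> D))"

definition C1_torus :: "('n::finite torus \<Rightarrow> real) set"
  where "C1_torus = {f. (\<forall>y. (\<lambda>z. f (tproj z)) differentiable (at y)) \<and>
                        continuous_on UNIV (torus_grad f)}"

definition C2_torus :: "('n::finite torus \<Rightarrow> real) set"
  where "C2_torus = {f \<in> C1_torus. \<forall>i. (\<lambda>x. torus_grad f x $ i) \<in> C1_torus}"

section \<open>Borel probability measures and integrals\<close>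

definition borel_prob_measures :: "'a::topological_space measure set"
  where "borel_prob_measures = {\<mu>. prob_space \<mu> \<and> sets \<mu> = sets borel}"

text \<open>The integral with values in the extended reals. The Bochner integral of a
  non-integrable function is \<open>0\<close>, which would be wrong for measures of infinite action.
  All integrands to which this is applied are bounded below, so \<open>\<infinity> - \<infinity>\<close> does not occur.\<close>

definition ext_integral :: "'a measure \<Rightarrow> ('a \<Rightarrow> real) \<Rightarrow> ereal"
  where "ext_integral M f =
    enn2ereal (\<integral>\<^sup>+ z. ennreal (f z) \<partial>M) - enn2ereal (\<integral>\<^sup>+ z. ennreal (- f z) \<partial>M)"

section \<open>Lagrangian, Euler--Lagrange flow and Mather measures\<close>

definition lagrangian :: "('n::finite torus \<Rightarrow> real) \<Rightarrow> real ^ 'n \<Rightarrow> 'n torus \<Rightarrow> real"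
  where "lagrangian \<Xi> p x = (norm p)\<^sup>2 / 2 - \<Xi> x"

text \<open>The position component \<open>q\<close> is a lift of the trajectory from the torus to the
  universal cover.\<close>

definition EL_solution ::
    "('n::finite torus \<Rightarrow> real) \<Rightarrow> (real \<Rightarrow> real ^ 'n) \<Rightarrow> (real \<Rightarrow> real ^ 'n) \<Rightarrow> bool"
  where "EL_solution \<Xi> q v \<longleftrightarrow>
    (\<forall>t. (q has_vector_derivative v t) (at t) \<and>
         (v has_vector_derivative - torus_grad \<Xi> (tproj (q t))) (at t))"

text \<open>For \<open>\<Xi>\<close> of class \<open>C\<^sup>2\<close> the vector field is globally Lipschitz, so the point
  described below exists and is unique.\<close>

definition EL_flow ::
    "('n::finite torus \<Rightarrow> real) \<Rightarrow> real \<Rightarrow> 'n torus \<times> (real ^ 'n) \<Rightarrow> 'n torus \<times> (real ^ 'n)"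
  where "EL_flow \<Xi> t = (\<lambda>(x, p). THE z. \<exists>q v. EL_solution \<Xi> q v \<and>
    tproj (q 0) = x \<and> v 0 = p \<and> z = (tproj (q t), v t))"

definition invariant_measures ::
    "('n::finite torus \<Rightarrow> real) \<Rightarrow> ('n torus \<times> (real ^ 'n)) measure set"
  where "invariant_measures \<Xi> =
    {\<nu> \<in> borel_prob_measures. \<forall>t. distr \<nu> borel (EL_flow \<Xi> t) = \<nu>}"

definition rotation_vector :: "('n::finite torus \<times> (real ^ 'n)) measure \<Rightarrow> real ^ 'n"
  where "rotation_vector \<nu> = (\<integral>(x, p). p \<partial>\<nu>)"

text \<open>Integrability is required because the rotation vector is undefined without it (and
  the Bochner integral would be \<open>0\<close>).\<close>

definition invariant_measures_rot ::
    "('n::finite torus \<Rightarrow> real) \<Rightarrow> real ^ 'n \<Rightarrow> ('n torus \<times> (real ^ 'n)) measure set"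
  where "invariant_measures_rot \<Xi> J =
    {\<nu> \<in> invariant_measures \<Xi>. integrable \<nu> (\<lambda>(x, p). p) \<and> rotation_vector \<nu> = J}"

definition mather_measure ::
    "('n::finite torus \<Rightarrow> real) \<Rightarrow> real ^ 'n \<Rightarrow> ('n torus \<times> (real ^ 'n)) measure \<Rightarrow> bool"
  where "mather_measure \<Xi> P \<nu> \<longleftrightarrow> \<nu> \<in> invariant_measures \<Xi> \<and>
    (\<forall>\<xi>\<in>invariant_measures \<Xi>.
       ext_integral \<nu> (\<lambda>(x, p). lagrangian \<Xi> p x - p \<bullet> P)
         \<le> ext_integral \<xi> (\<lambda>(x, p). lagrangian \<Xi> p x - p \<bullet> P))"

definition torus_marginal :: "('n::finite torus \<times> (real ^ 'n)) measure \<Rightarrow> 'n torus measure"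
  where "torus_marginal \<nu> = distr \<nu> borel fst"

section \<open>The functional F, the effective Hamiltonian and weak solutions\<close>

text \<open>The infimum is over a nonempty set of nonnegative reals. The supremum in
  \<open>H_hat\<close> is over a nonempty set of reals bounded above by \<open>max \<Xi> + \<bar>P\<bar>\<^sup>2 / 2\<close>.\<close>

definition F_fun :: "'n::finite torus measure \<Rightarrow> real ^ 'n \<Rightarrow> real"
  where "F_fun \<mu> P = 1 / 2 * (INF \<phi>\<in>C1_torus. \<integral>x. (norm (torus_grad \<phi> x + P))\<^sup>2 \<partial>\<mu>)"

definition H_hat :: "('n::finite torus \<Rightarrow> real) \<Rightarrow> real ^ 'n \<Rightarrow> real"
  where "H_hat \<Xi> P = (SUP \<mu>\<in>borel_prob_measures. (\<integral>x. \<Xi> x \<partial>\<mu>) + F_fun \<mu> P)"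

definition Lambda_set :: "'n::finite torus measure \<Rightarrow> ('n torus \<times> (real ^ 'n)) measure set"
  where "Lambda_set \<mu> = {\<nu> \<in> borel_prob_measures. torus_marginal \<nu> = \<mu> \<and>
    integrable \<nu> (\<lambda>(x, p). (norm p)\<^sup>2) \<and>
    (\<forall>\<theta>\<in>C1_torus. (\<integral>(x, p). p \<bullet> torus_grad \<theta> x \<partial>\<nu>) = 0)}"

definition weak_solution ::
    "'n::finite torus measure \<Rightarrow> real ^ 'n \<Rightarrow> ('n torus \<times> (real ^ 'n)) measure \<Rightarrow> bool"
  where "weak_solution \<mu> P \<nu> \<longleftrightarrow> \<nu> \<in> Lambda_set \<mu> \<and>
    (\<forall>\<xi>\<in>Lambda_set \<mu>. (\<integral>(x, p). (norm p)\<^sup>2 / 2 - p \<bullet> P \<partial>\<nu>)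
                         \<le> (\<integral>(x, p). (norm p)\<^sup>2 / 2 - p \<bullet> P \<partial>\<xi>))"

end

(*
A minimizing loop made of finitely many short extremals has no corners, so it is a periodic
orbit, and the uniform measure on a periodic orbit is invariant. Hence, with c minus the action of
the Mather measure, every closed broken line on the torus has nonnegative action for L - p.P + c.
So the infimum of this action over broken lines from a base point to x is a finite periodic
function of x, whose increments are bounded by the action; mollified, it is a C1 function phi with
|grad phi + P|^2 / 2 + Xi <= c + eps. The pointwise Young inequality for p and grad phi + P,
integrated against measures that annihilate p.grad theta, then bounds both minimization problems by
the value that the Mather measure attains. Periodic orbits make weak compactness of measures and
Tonelli's existence theorem unnecessary.
*)

theory Submission
  imports Defs
begin

section \<open>Global flows of Lipschitz vector fields\<close>

text \<open>The potential is built from \<open>cost\<close>, an explicit upper bound for the action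
  of a straight segment, and not from the action itself. Its increments along a short vector h v are
  then bounded by h times the Lagrangian at the starting point, up to an error of order h that does
  not depend on the point. Such increment inequalities are linear in the potential, so they survive
  averaging over translates although the potential is merely continuous; the Legendre transform is
  taken only afterwards, where a gradient exists. The price is the oscillation of \<Xi> over the
  averaging radius, hence an \<epsilon> in each comparison. Minimality of the Mather measure is used
  for the subsolution only against uniform measures on periodic orbits. One such orbit always
  exists, and its finite action is what excludes infinite action and makes the velocities square
  integrable. Closedness (annihilating p.grad \<theta>) comes from invariance alone.\<close>

lemma has_vector_derivative_compose_affine:
  assumes "(y has_vector_derivative d) (at (a + b * t))"
  shows "((\<lambda>t. y (a + b * t)) has_vector_derivative b *\<^sub>R d) (at t)"
proof -
  have "((\<lambda>t. a + b * t) has_vector_derivative b) (at t)"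
    by (auto intro!: derivative_eq_intros simp flip: has_real_derivative_iff_has_vector_derivative)
  from vector_diff_chain_at[OF this assms] show ?thesis
    by (simp add: o_def)
qed

text \<open>Integrating a bound that grows like exp(L|s|) gains the factor 1/L. With the rate 2L
  this gain becomes the contraction factor 1/2 of Picard iteration.\<close>

lemma norm_le_exp_of_derivative_bound:
  fixes g :: "real \<Rightarrow> 'a::real_normed_vector"
  assumes L: "L > 0" and g: "\<And>t. (g has_vector_derivative g' t) (at t)" and g0: "g 0 = 0"
    and bnd: "\<And>s. norm (g' s) \<le> C * exp (L * \<bar>s\<bar>)"
  shows "norm (g t) \<le> C / L * exp (L * \<bar>t\<bar>)"
proof -
  have C: "0 \<le> C"
    using order_trans[OF norm_ge_zero bnd[of 0]] by simp
  have fwd: "norm (h t) \<le> C / L * exp (L * \<bar>t\<bar>)"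
    if h: "\<And>t. (h has_vector_derivative h' t) (at t)" and h0: "h 0 = 0"
      and hb: "\<And>s. norm (h' s) \<le> C * exp (L * \<bar>s\<bar>)" and t: "t > 0"
    for h h' :: "real \<Rightarrow> 'a" and t :: real
  proof -
    have "norm (h t - h 0) \<le> C / L * exp (L * t) - C / L * exp (L * 0)"
    proof (rule differentiable_bound_general[OF t, where f'=h' and \<phi>'="\<lambda>s. C * exp (L * s)"])
      show "continuous_on {0..t} h"
        using h by (meson continuous_at_imp_continuous_on has_vector_derivative_continuous)
      show "continuous_on {0..t} (\<lambda>s. C / L * exp (L * s))"
        by (intro continuous_intros)
      show "((\<lambda>s. C / L * exp (L * s)) has_vector_derivative C * exp (L * x)) (at x)" for x
        using L by (auto intro!: derivative_eq_intros simp flip: has_real_derivative_iff_has_vector_derivative)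
      show "norm (h' x) \<le> C * exp (L * x)" if "0 < x" for x
        using hb[of x] that by simp
    qed (use h in auto)
    moreover have "0 \<le> C / L" using C L by simp
    ultimately show ?thesis using h0 t by simp
  qed
  consider "t > 0" | "t = 0" | "t < 0" by linarith
  then show ?thesis
  proof cases
    case 1 then show ?thesis using fwd[OF g g0 bnd] by simp
  next
    case 2 then show ?thesis using C L g0 by simp
  next
    case 3
    have "((\<lambda>s. g (- s)) has_vector_derivative - g' (- s)) (at s)" for s
      using has_vector_derivative_compose_affine[of g "g' (- s)" 0 "-1" s] g by simp
    then have "norm (g (- (- t))) \<le> C / L * exp (L * \<bar>- t\<bar>)"
      by (intro fwd[where h="\<lambda>s. g (- s)" and h'="\<lambda>s. - g' (- s)"])
        (use g0 3 bnd in \<open>auto simp: bnd[of "- _", simplified]\<close>)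
    then show ?thesis by simp
  qed
qed

definition ode_solution :: "('a::real_normed_vector \<Rightarrow> 'a) \<Rightarrow> (real \<Rightarrow> 'a) \<Rightarrow> bool"
  where "ode_solution F y \<longleftrightarrow> (\<forall>t. (y has_vector_derivative F (y t)) (at t))"

text \<open>Picard iteration is a contraction for the norm weighted by \<open>exp (- 2 * L * \<bar>t\<bar>)\<close>, on the
  whole line at once.\<close>

lemma ode_solution_exists:
  fixes F :: "'a::euclidean_space \<Rightarrow> 'a"
  assumes L: "L > 0" and lip: "\<And>x y. norm (F x - F y) \<le> L * norm (x - y)"
  obtains y where "y 0 = y0" "ode_solution F y"
proof -
  have contF: "continuous_on UNIV F"
    by (rule lipschitz_on_continuous_on[where L=L], rule lipschitz_onI)
      (use lip L in \<open>auto simp: dist_norm\<close>)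
  define w where "w t = exp (2 * L * \<bar>t\<bar>)" for t :: real
  have w0: "w t > 0" for t by (simp add: w_def)
  have cw: "continuous_on UNIV w" unfolding w_def by (intro continuous_intros)
  \<comment> \<open>The unknown is the rescaled displacement \<open>z\<close> = (y - y0) / w. It is
    bounded and continuous, so Banach's theorem applies in the complete space of such
    functions.\<close>
  define f where "f z s = F (y0 + w s *\<^sub>R apply_bcontfun z s)" for z :: "real \<Rightarrow>\<^sub>C 'a" and s
  have cf: "continuous_on UNIV (f z)" for z
    unfolding f_def by (intro continuous_on_compose2[OF contF] continuous_intros cw) auto
  have "\<exists>I. I 0 = 0 \<and> (\<forall>t. (I has_vector_derivative f z t) (at t))" for z
  proof -
    obtain I where I: "\<And>t. (I has_vector_derivative f z t) (at t)"
      using einterval_antiderivative[of "-\<infinity>" "\<infinity>" "f z"] cf[of z]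
      by (auto simp: continuous_on_eq_continuous_at)
    have "((\<lambda>t. I t - I 0) has_vector_derivative f z t) (at t)" for t
      using I[of t] by (auto intro!: derivative_eq_intros)
    then show ?thesis by (intro exI[of _ "\<lambda>t. I t - I 0"]) auto
  qed
  then obtain I where I0: "\<And>z. I z 0 = 0"
    and I: "\<And>z t. (I z has_vector_derivative f z t) (at t)" by metis
  define T where "T z = (\<lambda>t. inverse (w t) *\<^sub>R I z t)" for z
  have fb: "norm (f z s) \<le> (norm (F y0) + L * norm z) * exp (2 * L * \<bar>s\<bar>)" for z s
  proof -
    have "norm (f z s) \<le> norm (F y0) + norm (f z s - F y0)"
      by (metis add.commute diff_add_cancel norm_triangle_ineq)
    also have "norm (f z s - F y0) \<le> L * (w s * norm z)"
    proof -
      have "norm (f z s - F y0) \<le> L * norm (w s *\<^sub>R apply_bcontfun z s)"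
        unfolding f_def using lip[of "y0 + w s *\<^sub>R apply_bcontfun z s" y0] by simp
      also have "\<dots> \<le> L * (w s * norm z)"
        using L w0[of s] norm_bounded[of z s] by (simp add: mult_left_mono)
      finally show ?thesis .
    qed
    also have "norm (F y0) \<le> norm (F y0) * w s"
      using L by (simp add: w_def mult_le_cancel_left1)
    finally show ?thesis by (simp add: w_def algebra_simps)
  qed
  have Tb: "T z \<in> bcontfun" for z
  proof (rule bcontfun_normI)
    have "continuous_on UNIV (I z)"
      using I by (meson continuous_at_imp_continuous_on has_vector_derivative_continuous)
    then show "continuous_on UNIV (T z)"
      unfolding T_def by (intro continuous_intros cw) (auto simp: less_imp_neq[OF w0, symmetric])
    show "norm (T z t) \<le> (norm (F y0) + L * norm z) / (2 * L)" for t
    proof -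
      have "norm (I z t) \<le> (norm (F y0) + L * norm z) / (2 * L) * w t"
        unfolding w_def
        by (rule norm_le_exp_of_derivative_bound[of "2 * L" "I z" "f z"])
          (use L I I0 fb in auto)
      then show ?thesis using w0[of t]
        by (simp add: T_def field_simps)
    qed
  qed
  define TT where "TT z = Bcontfun (T z)" for z
  have TT: "apply_bcontfun (TT z) t = T z t" for z t
    using Tb by (simp add: TT_def Bcontfun_inverse)
  have "dist (TT z) (TT z') \<le> 1/2 * dist z z'" for z z'
  proof (rule dist_bound)
    fix t
    have "norm (I z t - I z' t) \<le> (L * dist z z') / (2 * L) * w t"
      unfolding w_def
    proof (rule norm_le_exp_of_derivative_bound[of "2 * L" "\<lambda>t. I z t - I z' t" "\<lambda>t. f z t - f z' t"])
      show "((\<lambda>t. I z t - I z' t) has_vector_derivative f z t - f z' t) (at t)" for t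
        using I by (auto intro!: derivative_eq_intros)
      show "norm (f z s - f z' s) \<le> L * dist z z' * exp (2 * L * \<bar>s\<bar>)" for s
      proof -
        have "norm (f z s - f z' s) \<le> L * norm (w s *\<^sub>R apply_bcontfun z s - w s *\<^sub>R apply_bcontfun z' s)"
          unfolding f_def using lip[of "y0 + w s *\<^sub>R apply_bcontfun z s" "y0 + w s *\<^sub>R apply_bcontfun z' s"]
          by simp
        also have "\<dots> = L * (w s * dist (apply_bcontfun z s) (apply_bcontfun z' s))"
          using w0[of s] by (simp add: dist_norm flip: scaleR_diff_right)
        also have "\<dots> \<le> L * (w s * dist z z')"
          using L w0[of s] dist_bounded[of z s z'] by (simp add: mult_left_mono)
        finally show ?thesis by (simp add: w_def algebra_simps)
      qed
    qed (use L I0 in auto)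
    then have "norm (I z t - I z' t) \<le> 1/2 * dist z z' * w t"
      using L by (simp add: field_simps)
    moreover have "dist (apply_bcontfun (TT z) t) (apply_bcontfun (TT z') t) = inverse (w t) * norm (I z t - I z' t)"
      using w0[of t] by (simp add: TT T_def dist_norm flip: scaleR_diff_right)
    ultimately have "dist (apply_bcontfun (TT z) t) (apply_bcontfun (TT z') t) \<le> inverse (w t) * (1/2 * dist z z' * w t)"
      using w0[of t] by (simp only: mult_left_mono less_imp_le positive_imp_inverse_positive)
    then show "dist (apply_bcontfun (TT z) t) (apply_bcontfun (TT z') t) \<le> 1/2 * dist z z'"
      using w0[of t] by (simp add: field_simps)
  qed
  then obtain z where z: "TT z = z"
    using banach_fix_type[of "1/2" TT] by auto
  have fix_I: "I z t = w t *\<^sub>R apply_bcontfun z t" for t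
    using TT[of z t] w0[of t] unfolding z by (simp add: T_def)
  have "((\<lambda>t. y0 + I z t) has_vector_derivative F (y0 + I z t)) (at t)" for t
    using I[of z t] unfolding f_def fix_I[symmetric] by (auto intro!: derivative_eq_intros)
  then show ?thesis
    using that[of "\<lambda>t. y0 + I z t"] I0 by (simp add: ode_solution_def)
qed

lemma ode_solution_reverse:
  assumes "ode_solution F y"
  shows "ode_solution (\<lambda>x. - F x) (\<lambda>t. y (- t))"
  unfolding ode_solution_def
proof
  fix t
  show "((\<lambda>t. y (- t)) has_vector_derivative - F (y (- t))) (at t)"
    using has_vector_derivative_compose_affine[of y "F (y (- t))" 0 "-1" t] assms
    by (simp add: ode_solution_def)
qed

lemma ode_solution_shift:
  assumes "ode_solution F y"
  shows "ode_solution F (\<lambda>t. y (s + t))"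
  unfolding ode_solution_def
proof
  fix t
  show "((\<lambda>t. y (s + t)) has_vector_derivative F (y (s + t))) (at t)"
    using has_vector_derivative_compose_affine[of y "F (y (s + t))" s 1 t] assms
    by (simp add: ode_solution_def)
qed

text \<open>Gronwall in differential form: exp(-2Ls) times the squared distance of two solutions is
  nonincreasing. Negative times follow by running both solutions backwards, as solutions of the
  field \<open>- F\<close>.\<close>

lemma ode_solution_dist:
  fixes F :: "'a::euclidean_space \<Rightarrow> 'a"
  assumes lip: "\<And>x y. norm (F x - F y) \<le> L * norm (x - y)"
    and y1: "ode_solution F y1" and y2: "ode_solution F y2"
  shows "norm (y1 t - y2 t) \<le> exp (L * \<bar>t\<bar>) * norm (y1 0 - y2 0)"
proof -
  have fwd: "norm (y1 t - y2 t) \<le> exp (L * t) * norm (y1 0 - y2 0)"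
    if lip: "\<And>x y. norm (F x - F y) \<le> L * norm (x - y)"
      and y1: "ode_solution F y1" and y2: "ode_solution F y2" and t: "t \<ge> 0"
    for F :: "'a \<Rightarrow> 'a" and y1 y2 t
  proof -
    define g where "g s = exp (- 2 * L * s) * ((y1 s - y2 s) \<bullet> (y1 s - y2 s))" for s
    have dg: "(g has_real_derivative exp (- 2 * L * s) * (2 * ((y1 s - y2 s) \<bullet> (F (y1 s) - F (y2 s))
        - L * ((y1 s - y2 s) \<bullet> (y1 s - y2 s))))) (at s)" for s
    proof -
      have "((\<lambda>s. y1 s - y2 s) has_vector_derivative F (y1 s) - F (y2 s)) (at s)"
        using y1 y2 by (auto intro!: derivative_eq_intros simp: ode_solution_def)
      then have "((\<lambda>s. (y1 s - y2 s) \<bullet> (y1 s - y2 s)) has_real_derivative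
          2 * ((y1 s - y2 s) \<bullet> (F (y1 s) - F (y2 s)))) (at s)"
        using bounded_bilinear.has_vector_derivative[OF bounded_bilinear_inner]
        by (fastforce simp: has_real_derivative_iff_has_vector_derivative inner_commute)
      moreover have "((\<lambda>s. exp (- 2 * L * s)) has_real_derivative - 2 * L * exp (- 2 * L * s)) (at s)"
        by (auto intro!: derivative_eq_intros)
      ultimately have "(g has_real_derivative (- 2 * L * exp (- 2 * L * s)) * ((y1 s - y2 s) \<bullet> (y1 s - y2 s))
          + (2 * ((y1 s - y2 s) \<bullet> (F (y1 s) - F (y2 s)))) * exp (- 2 * L * s)) (at s)"
        unfolding g_def by (intro DERIV_mult)
      then show ?thesis
        by (rule DERIV_cong) (simp add: algebra_simps)
    qed
    have "g t \<le> g 0"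
    proof (rule DERIV_nonpos_imp_nonincreasing[OF t])
      fix s
      have "(y1 s - y2 s) \<bullet> (F (y1 s) - F (y2 s)) \<le> norm (y1 s - y2 s) * norm (F (y1 s) - F (y2 s))"
        by (rule norm_cauchy_schwarz)
      also have "\<dots> \<le> norm (y1 s - y2 s) * (L * norm (y1 s - y2 s))"
        by (intro mult_left_mono lip) auto
      also have "\<dots> = L * ((y1 s - y2 s) \<bullet> (y1 s - y2 s))"
        by (simp add: dot_square_norm power2_eq_square)
      finally show "\<exists>d. (g has_real_derivative d) (at s) \<and> d \<le> 0"
        by (intro exI[of _ "exp (- 2 * L * s) * (2 * ((y1 s - y2 s) \<bullet> (F (y1 s) - F (y2 s))
        - L * ((y1 s - y2 s) \<bullet> (y1 s - y2 s))))"] conjI dg mult_nonneg_nonpos) auto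
    qed
    then have "(exp (- L * t) * norm (y1 t - y2 t))\<^sup>2 \<le> (norm (y1 0 - y2 0))\<^sup>2"
      unfolding g_def power_mult_distrib dot_square_norm exp_double[symmetric] by (simp add: mult.assoc)
    then have "exp (- L * t) * norm (y1 t - y2 t) \<le> norm (y1 0 - y2 0)"
      by (rule power2_le_imp_le) simp
    then have "exp (L * t) * (exp (- L * t) * norm (y1 t - y2 t)) \<le> exp (L * t) * norm (y1 0 - y2 0)"
      by (intro mult_left_mono) auto
    then show ?thesis by (simp flip: exp_add mult.assoc)
  qed
  show ?thesis
  proof (cases "t \<ge> 0")
    case True then show ?thesis using fwd[OF lip y1 y2] by simp
  next
    case False
    have "norm (y1 (- (- t)) - y2 (- (- t))) \<le> exp (L * (- t)) * norm (y1 (- 0) - y2 (- 0))"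
    proof (rule fwd[OF _ ode_solution_reverse[OF y1] ode_solution_reverse[OF y2]])
      show "norm (- F x - - F y) \<le> L * norm (x - y)" for x y
        using lip[of y x] by (simp add: norm_minus_commute)
    qed (use False in simp)
    then show ?thesis using False by simp
  qed
qed

locale lipschitz_field =
  fixes F :: "'a::euclidean_space \<Rightarrow> 'a" and L :: real
  assumes L_pos: "L > 0" and lip: "\<And>x y. norm (F x - F y) \<le> L * norm (x - y)"
begin

definition flow :: "real \<Rightarrow> 'a \<Rightarrow> 'a"
  where "flow t z = (SOME y. y 0 = z \<and> ode_solution F y) t"

lemma flow_0 [simp]: "flow 0 z = z"
  and ode_solution_flow: "ode_solution F (\<lambda>t. flow t z)"
proof -
  have "\<exists>y. y 0 = z \<and> ode_solution F y"
    using ode_solution_exists[OF L_pos lip, of z] by metis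
  then have "(SOME y. y 0 = z \<and> ode_solution F y) 0 = z \<and>
      ode_solution F (SOME y. y 0 = z \<and> ode_solution F y)"
    by (rule someI_ex)
  then show "flow 0 z = z" "ode_solution F (\<lambda>t. flow t z)"
    by (auto simp: flow_def)
qed

lemma flow_unique: "ode_solution F y \<Longrightarrow> y t = flow t (y 0)"
  using ode_solution_dist[OF lip _ ode_solution_flow, of y t "y 0"] by simp

lemma flow_has_vector_derivative: "((\<lambda>t. flow t z) has_vector_derivative F (flow t z)) (at t)"
  using ode_solution_flow[of z] by (simp add: ode_solution_def)

lemma flow_add: "flow (s + t) z = flow t (flow s z)"
  using flow_unique[OF ode_solution_shift[OF ode_solution_flow[of z], of s], of t] by simp

lemma flow_dist: "norm (flow t z - flow t z') \<le> exp (L * \<bar>t\<bar>) * norm (z - z')"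
  using ode_solution_dist[OF lip ode_solution_flow ode_solution_flow] by simp

lemma continuous_on_flow_time: "continuous_on S (\<lambda>t. flow t z)"
  using flow_has_vector_derivative
  by (meson continuous_at_imp_continuous_on has_vector_derivative_continuous)

text \<open>Dependence on the initial point is Lipschitz, locally uniformly in time; together with
  continuity in time at one fixed initial point this gives joint continuity.\<close>

lemma continuous_on_flow: "continuous_on S (\<lambda>(z, t). flow t z)"
proof -
  have "continuous (at x) (\<lambda>(z, t). flow t z)" for x :: "'a \<times> real"
  proof -
    obtain z t where x: "x = (z, t)" by force
    have lim: "((\<lambda>p. exp (L * \<bar>snd p\<bar>) * norm (fst p - z) + norm (flow (snd p) z - flow t z)) \<longlongrightarrow>
        exp (L * \<bar>t\<bar>) * norm (z - z) + norm (flow t z - flow t z)) (at x)"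
    proof (intro tendsto_intros)
      show "(snd \<longlongrightarrow> t) (at x)" "(fst \<longlongrightarrow> z) (at x)"
        using x by (auto intro!: tendsto_eq_intros)
      then show "((\<lambda>p. flow (snd p) z) \<longlongrightarrow> flow t z) (at x)"
        using continuous_on_flow_time[of UNIV z] 
        by (intro isCont_tendsto_compose[of t "\<lambda>t. flow t z"]) (auto simp: continuous_on_eq_continuous_at)
    qed
    have "((\<lambda>p. (case p of (z, t) \<Rightarrow> flow t z) - flow t z) \<longlongrightarrow> 0) (at x)"
    proof (rule Lim_null_comparison[OF always_eventually])
      show "\<forall>p. norm ((case p of (z, t) \<Rightarrow> flow t z) - flow t z)
          \<le> exp (L * \<bar>snd p\<bar>) * norm (fst p - z) + norm (flow (snd p) z - flow t z)"
      proof
        fix p :: "'a \<times> real"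
        have "norm (flow (snd p) (fst p) - flow t z) \<le>
          norm (flow (snd p) (fst p) - flow (snd p) z) + norm (flow (snd p) z - flow t z)"
          using norm_triangle_ineq[of "flow (snd p) (fst p) - flow (snd p) z" "flow (snd p) z - flow t z"]
          by simp
        then show "norm ((case p of (z, t) \<Rightarrow> flow t z) - flow t z)
          \<le> exp (L * \<bar>snd p\<bar>) * norm (fst p - z) + norm (flow (snd p) z - flow t z)"
          using flow_dist[of "snd p" "fst p" z] by (simp add: case_prod_beta)
      qed
    qed (use lim in simp)
    then show ?thesis
      unfolding continuous_within x by (simp add: LIM_zero_iff)
  qed
  then show ?thesis by (simp add: continuous_at_imp_continuous_on)
qed

end

section \<open>Mechanical Lagrangians and the short-time action\<close>

lemma norm_fst_le_norm: "norm (fst z) \<le> norm z" and norm_snd_le_norm: "norm (snd z) \<le> norm z"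
  by (metis norm_fst_le norm_snd_le prod.collapse)+

lemma has_real_derivative_inner:
  fixes f g :: "real \<Rightarrow> 'a::real_inner"
  assumes "(f has_vector_derivative f') (at t)" "(g has_vector_derivative g') (at t)"
  shows "((\<lambda>s. f s \<bullet> g s) has_real_derivative f t \<bullet> g' + f' \<bullet> g t) (at t)"
  using bounded_bilinear.has_vector_derivative[OF bounded_bilinear_inner assms]
  by (simp add: has_real_derivative_iff_has_vector_derivative)

lemma GDERIV_along_path:
  assumes "GDERIV f (c t) :> D" "(c has_vector_derivative c') (at t)"
  shows "((\<lambda>s. f (c s)) has_real_derivative c' \<bullet> D) (at t)"
proof -
  have "((\<lambda>s. f (c s)) has_derivative (\<lambda>h. (h *\<^sub>R c') \<bullet> D)) (at t)"
    using has_derivative_compose[of c "\<lambda>h. h *\<^sub>R c'" t UNIV f "\<lambda>h. h \<bullet> D"] assms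
    by (simp add: gderiv_def has_vector_derivative_def)
  then show ?thesis
    unfolding has_real_derivative_iff_has_vector_derivative has_vector_derivative_def by simp
qed

text \<open>The mechanical system on the universal cover. The Lipschitz constant \<open>K\<close> of
  the gradient makes all first-order expansions quadratic in their error; \<open>M\<close> and
  \<open>B\<close> bound force and potential, and come from compactness of the torus.\<close>

locale mechanical =
  fixes \<xi> :: "'a::euclidean_space \<Rightarrow> real" and G :: "'a \<Rightarrow> 'a" and K M B :: real
  assumes GD: "\<And>x. GDERIV \<xi> x :> G x"
    and K: "K \<ge> 1" and G_lip: "\<And>x y. norm (G x - G y) \<le> K * norm (x - y)"
    and G_bound: "\<And>x. norm (G x) \<le> M"
    and xi_bound: "\<And>x. \<bar>\<xi> x\<bar> \<le> B"
begin

definition vfield :: "'a \<times> 'a \<Rightarrow> 'a \<times> 'a"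
  where "vfield z = (snd z, - G (fst z))"

sublocale lipschitz_field vfield "1 + K"
proof
  show "1 + K > 0" using K by simp
  fix x y :: "'a \<times> 'a"
  have "norm (vfield x - vfield y) = norm (snd x - snd y, - (G (fst x) - G (fst y)))"
    by (simp add: vfield_def)
  also have "\<dots> \<le> norm (snd x - snd y) + norm (- (G (fst x) - G (fst y)))"
    by (rule norm_Pair_le)
  also have "\<dots> \<le> norm (x - y) + K * norm (x - y)"
  proof (rule add_mono)
    show "norm (snd x - snd y) \<le> norm (x - y)"
      using norm_snd_le_norm[of "x - y"] by simp
    have "norm (G (fst x) - G (fst y)) \<le> K * norm (fst x - fst y)" by (rule G_lip)
    also have "\<dots> \<le> K * norm (x - y)"
      using K norm_fst_le_norm[of "x - y"] by (simp add: mult_left_mono)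
    finally show "norm (- (G (fst x) - G (fst y))) \<le> K * norm (x - y)"
      by (simp add: norm_minus_commute)
  qed
  finally show "norm (vfield x - vfield y) \<le> (1 + K) * norm (x - y)"
    by (simp add: algebra_simps)
qed

lemma pos_deriv: "((\<lambda>t. fst (flow t z)) has_vector_derivative snd (flow t z)) (at t)"
  and vel_deriv: "((\<lambda>t. snd (flow t z)) has_vector_derivative - G (fst (flow t z))) (at t)"
  using flow_has_vector_derivative[of z t] unfolding has_vector_derivative_def vfield_def
  by (auto dest: has_derivative_fst has_derivative_snd)

lemma cont_xi: "continuous_on S \<xi>"
  using GD unfolding gderiv_def
  by (meson continuous_at_imp_continuous_on has_derivative_continuous)

lemma xi_mean_value: obtains y where "y \<in> closed_segment x (x + h)" "\<xi> (x + h) - \<xi> x = h \<bullet> G y"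
proof -
  have d: "((\<lambda>s. \<xi> (x + s *\<^sub>R h)) has_real_derivative h \<bullet> G (x + s *\<^sub>R h)) (at s)" for s
    by (rule GDERIV_along_path[OF GD]) (auto intro!: derivative_eq_intros)
  obtain s :: real where s: "0 < s" "s < 1" "\<xi> (x + 1 *\<^sub>R h) - \<xi> (x + 0 *\<^sub>R h) = (1 - 0) * (h \<bullet> G (x + s *\<^sub>R h))"
    using MVT2[of 0 1 "\<lambda>s. \<xi> (x + s *\<^sub>R h)" "\<lambda>s. h \<bullet> G (x + s *\<^sub>R h)"] d by auto
  have "x + s *\<^sub>R h = (1 - s) *\<^sub>R x + s *\<^sub>R (x + h)"
    by (simp add: algebra_simps)
  then have "x + s *\<^sub>R h \<in> closed_segment x (x + h)"
    using s unfolding in_segment by (intro exI[of _ s]) simp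
  then show ?thesis
    using that[of "x + s *\<^sub>R h"] s by simp
qed

lemma xi_taylor: "\<bar>\<xi> (x + h) - \<xi> x - G x \<bullet> h\<bar> \<le> K * (norm h)\<^sup>2"
proof -
  obtain y where y: "y \<in> closed_segment x (x + h)" "\<xi> (x + h) - \<xi> x = h \<bullet> G y"
    by (rule xi_mean_value)
  have "\<bar>(G y - G x) \<bullet> h\<bar> \<le> norm (G y - G x) * norm h"
    by (rule Cauchy_Schwarz_ineq2)
  also have "\<dots> \<le> (K * norm (y - x)) * norm h"
    by (intro mult_right_mono G_lip) auto
  also have "\<dots> \<le> (K * norm h) * norm h"
    using K segment_bound(1)[OF y(1)] by (intro mult_right_mono mult_left_mono) auto
  finally show ?thesis
    using y by (simp add: power2_eq_square inner_diff_left inner_commute[of h] mult.assoc)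
qed

lemma xi_lipschitz: "\<bar>\<xi> (x + h) - \<xi> x\<bar> \<le> M * norm h"
proof -
  obtain y where y: "\<xi> (x + h) - \<xi> x = h \<bullet> G y"
    by (rule xi_mean_value)
  have "\<bar>h \<bullet> G y\<bar> \<le> norm h * norm (G y)"
    by (rule Cauchy_Schwarz_ineq2)
  also have "\<dots> \<le> norm h * M"
    by (intro mult_left_mono G_bound) auto
  finally show ?thesis using y by (simp add: mult.commute)
qed

lemma M_nonneg: "0 \<le> M" using order_trans[OF norm_ge_zero G_bound] .

section \<open>Minimality of short orbit arcs\<close>

definition lag :: "'a \<Rightarrow> 'a \<Rightarrow> real"
  where "lag x v = (norm v)\<^sup>2 / 2 - \<xi> x"

definition action :: "real \<Rightarrow> 'a \<times> 'a \<Rightarrow> real"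
  where "action t z = integral {0..t} (\<lambda>s. lag (fst (flow s z)) (snd (flow s z)))"

lemma continuous_on_lag:
  "continuous_on S f \<Longrightarrow> continuous_on S g \<Longrightarrow> continuous_on S (\<lambda>s. lag (f s) (g s))"
  unfolding lag_def by (intro continuous_intros continuous_on_compose2[OF cont_xi]) auto

lemma continuous_on_lag_flow: "continuous_on S (\<lambda>s. lag (fst (flow s z)) (snd (flow s z)))"
  by (intro continuous_on_lag continuous_intros continuous_on_flow_time)

lemma lag_flow_integrable: "(\<lambda>s. lag (fst (flow s z)) (snd (flow s z))) integrable_on {a..b}"
  by (intro integrable_continuous_interval continuous_on_lag_flow)

lemma action_add:
  assumes "0 \<le> s" "0 \<le> t"
  shows "action (s + t) z = action s z + action t (flow s z)"
proof -
  have "action (s + t) z = action s z + integral {s..s + t} (\<lambda>r. lag (fst (flow r z)) (snd (flow r z)))"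
    unfolding action_def using assms
    by (intro Henstock_Kurzweil_Integration.integral_combine[symmetric] lag_flow_integrable) auto
  also have "integral {s..s + t} (\<lambda>r. lag (fst (flow r z)) (snd (flow r z)))
      = integral {0..t} ((\<lambda>r. lag (fst (flow r z)) (snd (flow r z))) \<circ> (\<lambda>r. r + s))"
    using integral_shift[where f="\<lambda>r. lag (fst (flow r z)) (snd (flow r z))" and a=0 and b=t and c=s]
      continuous_on_lag_flow by (simp add: add.commute)
  also have "\<dots> = action t (flow s z)"
    unfolding action_def o_def by (simp add: flow_add[symmetric] add.commute)
  finally show ?thesis .
qed

lemma continuous_on_action: "continuous_on S (action t)"
proof -
  have "continuous_on UNIV (\<lambda>z. integral (cbox 0 t) (\<lambda>s. lag (fst (flow s z)) (snd (flow s z))))"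
  proof (rule integral_continuous_on_param)
    have "continuous_on (UNIV \<times> cbox 0 t) (\<lambda>p. case p of (z, t) \<Rightarrow> flow t z)"
      by (rule continuous_on_flow)
    then show "continuous_on (UNIV \<times> cbox 0 t) (\<lambda>(z, s). lag (fst (flow s z)) (snd (flow s z)))"
      by (auto simp: case_prod_beta intro!: continuous_on_lag continuous_intros)
  qed
  then show ?thesis
    unfolding action_def by (auto intro: continuous_on_subset)
qed

text \<open>The quadratic error \<open>K * norm \<eta>\<^sup>2\<close> is absorbed by adding the total derivative of
  \<open>2 * K * s * norm \<eta>\<^sup>2\<close>, which works as long as \<open>8 * K * s\<^sup>2 \<le> 1\<close>.\<close>

lemma action_le_path:
  fixes \<sigma> \<sigma>' :: "real \<Rightarrow> 'a"
  assumes \<sigma>: "\<And>s. (\<sigma> has_vector_derivative \<sigma>' s) (at s)" and c: "continuous_on UNIV \<sigma>'"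
    and \<tau>: "0 \<le> \<tau>" "8 * K * \<tau>\<^sup>2 \<le> 1"
    and ends: "\<sigma> 0 = fst z" "\<sigma> \<tau> = fst (flow \<tau> z)"
  shows "action \<tau> z \<le> integral {0..\<tau>} (\<lambda>s. lag (\<sigma> s) (\<sigma>' s))"
proof -
  define q v \<eta> \<eta>' where "q s = fst (flow s z)" and "v s = snd (flow s z)"
    and "\<eta> s = \<sigma> s - fst (flow s z)" and "\<eta>' s = \<sigma>' s - snd (flow s z)" for s
  define W where "W s = v s \<bullet> \<eta> s - 2 * K * s * (\<eta> s \<bullet> \<eta> s)" for s
  have d\<eta>: "(\<eta> has_vector_derivative \<eta>' s) (at s)" for s
    unfolding \<eta>_def \<eta>'_def by (intro has_vector_derivative_diff \<sigma> pos_deriv)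
  have dv: "(v has_vector_derivative - G (q s)) (at s)" for s
    using vel_deriv unfolding v_def q_def .
  define W' where "W' s = (v s \<bullet> \<eta>' s - G (q s) \<bullet> \<eta> s) - (2 * K * (\<eta> s \<bullet> \<eta> s) + 2 * K * s * (2 * (\<eta> s \<bullet> \<eta>' s)))" for s
  have dW: "(W has_real_derivative W' s) (at s)" for s
    unfolding W_def W'_def
    by (rule derivative_eq_intros has_real_derivative_inner[OF dv d\<eta>] has_real_derivative_inner[OF d\<eta> d\<eta>] refl)+
      (simp add: inner_commute algebra_simps)
  have "(W' has_integral (W \<tau> - W 0)) {0..\<tau>}"
    using \<tau>(1) dW by (intro fundamental_theorem_of_calculus)
      (auto simp: has_real_derivative_iff_has_vector_derivative has_vector_derivative_at_within)
  moreover have "W \<tau> = 0" "W 0 = 0"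
    using ends by (auto simp: W_def \<eta>_def)
  ultimately have W0: "(W' has_integral 0) {0..\<tau>}" by simp
  have "continuous_on UNIV \<sigma>"
    using \<sigma> by (meson continuous_at_imp_continuous_on has_vector_derivative_continuous)
  then have int: "(\<lambda>s. lag (\<sigma> s) (\<sigma>' s)) integrable_on {0..\<tau>}"
    by (intro integrable_continuous_interval continuous_on_lag) (auto intro: continuous_on_subset c)
  have "0 \<le> integral {0..\<tau>} (\<lambda>s. lag (\<sigma> s) (\<sigma>' s)) - action \<tau> z"
    unfolding action_def
  proof (rule has_integral_le[OF W0 has_integral_diff[OF integrable_integral[OF int] integrable_integral[OF lag_flow_integrable]]])
    fix s assume s: "s \<in> {0..\<tau>}"
    have "\<xi> (q s + \<eta> s) - \<xi> (q s) - G (q s) \<bullet> \<eta> s \<le> K * (norm (\<eta> s))\<^sup>2"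
      using xi_taylor[of "q s" "\<eta> s"] by linarith
    then have 1: "\<xi> (\<sigma> s) - \<xi> (q s) - G (q s) \<bullet> \<eta> s \<le> K * (\<eta> s \<bullet> \<eta> s)"
      by (simp add: q_def \<eta>_def power2_norm_eq_inner)
    have 2: "(norm (\<sigma>' s))\<^sup>2 / 2 = (norm (v s))\<^sup>2 / 2 + v s \<bullet> \<eta>' s + (\<eta>' s \<bullet> \<eta>' s) / 2"
      unfolding v_def \<eta>'_def power2_norm_eq_inner by (simp add: algebra_simps inner_commute diff_divide_distrib add_divide_distrib)
    \<comment> \<open>Completing the square: the mixed term of \<open>W'\<close> is absorbed by half
      the square of \<open>\<eta>'\<close>, and the surplus 8 K^2 s^2 |\<eta>|^2 is at most K
      |\<eta>|^2 because the time is short.\<close>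
    have 3: "0 \<le> ((\<eta>' s + (4 * K * s) *\<^sub>R \<eta> s) \<bullet> (\<eta>' s + (4 * K * s) *\<^sub>R \<eta> s)) / 2"
      by simp
    have 4: "((\<eta>' s + (4 * K * s) *\<^sub>R \<eta> s) \<bullet> (\<eta>' s + (4 * K * s) *\<^sub>R \<eta> s)) / 2
      = (\<eta>' s \<bullet> \<eta>' s) / 2 + 2 * K * s * (2 * (\<eta> s \<bullet> \<eta>' s)) + 8 * K * s\<^sup>2 * (K * (\<eta> s \<bullet> \<eta> s))"
      by (simp add: algebra_simps inner_commute power2_eq_square)
    have "8 * K * s\<^sup>2 \<le> 8 * K * \<tau>\<^sup>2"
      using s K by (intro mult_left_mono power_mono) auto
    then have "8 * K * s\<^sup>2 \<le> 1" using \<tau>(2) by linarith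
    then have "8 * K * s\<^sup>2 * (K * (\<eta> s \<bullet> \<eta> s)) \<le> 1 * (K * (\<eta> s \<bullet> \<eta> s))"
      using K by (intro mult_right_mono) auto
    then show "W' s \<le> lag (\<sigma> s) (\<sigma>' s) - lag (fst (flow s z)) (snd (flow s z))"
      using 1 2 3 unfolding 4 W'_def lag_def q_def[symmetric] v_def[symmetric] by linarith
  qed
  then show ?thesis by simp
qed

section \<open>The two-point problem for short times\<close>

definition tmax :: real where "tmax = 1 / (8 * (1 + K) * exp (1 + K))"

lemma tmax_pos: "0 < tmax"
  using K by (simp add: tmax_def)

text \<open>\<open>tmax\<close> is chosen for these three bounds: the first replaces exp((1+K)s) by
  a constant, the second makes orbit arcs minimizing, the third makes the shooting map a
  contraction.\<close>

lemma tmax_bounds: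
  assumes "0 < \<tau>" "\<tau> \<le> tmax"
  shows "\<tau> \<le> 1" "8 * K * \<tau>\<^sup>2 \<le> 1" "\<tau> * (K * exp (1 + K)) \<le> 1/2"
proof -
  have e: "1 \<le> exp (1 + K)" using K by simp
  have t: "8 * (1 + K) * exp (1 + K) * \<tau> \<le> 1"
    using assms K by (simp add: tmax_def pos_le_divide_eq mult.commute)
  have "8 * (1 + K) * 1 * \<tau> \<le> 8 * (1 + K) * exp (1 + K) * \<tau>"
    using e K assms by (intro mult_right_mono mult_left_mono) auto
  then have t2: "8 * (1 + K) * \<tau> \<le> 1" using t by simp
  moreover have "1 * \<tau> \<le> 8 * (1 + K) * \<tau>" using K assms by (intro mult_right_mono) auto
  ultimately show t1: "\<tau> \<le> 1" by simp
  have "8 * K * \<tau>\<^sup>2 \<le> 8 * (1 + K) * \<tau> * 1"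
    unfolding power2_eq_square mult.assoc[symmetric] using t1 K assms
    by (intro mult_mono mult_left_mono mult_right_mono) auto
  then show "8 * K * \<tau>\<^sup>2 \<le> 1" using t2 by simp
  have "2 * K * exp (1 + K) * \<tau> \<le> 8 * (1 + K) * exp (1 + K) * \<tau>"
    using K assms by (intro mult_right_mono) auto
  then show "\<tau> * (K * exp (1 + K)) \<le> 1/2" using t by (simp add: mult.commute mult.left_commute)
qed

text \<open>The forces along the two orbits differ by at most \<open>D\<close>. Integrated twice,
  this moves the difference of positions by at most \<tau>^2 D away from free motion, and the third
  bound of \<open>tmax_bounds\<close> turns one factor \<tau> into 1/2.\<close>

lemma flow_almost_free:
  assumes \<tau>: "0 < \<tau>" "\<tau> \<le> tmax"
  shows "norm (fst (flow \<tau> z) - fst (flow \<tau> z') - (fst z - fst z') - \<tau> *\<^sub>R (snd z - snd z'))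
    \<le> \<tau> / 2 * norm (z - z')"
proof -
  define D where "D = K * exp (1 + K) * norm (z - z')"
  define wq wv where "wq s = fst (flow s z) - fst (flow s z')" and "wv s = snd (flow s z) - snd (flow s z')" for s
  have dq: "(wq has_vector_derivative wv s) (at s)" for s
    unfolding wq_def wv_def by (intro has_vector_derivative_diff pos_deriv)
  have dv: "(wv has_vector_derivative - G (fst (flow s z)) - (- G (fst (flow s z')))) (at s)" for s
    unfolding wv_def by (intro has_vector_derivative_diff vel_deriv)
  have gb: "norm (- G (fst (flow s z)) - (- G (fst (flow s z')))) \<le> D" if "0 < s" "s \<le> \<tau>" for s
  proof -
    have "norm (- G (fst (flow s z)) - (- G (fst (flow s z')))) \<le> K * norm (fst (flow s z) - fst (flow s z'))"
      using G_lip[of "fst (flow s z')" "fst (flow s z)"] by (simp add: norm_minus_commute)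
    also have "\<dots> \<le> K * norm (flow s z - flow s z')"
      using K norm_fst_le_norm[of "flow s z - flow s z'"]
      by (simp add: mult_left_mono)
    also have "\<dots> \<le> K * (exp ((1 + K) * \<bar>s\<bar>) * norm (z - z'))"
      using K by (intro mult_left_mono flow_dist) auto
    also have "\<dots> \<le> K * (exp ((1 + K) * 1) * norm (z - z'))"
      using K that tmax_bounds(1)[OF \<tau>] by (intro mult_left_mono mult_right_mono) auto
    finally show ?thesis by (simp add: D_def)
  qed
  have vb: "norm (wv s - wv 0) \<le> \<tau> * D" if s: "0 < s" "s \<le> \<tau>" for s
  proof -
    have "norm (wv s - wv 0) \<le> s * D - 0 * D"
    proof (rule differentiable_bound_general[OF s(1), where f' = "\<lambda>s. - G (fst (flow s z)) - (- G (fst (flow s z')))" and \<phi>'="\<lambda>_. D"])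
      show "continuous_on {0..s} wv"
        using dv by (meson continuous_at_imp_continuous_on has_vector_derivative_continuous)
      show "((\<lambda>s. s * D) has_vector_derivative D) (at x)" for x
        by (auto intro!: derivative_eq_intros simp flip: has_real_derivative_iff_has_vector_derivative)
    qed (use dv gb s in \<open>auto intro!: continuous_intros\<close>)
    also have "\<dots> \<le> \<tau> * D"
      using s K by (auto simp: D_def intro!: mult_right_mono)
    finally show ?thesis .
  qed
  have "norm ((wq \<tau> - \<tau> *\<^sub>R wv 0) - (wq 0 - 0 *\<^sub>R wv 0)) \<le> \<tau> * (\<tau> * D) - 0 * (\<tau> * D)"
  proof (rule differentiable_bound_general[OF \<tau>(1), where f="\<lambda>s. wq s - s *\<^sub>R wv 0" and f' = "\<lambda>s. wv s - wv 0" and \<phi>="\<lambda>s. s * (\<tau> * D)" and \<phi>'="\<lambda>_. \<tau> * D"])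
    have "continuous_on {0..\<tau>} wq"
      using dq by (meson continuous_at_imp_continuous_on has_vector_derivative_continuous)
    then show "continuous_on {0..\<tau>} (\<lambda>s. wq s - s *\<^sub>R wv 0)"
      by (intro continuous_intros)
    show "((\<lambda>s. s * (\<tau> * D)) has_vector_derivative \<tau> * D) (at x)" for x
      by (auto intro!: derivative_eq_intros simp flip: has_real_derivative_iff_has_vector_derivative)
    show "((\<lambda>s. wq s - s *\<^sub>R wv 0) has_vector_derivative wv x - wv 0) (at x)" for x
      using dq by (auto intro!: derivative_eq_intros)
  qed (use vb in \<open>auto intro!: continuous_intros\<close>)
  also have "\<tau> * (\<tau> * D) - 0 * (\<tau> * D) = \<tau> * (\<tau> * (K * exp (1 + K)) * norm (z - z'))"
    by (simp add: D_def)
  also have "\<dots> \<le> \<tau> * (1/2 * norm (z - z'))"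
    using \<tau> tmax_bounds(3)[OF \<tau>] by (intro mult_left_mono mult_right_mono) auto
  finally show ?thesis
    by (simp add: wq_def wv_def algebra_simps)
qed

text \<open>Shooting: the initial velocity is corrected by the missed displacement divided by the
  time. For free motion one correction would be exact; for nearly free motion the correction is a
  contraction.\<close>

lemma two_point_velocity:
  assumes \<tau>: "0 < \<tau>" "\<tau> \<le> tmax"
  shows "\<exists>v. fst (flow \<tau> (x, v)) = y"
proof -
  define T where "T v = v - (1 / \<tau>) *\<^sub>R (fst (flow \<tau> (x, v)) - y)" for v
  have "dist (T v) (T v') \<le> 1/2 * dist v v'" for v v'
  proof -
    have "norm (fst (flow \<tau> (x, v)) - fst (flow \<tau> (x, v')) - \<tau> *\<^sub>R (v - v')) \<le> \<tau> / 2 * norm (v - v')"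
      using flow_almost_free[OF \<tau>, of "(x, v)" "(x, v')"] by simp
    moreover from \<tau> have "T v - T v' = (- (1 / \<tau>)) *\<^sub>R (fst (flow \<tau> (x, v)) - fst (flow \<tau> (x, v')) - \<tau> *\<^sub>R (v - v'))"
      using \<tau> by (simp add: T_def algebra_simps)
    then have "norm (T v - T v') = (1 / \<tau>) * norm (fst (flow \<tau> (x, v)) - fst (flow \<tau> (x, v')) - \<tau> *\<^sub>R (v - v'))"
      using \<tau> by (simp only: norm_scaleR) simp
    ultimately have "norm (T v - T v') \<le> (1 / \<tau>) * (\<tau> / 2 * norm (v - v'))"
      using \<tau> by (metis mult_left_mono less_imp_le zero_less_divide_1_iff)
    then show ?thesis
      using \<tau> by (simp add: dist_norm)
  qed
  then obtain v where "T v = v"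
    using banach_fix_type[of "1/2" T] by auto
  then have "fst (flow \<tau> (x, v)) = y"
    using \<tau> by (simp add: T_def)
  then show ?thesis ..
qed

definition vel :: "real \<Rightarrow> 'a \<Rightarrow> 'a \<Rightarrow> 'a"
  where "vel \<tau> x y = (SOME v. fst (flow \<tau> (x, v)) = y)"

text \<open>Hamilton's principal function, taken along the connecting orbit instead of as a minimum
  over paths; \<open>S_le_path\<close> recovers the minimality.\<close>

definition S :: "real \<Rightarrow> 'a \<Rightarrow> 'a \<Rightarrow> real"
  where "S \<tau> x y = action \<tau> (x, vel \<tau> x y)"

lemma flow_vel:
  assumes "0 < \<tau>" "\<tau> \<le> tmax"
  shows "fst (flow \<tau> (x, vel \<tau> x y)) = y"
  unfolding vel_def using two_point_velocity[OF assms] by (rule someI_ex)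

text \<open>Both endpoints move here. The part \<tau>/2 |v - v'| of the error is absorbed into the
  left side. The purpose is continuity of \<open>S\<close>, on which minimization over chains
  rests.\<close>

lemma vel_lipschitz:
  assumes \<tau>: "0 < \<tau>" "\<tau> \<le> tmax"
  shows "norm (vel \<tau> x y - vel \<tau> x' y') \<le> 4 / \<tau> * (norm (x - x') + norm (y - y'))"
proof -
  define v v' where "v = vel \<tau> x y" and "v' = vel \<tau> x' y'"
  have "norm (y - y' - (x - x') - \<tau> *\<^sub>R (v - v')) \<le> \<tau> / 2 * norm ((x, v) - (x', v'))"
    using flow_almost_free[OF \<tau>, of "(x, v)" "(x', v')"] by (simp add: v_def v'_def flow_vel[OF \<tau>])
  also have "\<dots> \<le> \<tau> / 2 * (norm (x - x') + norm (v - v'))"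
    using \<tau> norm_Pair_le[of "x - x'" "v - v'"] by (simp add: mult_left_mono)
  finally have 1: "norm (y - y' - (x - x') - \<tau> *\<^sub>R (v - v')) \<le> \<tau> / 2 * (norm (x - x') + norm (v - v'))" .
  have "\<tau> * norm (v - v') = norm ((y - y') - (x - x') - (y - y' - (x - x') - \<tau> *\<^sub>R (v - v')))"
    using \<tau> by simp
  also have "\<dots> \<le> norm (y - y') + norm (x - x') + norm (y - y' - (x - x') - \<tau> *\<^sub>R (v - v'))"
    by (meson norm_triangle_ineq4 order_trans add_right_mono)
  also note 1
  finally have "\<tau> * norm (v - v') \<le> norm (y - y') + norm (x - x') + \<tau> / 2 * (norm (x - x') + norm (v - v'))"
    by simp
  moreover have "\<tau> / 2 * norm (x - x') \<le> 1 * norm (x - x')"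
    using tmax_bounds(1)[OF \<tau>] by (intro mult_right_mono) auto
  ultimately have "\<tau> / 2 * norm (v - v') \<le> norm (y - y') + 2 * norm (x - x')"
    by (simp add: algebra_simps)
  also have "\<dots> \<le> 2 * (norm (x - x') + norm (y - y'))" by simp
  finally show ?thesis
    using \<tau> by (simp add: v_def v'_def field_simps)
qed

lemma continuous_on_vel:
  assumes \<tau>: "0 < \<tau>" "\<tau> \<le> tmax"
  shows "continuous_on UNIV (\<lambda>p. vel \<tau> (fst p) (snd p))"
proof (rule lipschitz_on_continuous_on)
  show "(8 / \<tau>)-lipschitz_on UNIV (\<lambda>p. vel \<tau> (fst p) (snd p))"
  proof (rule lipschitz_onI)
    fix p p' :: "'a \<times> 'a"
    have "dist (vel \<tau> (fst p) (snd p)) (vel \<tau> (fst p') (snd p'))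
       \<le> 4 / \<tau> * (norm (fst (p - p')) + norm (snd (p - p')))"
      using vel_lipschitz[OF \<tau>] by (simp add: dist_norm)
    also have "\<dots> \<le> 4 / \<tau> * (2 * norm (p - p'))"
      using \<tau> norm_fst_le_norm[of "p - p'"] norm_snd_le_norm[of "p - p'"]
      by (intro mult_left_mono) (auto simp del: fst_diff snd_diff)
    finally show "dist (vel \<tau> (fst p) (snd p)) (vel \<tau> (fst p') (snd p')) \<le> 8 / \<tau> * dist p p'"
      by (simp add: dist_norm)
  qed (use \<tau> in auto)
qed

lemma continuous_on_S:
  assumes \<tau>: "0 < \<tau>" "\<tau> \<le> tmax"
    and "continuous_on A f" "continuous_on A g"
  shows "continuous_on A (\<lambda>p. S \<tau> (f p) (g p))"
proof -
  have "continuous_on UNIV (\<lambda>p. S \<tau> (fst p) (snd p))"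
    unfolding S_def
    by (intro continuous_on_compose2[OF continuous_on_action] continuous_intros continuous_on_vel[OF \<tau>]) auto
  then show ?thesis
    using continuous_on_compose2[of UNIV "\<lambda>p. S \<tau> (fst p) (snd p)" A "\<lambda>p. (f p, g p)"] assms
    by (auto intro!: continuous_intros)
qed

section \<open>Bounds for the short-time action\<close>

lemma S_le_path:
  assumes \<tau>: "0 < \<tau>" "\<tau> \<le> tmax"
    and "\<And>s. (\<sigma> has_vector_derivative \<sigma>' s) (at s)" "continuous_on UNIV \<sigma>'"
    and "\<sigma> 0 = x" "\<sigma> \<tau> = y"
  shows "S \<tau> x y \<le> integral {0..\<tau>} (\<lambda>s. lag (\<sigma> s) (\<sigma>' s))"
  unfolding S_def using assms tmax_bounds(2)[OF \<tau>]
  by (intro action_le_path) (auto simp: flow_vel)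

text \<open>The competitor is the segment run at constant speed, with \<xi> frozen at the starting
  point at the cost of its Lipschitz constant. The right-hand side is the source of
  \<open>cost\<close>.\<close>

lemma S_le_straight:
  assumes \<tau>: "0 < \<tau>" "\<tau> \<le> tmax"
  shows "S \<tau> x y \<le> (norm (y - x))\<^sup>2 / (2 * \<tau>) - \<tau> * \<xi> x + M * \<tau> * norm (y - x)"
proof -
  define e where "e = (1 / \<tau>) *\<^sub>R (y - x)"
  define C where "C = (norm e)\<^sup>2 / 2 - \<xi> x + M * norm (y - x)"
  have ye: "\<tau> *\<^sub>R e = y - x" using \<tau> by (simp add: e_def)
  have "S \<tau> x y \<le> integral {0..\<tau>} (\<lambda>s. lag (x + s *\<^sub>R e) e)"
    using ye by (intro S_le_path \<tau>) (auto intro!: derivative_eq_intros continuous_intros)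
  also have "\<dots> \<le> integral {0..\<tau>} (\<lambda>s. C)"
  proof (rule integral_le)
    show "(\<lambda>s. lag (x + s *\<^sub>R e) e) integrable_on {0..\<tau>}"
      by (intro integrable_continuous_interval continuous_on_lag continuous_intros)
    fix s assume s: "s \<in> {0..\<tau>}"
    have "norm (s *\<^sub>R e) \<le> norm (\<tau> *\<^sub>R e)" using s by (simp add: mult_right_mono)
    then have "M * norm (s *\<^sub>R e) \<le> M * norm (y - x)"
      unfolding ye by (intro mult_left_mono M_nonneg)
    then show "lag (x + s *\<^sub>R e) e \<le> C"
      using xi_lipschitz[of x "s *\<^sub>R e"] by (simp add: lag_def C_def)
  qed auto
  also have "\<dots> = \<tau> * C" using \<tau> by simp
  also have "\<dots> = (norm (y - x))\<^sup>2 / (2 * \<tau>) - \<tau> * \<xi> x + M * \<tau> * norm (y - x)"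
  proof -
    have "\<tau> * (norm e)\<^sup>2 = (norm (y - x))\<^sup>2 / \<tau>"
      using \<tau> by (simp add: e_def power_mult_distrib power2_eq_square)
    then show ?thesis by (simp add: C_def algebra_simps)
  qed
  finally show ?thesis .
qed

text \<open>With the mean velocity e, Young's inequality gives v.e - |e|^2/2 \<le> |v|^2/2 along the
  orbit, and the integral of v.e depends on the endpoints only.\<close>

lemma S_coercive:
  assumes \<tau>: "0 < \<tau>" "\<tau> \<le> tmax"
  shows "(norm (y - x))\<^sup>2 / (2 * \<tau>) - \<tau> * B \<le> S \<tau> x y"
proof -
  define e z where "e = (1 / \<tau>) *\<^sub>R (y - x)" and "z = (x, vel \<tau> x y)"
  have ye: "\<tau> *\<^sub>R e = y - x" using \<tau> by (simp add: e_def)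
  have "((\<lambda>s. fst (flow s z) \<bullet> e - s * ((e \<bullet> e) / 2 + B)) has_real_derivative snd (flow s z) \<bullet> e - ((e \<bullet> e) / 2 + B)) (at s)" for s
    by (rule derivative_eq_intros has_real_derivative_inner[OF pos_deriv has_vector_derivative_const] refl)+ simp
  then have "((\<lambda>s. snd (flow s z) \<bullet> e - ((e \<bullet> e) / 2 + B)) has_integral
      (fst (flow \<tau> z) \<bullet> e - \<tau> * ((e \<bullet> e) / 2 + B)) - (fst (flow 0 z) \<bullet> e - 0 * ((e \<bullet> e) / 2 + B))) {0..\<tau>}"
    using \<tau>(1) by (intro fundamental_theorem_of_calculus)
      (auto simp: has_real_derivative_iff_has_vector_derivative has_vector_derivative_at_within)
  moreover have "(fst (flow \<tau> z) \<bullet> e - \<tau> * ((e \<bullet> e) / 2 + B)) - (fst (flow 0 z) \<bullet> e - 0 * ((e \<bullet> e) / 2 + B))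
     = (norm (y - x))\<^sup>2 / (2 * \<tau>) - \<tau> * B"
  proof -
    have "(fst (flow \<tau> z) \<bullet> e - \<tau> * ((e \<bullet> e) / 2 + B)) - (fst (flow 0 z) \<bullet> e - 0 * ((e \<bullet> e) / 2 + B))
      = (y - x) \<bullet> e - \<tau> * (e \<bullet> e) / 2 - \<tau> * B"
      by (simp add: z_def flow_vel[OF \<tau>] algebra_simps)
    also have "(y - x) \<bullet> e = (norm (y - x))\<^sup>2 / \<tau>" by (simp add: e_def power2_norm_eq_inner)
    also have "\<tau> * (e \<bullet> e) = (norm (y - x))\<^sup>2 / \<tau>"
      using \<tau> by (simp add: e_def power2_norm_eq_inner)
    finally show ?thesis by simp
  qed
  ultimately have int: "((\<lambda>s. snd (flow s z) \<bullet> e - ((e \<bullet> e) / 2 + B)) has_integral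
      (norm (y - x))\<^sup>2 / (2 * \<tau>) - \<tau> * B) {0..\<tau>}" by simp
  show ?thesis
    unfolding S_def action_def z_def[symmetric]
  proof (rule has_integral_le[OF int integrable_integral[OF lag_flow_integrable]])
    fix s
    have "0 \<le> (snd (flow s z) - e) \<bullet> (snd (flow s z) - e)" by simp
    then have "snd (flow s z) \<bullet> e - (e \<bullet> e) / 2 \<le> (norm (snd (flow s z)))\<^sup>2 / 2"
      unfolding power2_norm_eq_inner by (simp add: algebra_simps inner_commute)
    then show "snd (flow s z) \<bullet> e - ((e \<bullet> e) / 2 + B) \<le> lag (fst (flow s z)) (snd (flow s z))"
      using xi_bound[of "fst (flow s z)"] by (simp add: lag_def)
  qed
qed

text \<open>The orbit displaced by the linear interpolation from \<open>a\<close> to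
  \<open>b\<close> is a competitor. By the equation of motion the first-order terms are the exact
  derivative of velocity times displacement, so they reduce to end momenta: this is dS = p dy - p dx
  as an upper bound. In the error, 1/\<tau> is the kinetic energy of the displacement and \<tau> K
  the Taylor remainder of \<xi>.\<close>

lemma S_perturb:
  assumes \<tau>: "0 < \<tau>" "\<tau> \<le> tmax"
  shows "S \<tau> (x + a) (y + b) \<le> S \<tau> x y + snd (flow \<tau> (x, vel \<tau> x y)) \<bullet> b - vel \<tau> x y \<bullet> a
    + (1 / \<tau> + \<tau> * K) * ((norm a)\<^sup>2 + (norm b)\<^sup>2)"
proof -
  define z e where "z = (x, vel \<tau> x y)" and "e = (1 / \<tau>) *\<^sub>R (b - a)"
  define \<eta> where "\<eta> s = a + s *\<^sub>R e" for s
  define C where "C = (1 / \<tau>\<^sup>2 + K) * ((norm a)\<^sup>2 + (norm b)\<^sup>2)"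
  have \<eta>\<tau>: "\<eta> \<tau> = b" "\<eta> 0 = a" using \<tau> by (auto simp: \<eta>_def e_def)
  have d\<eta>: "(\<eta> has_vector_derivative e) (at s)" for s
    unfolding \<eta>_def by (auto intro!: derivative_eq_intros)
  define W W' where "W s = snd (flow s z) \<bullet> \<eta> s + s * C"
    and "W' s = snd (flow s z) \<bullet> e - G (fst (flow s z)) \<bullet> \<eta> s + C" for s
  have dW: "(W has_real_derivative W' s) (at s)" for s
    unfolding W_def W'_def
    by (rule derivative_eq_intros has_real_derivative_inner[OF vel_deriv d\<eta>] refl)+ simp
  then have W: "(W' has_integral W \<tau> - W 0) {0..\<tau>}"
    using \<tau>(1) by (intro fundamental_theorem_of_calculus)
      (auto simp: has_real_derivative_iff_has_vector_derivative has_vector_derivative_at_within)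
  have cfl: "continuous_on A (\<lambda>s. flow s z)" for A by (rule continuous_on_flow_time)
  have "S \<tau> (x + a) (y + b) \<le> integral {0..\<tau>} (\<lambda>s. lag (fst (flow s z) + \<eta> s) (snd (flow s z) + e))"
  proof (rule S_le_path[OF \<tau>])
    show "((\<lambda>s. fst (flow s z) + \<eta> s) has_vector_derivative snd (flow s z) + e) (at s)" for s
      by (intro has_vector_derivative_add pos_deriv d\<eta>)
    show "continuous_on UNIV (\<lambda>s. snd (flow s z) + e)"
      by (intro continuous_intros cfl)
  qed (simp_all add: \<eta>\<tau> z_def flow_vel[OF \<tau>])
  also have "\<dots> \<le> S \<tau> x y + (W \<tau> - W 0)"
    unfolding S_def action_def z_def[symmetric]
  proof (rule has_integral_le[OF integrable_integral has_integral_add[OF integrable_integral[OF lag_flow_integrable] W]])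
    show "(\<lambda>s. lag (fst (flow s z) + \<eta> s) (snd (flow s z) + e)) integrable_on {0..\<tau>}"
      unfolding \<eta>_def by (intro integrable_continuous_interval continuous_on_lag continuous_intros cfl)
    fix s assume s: "s \<in> {0..\<tau>}"
    define \<theta> where "\<theta> = s / \<tau>"
    have \<theta>: "0 \<le> \<theta>" "\<theta> \<le> 1" using s \<tau> by (auto simp: \<theta>_def)
    have "\<eta> s = (1 - \<theta>) *\<^sub>R a + \<theta> *\<^sub>R b"
      by (simp add: \<eta>_def e_def \<theta>_def algebra_simps)
    then have "norm (\<eta> s) \<le> (1 - \<theta>) * norm a + \<theta> * norm b"
      using \<theta> norm_triangle_ineq[of "(1 - \<theta>) *\<^sub>R a" "\<theta> *\<^sub>R b"] by simp
    also have "\<dots> \<le> max (norm a) (norm b)"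
      using \<theta> by (intro convex_bound_le) auto
    finally have "(norm (\<eta> s))\<^sup>2 \<le> (max (norm a) (norm b))\<^sup>2"
      by (intro power_mono) auto
    also have "\<dots> \<le> (norm a)\<^sup>2 + (norm b)\<^sup>2" by (auto simp: max_def)
    finally have 1: "K * (norm (\<eta> s))\<^sup>2 \<le> K * ((norm a)\<^sup>2 + (norm b)\<^sup>2)"
      using K by (intro mult_left_mono) auto
    have "(b - a) \<bullet> (b - a) + (b + a) \<bullet> (b + a) = 2 * ((norm a)\<^sup>2 + (norm b)\<^sup>2)"
      unfolding power2_norm_eq_inner by (simp add: algebra_simps inner_commute)
    then have "(b - a) \<bullet> (b - a) \<le> 2 * ((norm a)\<^sup>2 + (norm b)\<^sup>2)"
      using inner_ge_zero[of "b + a"] by linarith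
    then have 2: "(e \<bullet> e) / 2 \<le> 1 / \<tau>\<^sup>2 * ((norm a)\<^sup>2 + (norm b)\<^sup>2)"
    proof -
      have "e \<bullet> e = (1 / \<tau>\<^sup>2) * ((b - a) \<bullet> (b - a))"
        by (simp add: e_def power2_eq_square)
      also have "\<dots> \<le> (1 / \<tau>\<^sup>2) * (2 * ((norm a)\<^sup>2 + (norm b)\<^sup>2))"
        using \<open>(b - a) \<bullet> (b - a) \<le> _\<close> by (intro mult_left_mono) auto
      finally show ?thesis by (simp add: mult.commute)
    qed
    have 3: "(norm (snd (flow s z) + e))\<^sup>2 / 2 = (norm (snd (flow s z)))\<^sup>2 / 2 + snd (flow s z) \<bullet> e + (e \<bullet> e) / 2"
      unfolding power2_norm_eq_inner by (simp add: algebra_simps inner_commute)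
    have "C = 1 / \<tau>\<^sup>2 * ((norm a)\<^sup>2 + (norm b)\<^sup>2) + K * ((norm a)\<^sup>2 + (norm b)\<^sup>2)"
      by (simp add: C_def algebra_simps)
    then show "lag (fst (flow s z) + \<eta> s) (snd (flow s z) + e)
       \<le> lag (fst (flow s z)) (snd (flow s z)) + W' s"
      unfolding lag_def W'_def 3
      using 1 2 xi_taylor[of "fst (flow s z)" "\<eta> s"] by linarith
  qed
  also have "W \<tau> - W 0 = snd (flow \<tau> z) \<bullet> b - vel \<tau> x y \<bullet> a + \<tau> * C"
    by (simp add: W_def \<eta>\<tau>) (simp add: z_def)
  also have "\<tau> * C = (1 / \<tau> + \<tau> * K) * ((norm a)\<^sup>2 + (norm b)\<^sup>2)"
    using \<tau> by (simp add: C_def power2_eq_square field_simps)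
  finally show ?thesis by (simp add: z_def)
qed

end

section \<open>Periodic orbits from closed chains\<close>

definition lattice_vec :: "real ^ 'n \<Rightarrow> bool"
  where "lattice_vec m \<longleftrightarrow> (\<forall>i. m $ i \<in> \<int>)"

lemma lattice_vec_0 [simp]: "lattice_vec 0"
  and lattice_vec_add: "lattice_vec m \<Longrightarrow> lattice_vec m' \<Longrightarrow> lattice_vec (m + m')"
  and lattice_vec_minus: "lattice_vec m \<Longrightarrow> lattice_vec (- m)"
  by (auto simp: lattice_vec_def)

lemma lattice_translate_to_cube:
  fixes x :: "real ^ 'n"
  obtains m where "lattice_vec m" "x + m \<in> cbox 0 1"
proof
  define m :: "real ^ 'n" where "m = (\<chi> i. - of_int \<lfloor>x $ i\<rfloor>)"
  show "lattice_vec m"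
    by (simp add: lattice_vec_def m_def)
  have "0 \<le> x $ i - of_int \<lfloor>x $ i\<rfloor> \<and> x $ i - of_int \<lfloor>x $ i\<rfloor> \<le> 1" for i
    by linarith
  then show "x + m \<in> cbox 0 1"
    by (simp add: mem_box_cart m_def)
qed

lemma sum_cyclic_shift:
  fixes g :: "nat \<Rightarrow> 'a::ab_group_add"
  assumes "g N = g 0"
  shows "(\<Sum>j<N. g (Suc j)) = (\<Sum>j<N. g j)"
  using sum.lessThan_Suc_shift[of g N] sum.lessThan_Suc[of g N] assms by simp

text \<open>Tychonoff's theorem, for chains represented as infinite sequences of vertices.\<close>

lemma compact_pointwise_product:
  fixes A :: "nat \<Rightarrow> 'a::metric_space set"
  assumes "\<And>i. compact (A i)"
  shows "compact {x. \<forall>i. x i \<in> A i}"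
proof -
  have "compactin (product_topology (\<lambda>_. euclidean) UNIV) (PiE UNIV A)"
    using assms by (subst compactin_PiE) auto
  moreover have "PiE UNIV A = {x. \<forall>i. x i \<in> A i}" by auto
  ultimately show ?thesis
    by (simp add: euclidean_product_topology)
qed

locale periodic_mechanical = mechanical \<xi> G K M B
  for \<xi> :: "real ^ 'n \<Rightarrow> real" and G :: "real ^ 'n \<Rightarrow> real ^ 'n" and K M B :: real +
  assumes xi_periodic: "\<And>x m. lattice_vec m \<Longrightarrow> \<xi> (x + m) = \<xi> x"
    and G_periodic: "\<And>x m. lattice_vec m \<Longrightarrow> G (x + m) = G x"
begin

lemma flow_translate:
  assumes "lattice_vec m"
  shows "flow t (x + m, v) = flow t (x, v) + (m, 0)"
proof -
  have "ode_solution vfield (\<lambda>t. flow t (x, v) + (m, 0))"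
    unfolding ode_solution_def
  proof
    fix t
    have "vfield (flow t (x, v) + (m, 0)) = vfield (flow t (x, v))"
      using G_periodic[OF assms] by (simp add: vfield_def)
    then show "((\<lambda>t. flow t (x, v) + (m, 0)) has_vector_derivative vfield (flow t (x, v) + (m, 0))) (at t)"
      using flow_has_vector_derivative[of "(x, v)" t] by (auto intro!: derivative_eq_intros)
  qed
  from flow_unique[OF this, of t] show ?thesis by simp
qed

lemma action_translate:
  assumes "lattice_vec m"
  shows "action t (x + m, v) = action t (x, v)"
  unfolding action_def flow_translate[OF assms] lag_def by (simp add: xi_periodic[OF assms])

lemma S_translate:
  assumes "lattice_vec m"
  shows "S \<tau> (x + m) (y + m) = S \<tau> x y"
proof -
  have "vel \<tau> (x + m) (y + m) = vel \<tau> x y"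
    unfolding vel_def flow_translate[OF assms] by simp
  then show ?thesis
    by (simp add: S_def action_translate[OF assms])
qed

text \<open>Coercivity confines the vertices to a compact set, once the first vertex has been moved to
  the unit cube by a lattice translation.\<close>

lemma closed_chain_minimizer:
  fixes N :: nat and \<tau> :: "nat \<Rightarrow> real" and m :: "real ^ 'n"
  assumes N: "0 < N" and \<tau>: "\<And>i. 0 < \<tau> i" "\<And>i. \<tau> i \<le> tmax" and m: "lattice_vec m"
    and y: "y N = y 0 + m"
  obtains x where "x N = x 0 + m"
    "\<And>x'. x' N = x' 0 + m \<Longrightarrow> (\<Sum>i<N. S (\<tau> i) (x i) (x (Suc i))) \<le> (\<Sum>i<N. S (\<tau> i) (x' i) (x' (Suc i)))"
proof -
  define f where "f x = (\<Sum>i<N. S (\<tau> i) (x i) (x (Suc i)))" for x :: "nat \<Rightarrow> real ^ 'n"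
  have B0: "0 \<le> B" using xi_bound[of 0] by linarith
  \<comment> \<open>A bound for the length of one edge: every other edge contributes at least - tmax
    B to the action, so an action of at most \<open>f y\<close> leaves this much for the remaining
    one.\<close>
  define r where "r = sqrt (2 * tmax * (f y + N * (tmax * B)))"
  obtain b where b: "\<And>x :: real ^ 'n. x \<in> cbox 0 1 \<Longrightarrow> norm x \<le> b" "b > 0"
    using bounded_cbox[of "0 :: real ^ 'n" 1] unfolding bounded_pos by blast
  define C where "C = {x :: nat \<Rightarrow> real ^ 'n. \<forall>i. norm (x i) \<le> b + real i * r} \<inter> {x. x N = x 0 + m}"
  have "compact {x :: nat \<Rightarrow> real ^ 'n. \<forall>i. norm (x i) \<le> b + real i * r}"
    using compact_pointwise_product[of "\<lambda>i. cball (0 :: real ^ 'n) (b + real i * r)"] by simp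
  moreover have "closed {x :: nat \<Rightarrow> real ^ 'n. x N = x 0 + m}"
    by (intro closed_Collect_eq continuous_intros continuous_on_product_coordinates)
  ultimately have C: "compact C" unfolding C_def by (rule compact_Int_closed)
  have cf: "continuous_on C f"
    unfolding f_def using \<tau>
    by (intro continuous_intros continuous_on_S continuous_on_subset[OF continuous_on_product_coordinates]) auto
  have reduce: "\<exists>x'\<in>C. f x' = f x" if x: "x N = x 0 + m" and fx: "f x \<le> f y" for x
  proof -
    obtain k where k: "lattice_vec k" "x 0 + k \<in> cbox 0 1"
      by (rule lattice_translate_to_cube)
    \<comment> \<open>A chain is an infinite sequence of which only the vertices up to
      \<open>N\<close> matter. The others are set to 0, since membership in the compact set
      \<open>C\<close> restrains them too.\<close>
    define x' where "x' i = (if i \<le> N then x i + k else 0)" for i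
    have fx': "f x' = f x"
      unfolding f_def by (intro sum.cong) (auto simp: x'_def S_translate[OF k(1)])
    have step: "norm (x' (Suc i) - x' i) \<le> r" if i: "i < N" for i
    proof -
      have lo: "- (tmax * B) \<le> S (\<tau> j) (x' j) (x' (Suc j))" for j
      proof -
        have "- (tmax * B) \<le> 0 - \<tau> j * B" using \<tau>[of j] B0 by (simp add: mult_right_mono)
        also have "\<dots> \<le> (norm (x' (Suc j) - x' j))\<^sup>2 / (2 * \<tau> j) - \<tau> j * B"
          using \<tau>(1)[of j] by (intro diff_mono) auto
        also have "\<dots> \<le> S (\<tau> j) (x' j) (x' (Suc j))" by (rule S_coercive[OF \<tau>])
        finally show ?thesis .
      qed
      have "(norm (x' (Suc i) - x' i))\<^sup>2 / (2 * tmax) \<le> (norm (x' (Suc i) - x' i))\<^sup>2 / (2 * \<tau> i)"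
        using \<tau>[of i] by (intro divide_left_mono) (auto simp: tmax_pos)
      also have "\<dots> \<le> S (\<tau> i) (x' i) (x' (Suc i)) + \<tau> i * B"
        using S_coercive[OF \<tau>(1)[of i] \<tau>(2)[of i], of "x' (Suc i)" "x' i"] by simp
      also have "\<dots> \<le> S (\<tau> i) (x' i) (x' (Suc i)) + tmax * B"
        using \<tau>[of i] B0 by (simp add: mult_right_mono)
      also have "S (\<tau> i) (x' i) (x' (Suc i)) + tmax * B \<le> (\<Sum>j<N. S (\<tau> j) (x' j) (x' (Suc j)) + tmax * B)"
      proof (rule member_le_sum[of i "{..<N}" "\<lambda>j. S (\<tau> j) (x' j) (x' (Suc j)) + tmax * B"])
        show "0 \<le> S (\<tau> j) (x' j) (x' (Suc j)) + tmax * B" for j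
          using lo[of j] by linarith
      qed (use i in auto)
      also have "\<dots> = f x' + N * (tmax * B)"
        by (simp add: f_def sum.distrib)
      also have "\<dots> \<le> f y + N * (tmax * B)" using fx fx' by simp
      finally have "(norm (x' (Suc i) - x' i))\<^sup>2 \<le> 2 * tmax * (f y + N * (tmax * B))"
        using tmax_pos by (simp add: field_simps)
      then show ?thesis unfolding r_def by (rule real_le_rsqrt)
    qed
    have "norm (x' i) \<le> b + real i * r" if "i \<le> N" for i
      using that
    proof (induction i)
      case 0 show ?case using b(1)[OF k(2)] by (simp add: x'_def)
    next
      case (Suc i)
      have "norm (x' (Suc i)) \<le> norm (x' i) + norm (x' (Suc i) - x' i)"
        by (metis add.commute diff_add_cancel norm_triangle_ineq)
      then show ?case using Suc step[of i] by (simp add: algebra_simps)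
    qed
    moreover have "norm (x' i) \<le> b + real i * r" if "\<not> i \<le> N" for i
    proof -
      have "0 \<le> r"
        using order_trans[OF norm_ge_zero step[of 0]] N by simp
      then show ?thesis using that b(2) by (simp add: x'_def)
    qed
    ultimately have "x' \<in> C"
      using x by (auto simp: C_def x'_def)
    then show ?thesis using fx' by blast
  qed
  obtain x0 where "x0 \<in> C" using reduce[of y] y by auto
  then obtain x where x: "x \<in> C" "\<And>x'. x' \<in> C \<Longrightarrow> f x \<le> f x'"
    using continuous_attains_inf[OF C _ cf] by blast
  show ?thesis
  proof (rule that[of x])
    show "x N = x 0 + m" using x(1) by (simp add: C_def)
    fix x' assume x': "x' N = x' 0 + m"
    have "f x \<le> f y" using reduce[OF y] x(2) by (metis order_refl)
    then show "(\<Sum>i<N. S (\<tau> i) (x i) (x (Suc i))) \<le> (\<Sum>i<N. S (\<tau> i) (x' i) (x' (Suc i)))"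
      using reduce[OF x'] x(2) unfolding f_def[symmetric] by (metis linear order_trans)
  qed
qed

text \<open>Moving every vertex of a minimizer against the velocity jump there changes the action at
  first order by minus the sum of the squared jumps, so that there are no jumps.\<close>

lemma periodic_orbit_below_chain:
  fixes N :: nat and \<tau> :: "nat \<Rightarrow> real"
  assumes N: "0 < N" and \<tau>: "\<And>i. 0 < \<tau> i" "\<And>i. \<tau> i \<le> tmax" and m: "lattice_vec m"
    and y: "y N = y 0 + m"
  obtains x v where "flow (\<Sum>i<N. \<tau> i) (x, v) = (x + m, v)"
    "action (\<Sum>i<N. \<tau> i) (x, v) \<le> (\<Sum>i<N. S (\<tau> i) (y i) (y (Suc i)))"
proof -
  obtain x where xN: "x N = x 0 + m"
    and min: "\<And>x'. x' N = x' 0 + m \<Longrightarrow> (\<Sum>i<N. S (\<tau> i) (x i) (x (Suc i))) \<le> (\<Sum>i<N. S (\<tau> i) (x' i) (x' (Suc i)))"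
    by (rule closed_chain_minimizer[where \<tau>=\<tau>, OF N \<tau> m y]) (rule that)
  define v w where "v j = vel (\<tau> j) (x j) (x (Suc j))"
    and "w j = snd (flow (\<tau> j) (x j, vel (\<tau> j) (x j) (x (Suc j))))" for j
  have fl: "flow (\<tau> j) (x j, v j) = (x (Suc j), w j)" for j
    using flow_vel[OF \<tau>] by (simp add: v_def w_def prod_eq_iff)
  \<comment> \<open>\<open>w' j\<close> is the velocity arriving at vertex \<open>j\<close>. Vertex
    0 receives that of the last edge, because the chain closes up on the torus; likewise the jump
    \<open>d\<close> identifies the index \<open>N\<close> with 0.\<close>
  define w' where "w' j = (case j of 0 \<Rightarrow> w (N - 1) | Suc i \<Rightarrow> w i)" for j
  define d where "d j = (let i = if j = N then 0 else j in w' i - v i)" for j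
  have w'N: "w' N = w' 0" using N by (cases N) (auto simp: w'_def)
  have dN: "d N = d 0" by (simp add: d_def)
  define Q where "Q = (\<Sum>j<N. (norm (d j))\<^sup>2)"
  define C where "C = (\<Sum>j<N. (1 / \<tau> j + \<tau> j * K) * ((norm (d j))\<^sup>2 + (norm (d (Suc j)))\<^sup>2))"
  have first_variation: "(\<Sum>j<N. w j \<bullet> d (Suc j) - v j \<bullet> d j) = Q"
  proof -
    have "(\<Sum>j<N. w j \<bullet> d (Suc j)) = (\<Sum>j<N. w' (Suc j) \<bullet> d (Suc j))"
      by (simp add: w'_def)
    also have "\<dots> = (\<Sum>j<N. w' j \<bullet> d j)"
      by (rule sum_cyclic_shift) (simp add: dN w'N)
    finally have "(\<Sum>j<N. w j \<bullet> d (Suc j) - v j \<bullet> d j) = (\<Sum>j<N. (w' j - v j) \<bullet> d j)"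
      by (simp add: sum_subtractf inner_diff_left)
    also have "\<dots> = Q"
      unfolding Q_def by (intro sum.cong) (auto simp: d_def power2_norm_eq_inner)
    finally show ?thesis .
  qed
  have ineq: "s * Q \<le> s\<^sup>2 * C" for s
  proof -
    \<comment> \<open>Since \<open>d N = d 0\<close>, the displaced chain closes up with the same
      lattice vector \<open>m\<close> and is an admissible competitor.\<close>
    define x' where "x' j = x j + (- s) *\<^sub>R d j" for j
    have "(\<Sum>i<N. S (\<tau> i) (x i) (x (Suc i))) \<le> (\<Sum>i<N. S (\<tau> i) (x' i) (x' (Suc i)))"
      by (rule min) (simp add: x'_def xN dN)
    also have "\<dots> \<le> (\<Sum>i<N. S (\<tau> i) (x i) (x (Suc i)) - s * (w i \<bullet> d (Suc i) - v i \<bullet> d i)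
        + s\<^sup>2 * ((1 / \<tau> i + \<tau> i * K) * ((norm (d i))\<^sup>2 + (norm (d (Suc i)))\<^sup>2)))"
    proof (rule sum_mono)
      fix i
      show "S (\<tau> i) (x' i) (x' (Suc i)) \<le> S (\<tau> i) (x i) (x (Suc i)) - s * (w i \<bullet> d (Suc i) - v i \<bullet> d i)
        + s\<^sup>2 * ((1 / \<tau> i + \<tau> i * K) * ((norm (d i))\<^sup>2 + (norm (d (Suc i)))\<^sup>2))"
        using S_perturb[OF \<tau>(1)[of i] \<tau>(2)[of i], of "x i" "(- s) *\<^sub>R d i" "x (Suc i)" "(- s) *\<^sub>R d (Suc i)"]
        unfolding v_def[symmetric] w_def[symmetric] x'_def
        by (simp add: fl power_mult_distrib algebra_simps)
    qed
    also have "\<dots> = (\<Sum>i<N. S (\<tau> i) (x i) (x (Suc i))) - s * Q + s\<^sup>2 * C"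
      unfolding first_variation[symmetric] C_def sum_distrib_left
      by (simp only: sum.distrib sum_subtractf)
    finally show ?thesis by simp
  qed
  have "Q \<le> 0"
  proof (rule ccontr)
    assume "\<not> Q \<le> 0"
    then have Q: "Q > 0" by simp
    have C0: "C > 0" using ineq[of 1] Q by simp
    \<comment> \<open>A small step makes the linear gain beat the quadratic error: s = Q/(2C) would
      give Q^2/(2C) \<le> Q^2/(4C).\<close>
    have "(Q / (2 * C)) * Q \<le> (Q / (2 * C))\<^sup>2 * C" by (rule ineq)
    then show False using Q C0 by (simp add: power2_eq_square field_simps)
  qed
  then have "(\<Sum>j<N. (norm (d j))\<^sup>2) = 0"
    unfolding Q_def by (intro antisym sum_nonneg) auto
  then have d0: "d j = 0" if "j < N" for j
    using that by (simp add: sum_nonneg_eq_0_iff)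
  have wv: "w j = v (Suc j)" if "Suc j < N" for j
    using d0[OF that] that by (simp add: d_def w'_def)
  have wlast: "w (N - 1) = v 0"
    using d0[OF N] N by (simp add: d_def w'_def)
  \<comment> \<open>Restricted to \<open>j < N\<close>, because \<open>v N\<close> belongs to an
    edge beyond the chain. The last edge is attached separately, and \<open>wlast\<close> returns it
    to the initial velocity.\<close>
  have glue: "flow (\<Sum>i<j. \<tau> i) (x 0, v 0) = (x j, v j) \<and>
      action (\<Sum>i<j. \<tau> i) (x 0, v 0) = (\<Sum>i<j. S (\<tau> i) (x i) (x (Suc i)))" if "j < N" for j
    using that
  proof (induction j)
    case 0 show ?case by (simp add: action_def)
  next
    case (Suc j)
    have "0 \<le> (\<Sum>i<j. \<tau> i)" using \<tau>(1) by (simp add: sum_nonneg less_imp_le)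
    then show ?case
      using Suc fl[of j] wv[of j] less_imp_le[OF \<tau>(1)[of j]]
      by (simp add: flow_add action_add S_def v_def)
  qed
  obtain n where n: "N = Suc n" using N by (cases N) auto
  have "0 \<le> (\<Sum>i<n. \<tau> i)" using \<tau>(1) by (simp add: sum_nonneg less_imp_le)
  then have "flow (\<Sum>i<N. \<tau> i) (x 0, v 0) = (x 0 + m, v 0)"
    and "action (\<Sum>i<N. \<tau> i) (x 0, v 0) = (\<Sum>i<N. S (\<tau> i) (x i) (x (Suc i)))"
    using glue[of n] n fl[of n] xN wlast less_imp_le[OF \<tau>(1)[of n]]
    by (simp_all add: flow_add action_add S_def v_def)
  then show ?thesis
    using that[of "x 0" "v 0"] min[of y] y by simp
qed

end

section \<open>Mollification\<close>

text \<open>Squaring removes the kink at 0: in every sign case the remainder is at most (t - s)^2.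
  This makes the convolution kernel continuously differentiable.\<close>

lemma has_real_derivative_positive_part_square:
  "((\<lambda>s. (max 0 s)\<^sup>2) has_real_derivative 2 * max 0 s) (at (s :: real))"
proof -
  have quad: "\<bar>(max 0 t)\<^sup>2 - (max 0 s)\<^sup>2 - (t - s) * (2 * max 0 s)\<bar> \<le> (t - s)\<^sup>2" for t :: real
  proof -
    consider "s \<le> 0" "t \<le> 0" | "s \<le> 0" "t > 0" | "s > 0" "t \<le> 0" | "s > 0" "t > 0" by linarith
    then show ?thesis
    proof cases
      case 2
      then have "t\<^sup>2 \<le> (t - s)\<^sup>2" by (intro power_mono) auto
      then show ?thesis using 2 by (simp add: max_def)
    next
      case 3
      have "s * t \<le> 0" using 3 by (simp add: mult_nonneg_nonpos)
      then have nonneg: "0 \<le> s\<^sup>2 - 2 * (s * t)" using zero_le_power2[of s] by linarith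
      have "(max 0 t)\<^sup>2 - (max 0 s)\<^sup>2 - (t - s) * (2 * max 0 s) = s\<^sup>2 - 2 * (s * t)"
        using 3 by (simp add: max_absorb1 max_absorb2 power2_eq_square algebra_simps)
      then show ?thesis
        using nonneg by (simp add: power2_eq_square algebra_simps)
    next
      case 4
      then have "(max 0 t)\<^sup>2 - (max 0 s)\<^sup>2 - (t - s) * (2 * max 0 s) = (t - s)\<^sup>2"
        by (simp add: power2_eq_square algebra_simps)
      then show ?thesis by simp
    qed (simp add: max_def)
  qed
  have "((\<lambda>t. ((max 0 t)\<^sup>2 - (max 0 s)\<^sup>2) / (t - s) - 2 * max 0 s) \<longlongrightarrow> 0) (at s)"
  proof (rule Lim_null_comparison)
    show "\<forall>\<^sub>F t in at s. norm (((max 0 t)\<^sup>2 - (max 0 s)\<^sup>2) / (t - s) - 2 * max 0 s) \<le> \<bar>t - s\<bar>"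
      unfolding eventually_at_filter
    proof (rule always_eventually, intro allI impI)
      fix t assume t: "t \<noteq> s"
      have "((max 0 t)\<^sup>2 - (max 0 s)\<^sup>2) / (t - s) - 2 * max 0 s
        = ((max 0 t)\<^sup>2 - (max 0 s)\<^sup>2 - (t - s) * (2 * max 0 s)) / (t - s)"
        using t by (simp add: diff_divide_distrib)
      also have "norm \<dots> \<le> (t - s)\<^sup>2 / \<bar>t - s\<bar>"
        unfolding real_norm_def abs_divide by (intro divide_right_mono quad) auto
      also have "\<dots> = \<bar>t - s\<bar>" using t
        by (metis abs_eq_0 eq_iff_diff_eq_0 nonzero_mult_div_cancel_left power2_abs power2_eq_square)
      finally show "norm (((max 0 t)\<^sup>2 - (max 0 s)\<^sup>2) / (t - s) - 2 * max 0 s) \<le> \<bar>t - s\<bar>" .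
    qed
    show "((\<lambda>t. \<bar>t - s\<bar>) \<longlongrightarrow> 0) (at s)"
      by (auto intro!: tendsto_eq_intros)
  qed
  then show ?thesis
    unfolding has_field_derivative_iff by (simp add: LIM_zero_iff)
qed

lemma continuous_compact_support_integrable:
  fixes f :: "'a::euclidean_space \<Rightarrow> 'b::{banach, second_countable_topology}"
  assumes "continuous_on UNIV f" "compact S" "\<And>x. x \<notin> S \<Longrightarrow> f x = 0"
  shows "integrable lborel f"
proof -
  have "integrable lborel (\<lambda>x. indicator S x *\<^sub>R f x)"
    using assms by (intro borel_integrable_compact) (auto intro: continuous_on_subset)
  moreover have "(\<lambda>x. indicator S x *\<^sub>R f x) = f"
    using assms(3) by (auto simp: indicator_def)
  ultimately show ?thesis by simp
qed

lemma lborel_integral_eq_integral_on: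
  fixes f :: "'a::euclidean_space \<Rightarrow> 'b::euclidean_space"
  assumes "integrable lborel f" "\<And>x. x \<notin> S \<Longrightarrow> f x = 0"
  shows "(\<integral>x. f x \<partial>lborel) = integral S f"
proof -
  have "(\<integral>x. f x \<partial>lborel) = integral UNIV f"
    using assms(1) by (rule integral_lborel[symmetric])
  also have "\<dots> = integral UNIV (\<lambda>x. if x \<in> S then f x else 0)"
    using assms(2) by (metis (mono_tags, lifting))
  finally show ?thesis by (simp add: integral_restrict_UNIV)
qed

lemma lborel_integral_translate:
  fixes f :: "'a::euclidean_space \<Rightarrow> 'b::{banach, second_countable_topology}"
  assumes "f \<in> borel_measurable borel"
  shows "(\<integral>y. f (c + y) \<partial>lborel) = (\<integral>y. f y \<partial>lborel)"
  using integral_distr[of "(+) c" lborel borel f] assms by (simp add: lborel_distr_plus)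

text \<open>A kernel that is just C1, with an explicit gradient; that is all the regularity required
  of the subsolution. It is not normalized, and \<open>mollify\<close> divides by its mass.\<close>

definition bump :: "real \<Rightarrow> 'a::euclidean_space \<Rightarrow> real"
  where "bump \<delta> y = (max 0 (\<delta>\<^sup>2 - (norm y)\<^sup>2))\<^sup>2"

definition bump_grad :: "real \<Rightarrow> 'a::euclidean_space \<Rightarrow> 'a"
  where "bump_grad \<delta> y = (- 4 * max 0 (\<delta>\<^sup>2 - (norm y)\<^sup>2)) *\<^sub>R y"

definition mollify :: "real \<Rightarrow> ('a::euclidean_space \<Rightarrow> real) \<Rightarrow> 'a \<Rightarrow> real"
  where "mollify \<delta> u x = (\<integral>y. bump \<delta> y * u (x + y) \<partial>lborel) / (\<integral>y. bump \<delta> (y::'a) \<partial>lborel)"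

lemma bump_nonneg: "0 \<le> bump \<delta> y"
  by (simp add: bump_def)

lemma bump_eq_0: "0 < \<delta> \<Longrightarrow> \<delta> \<le> norm y \<Longrightarrow> bump \<delta> y = 0"
  and bump_grad_eq_0: "0 < \<delta> \<Longrightarrow> \<delta> \<le> norm y \<Longrightarrow> bump_grad \<delta> y = 0"
  by (auto simp: bump_def bump_grad_def max_def power_mono dest: power_mono[of \<delta> "norm y" 2])

lemma continuous_on_bump: "continuous_on A f \<Longrightarrow> continuous_on A (\<lambda>x. bump \<delta> (f x))"
  and continuous_on_bump_grad: "continuous_on A f \<Longrightarrow> continuous_on A (\<lambda>x. bump_grad \<delta> (f x))"
  unfolding bump_def bump_grad_def by (intro continuous_intros; simp)+

lemma bump_has_derivative: "(bump \<delta> has_derivative (\<lambda>h. h \<bullet> bump_grad \<delta> y)) (at y)"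
proof -
  have "((\<lambda>y. \<delta>\<^sup>2 - y \<bullet> y) has_derivative (\<lambda>h. - 2 * (h \<bullet> y))) (at y)"
    by (auto intro!: derivative_eq_intros simp: inner_commute)
  from has_derivative_compose[OF this has_real_derivative_positive_part_square[unfolded has_field_derivative_def]]
  show ?thesis
    unfolding bump_def bump_grad_def power2_norm_eq_inner by (simp add: mult_ac)
qed

lemma bump_mult_integrable:
  assumes "0 < \<delta>" "continuous_on UNIV f"
  shows "integrable lborel (\<lambda>y. bump \<delta> (y - c) * f y)"
  using assms
  by (intro continuous_compact_support_integrable[where S="cball c \<delta>"] continuous_intros continuous_on_bump)
    (auto simp: bump_eq_0 dist_norm norm_minus_commute)

lemma bump_mass_pos:
  assumes "0 < \<delta>"
  shows "0 < (\<integral>y. bump \<delta> (y :: 'a::euclidean_space) \<partial>lborel)"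
proof -
  have int: "integrable lborel (bump \<delta> :: 'a \<Rightarrow> real)"
    using bump_mult_integrable[OF assms continuous_on_const, of "0 :: 'a" 1] by simp
  \<comment> \<open>On the ball of half the radius, \<delta>^2 - |y|^2 is at least 3/4 of
    \<delta>^2.\<close>
  define k where "k = (\<delta>\<^sup>2 * (3/4))\<^sup>2"
  have "0 < k * measure lborel (ball (0::'a) (\<delta>/2))"
    using assms by (auto simp: k_def content_ball_pos)
  also have "\<dots> = (\<integral>y. k * indicator (ball (0::'a) (\<delta>/2)) y \<partial>lborel)"
    by simp
  also have "\<dots> \<le> (\<integral>y. bump \<delta> (y::'a) \<partial>lborel)"
  proof (rule integral_mono[OF _ int])
    show "integrable lborel (\<lambda>y. k * indicator (ball (0::'a) (\<delta>/2)) y)"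
      using emeasure_bounded_finite[OF bounded_ball, of "0 :: 'a" "\<delta>/2"]
      by (intro integrable_mult_right integrable_real_indicator) auto
    fix y :: 'a
    show "k * indicator (ball 0 (\<delta>/2)) y \<le> bump \<delta> y"
    proof (cases "norm y < \<delta> / 2")
      case True
      then have "(norm y)\<^sup>2 \<le> (\<delta> / 2)\<^sup>2" by (intro power_mono) auto
      then have "\<delta>\<^sup>2 * (3/4) \<le> max 0 (\<delta>\<^sup>2 - (norm y)\<^sup>2)"
        by (intro order_trans[OF _ max.cobounded2]) (simp add: power_divide)
      then have "k \<le> bump \<delta> y"
        unfolding k_def bump_def by (intro power_mono) auto
      then show ?thesis using True by (simp add: indicator_def)
    qed (simp add: bump_nonneg)
  qed
  finally show ?thesis .
qed

text \<open>A bound on increments is linear in \<open>u\<close> and uniform over the translates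
  being averaged, so the average inherits it. This carries the estimates of the potential to a C1
  function.\<close>

lemma mollify_diff_le:
  fixes u :: "'a::euclidean_space \<Rightarrow> real"
  assumes \<delta>: "0 < \<delta>" and u: "continuous_on UNIV u"
    and le: "\<And>y. norm y \<le> \<delta> \<Longrightarrow> u (x' + y) - u (x + y) \<le> C"
  shows "mollify \<delta> u x' - mollify \<delta> u x \<le> C"
proof -
  have int: "integrable lborel (\<lambda>y. bump \<delta> y * u (c + y))" for c
  proof -
    have "continuous_on UNIV (\<lambda>y. u (c + y))"
      by (intro continuous_on_compose2[OF u] continuous_intros) auto
    from bump_mult_integrable[OF \<delta> this, of 0] show ?thesis by simp
  qed
  have int1: "integrable lborel (\<lambda>y. bump \<delta> (y::'a) * C)"
    using bump_mult_integrable[OF \<delta> continuous_on_const, of 0 C] by simp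
  have "(\<integral>y. bump \<delta> y * u (x' + y) \<partial>lborel) - (\<integral>y. bump \<delta> y * u (x + y) \<partial>lborel)
      = (\<integral>y. bump \<delta> y * u (x' + y) - bump \<delta> y * u (x + y) \<partial>lborel)"
    using int by simp
  also have "\<dots> \<le> (\<integral>y. bump \<delta> (y::'a) * C \<partial>lborel)"
  proof (rule integral_mono)
    fix y :: 'a
    show "bump \<delta> y * u (x' + y) - bump \<delta> y * u (x + y) \<le> bump \<delta> y * C"
    proof (cases "norm y \<le> \<delta>")
      case True
      then show ?thesis
        using mult_left_mono[OF le[OF True] bump_nonneg[of \<delta> y]] by (simp add: algebra_simps)
    qed (use \<delta> in \<open>simp add: bump_eq_0\<close>)
  qed (use int int1 in auto)
  also have "\<dots> = (\<integral>y. bump \<delta> (y::'a) \<partial>lborel) * C" by simp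
  finally show ?thesis
    using bump_mass_pos[OF \<delta>, where 'a='a]
    unfolding mollify_def diff_divide_distrib[symmetric] by (simp add: pos_divide_le_eq mult.commute)
qed

text \<open>After translating the variable of integration, x occurs in the kernel only, so
  \<open>u\<close> is never differentiated. The minus sign in \<open>g0\<close> comes from
  differentiating \<open>bump \<delta> (y - x)\<close> in x.\<close>

lemma mollify_C1:
  fixes u :: "'a::euclidean_space \<Rightarrow> real"
  assumes \<delta>: "0 < \<delta>" and u: "continuous_on UNIV u"
  obtains g where "\<And>x. GDERIV (mollify \<delta> u) x :> g x" "continuous_on UNIV g"
proof -
  define Z where "Z = (\<integral>y. bump \<delta> (y :: 'a) \<partial>lborel)"
  define g0 where "g0 x = (\<integral>y. u y *\<^sub>R - bump_grad \<delta> (y - x) \<partial>lborel)" for x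
  have cu: "continuous_on A f \<Longrightarrow> continuous_on A (\<lambda>x. u (f x))" for A :: "'c::topological_space set" and f
    by (rule continuous_on_compose2[OF u]) auto
  have shift: "(\<integral>y. bump \<delta> y * u (x + y) \<partial>lborel) = (\<integral>y. bump \<delta> (y - x) * u y \<partial>lborel)" for x
  proof -
    have "(\<lambda>y. bump \<delta> (y - x) * u y) \<in> borel_measurable borel"
      by (intro borel_measurable_continuous_onI continuous_intros continuous_on_bump u)
    from lborel_integral_translate[OF this, of x] show ?thesis by simp
  qed
  have local: "GDERIV (\<lambda>x. \<integral>y. bump \<delta> (y - x) * u y \<partial>lborel) x0 :> g0 x0 \<and> continuous (at x0) g0" for x0
  proof -
    \<comment> \<open>Differentiation under the integral is done over a fixed box. For x within
      distance 1 of \<open>x0\<close>, the kernel lives in the ball of radius 1 + \<delta> around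
      \<open>x0\<close>, hence in one common box.\<close>
    define U where "U = ball x0 1"
    obtain a b where ab: "cball x0 (1 + \<delta>) \<subseteq> cbox a b"
      using bounded_subset_cbox_symmetric[OF bounded_cball, of x0 "1 + \<delta>"] by blast
    have out: "\<delta> \<le> norm (y - x)" if "x \<in> U" "y \<notin> cbox a b" for x y
    proof -
      have "1 + \<delta> < dist x0 y" using that(2) ab by (metis mem_cball not_le subsetD)
      also have "dist x0 y \<le> dist x0 x + dist x y" by (rule dist_triangle)
      finally show ?thesis using that(1) by (simp add: U_def dist_norm norm_minus_commute)
    qed
    have eq1: "(\<integral>y. bump \<delta> (y - x) * u y \<partial>lborel) = integral (cbox a b) (\<lambda>y. bump \<delta> (y - x) * u y)"
      if "x \<in> U" for x
      using out[OF that] \<delta>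
      by (intro lborel_integral_eq_integral_on bump_mult_integrable u) (auto simp: bump_eq_0)
    have g0i: "integrable lborel (\<lambda>y. u y *\<^sub>R - bump_grad \<delta> (y - x))" for x
      using \<delta>
      by (intro continuous_compact_support_integrable[where S="cball x \<delta>"] continuous_intros continuous_on_bump_grad u)
        (auto simp: bump_grad_eq_0 dist_norm norm_minus_commute)
    have eq2: "g0 x = integral (cbox a b) (\<lambda>y. u y *\<^sub>R - bump_grad \<delta> (y - x))" if "x \<in> U" for x
      unfolding g0_def using out[OF that] \<delta>
      by (intro lborel_integral_eq_integral_on g0i) (auto simp: bump_grad_eq_0)
    have cg: "continuous_on (U \<times> cbox a b) (\<lambda>(x, y). u y *\<^sub>R - bump_grad \<delta> (y - x))"
      unfolding case_prod_beta by (intro continuous_intros continuous_on_bump_grad cu)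
    define fx where "fx x y = blinfun_inner_left (u y *\<^sub>R - bump_grad \<delta> (y - x))" for x y
    have "((\<lambda>x. integral (cbox a b) (\<lambda>y. bump \<delta> (y - x) * u y)) has_derivative
        blinfun_apply (integral (cbox a b) (fx x0))) (at x0 within U)"
    proof (rule leibniz_rule)
      show "((\<lambda>x. bump \<delta> (y - x) * u y) has_derivative blinfun_apply (fx x y)) (at x within U)" for x y
      proof -
        have "((\<lambda>x. y - x) has_derivative (\<lambda>h. - h)) (at x)"
          by (auto intro!: derivative_eq_intros)
        from has_derivative_compose[OF this bump_has_derivative]
        have "((\<lambda>x. bump \<delta> (y - x)) has_derivative (\<lambda>h. - h \<bullet> bump_grad \<delta> (y - x))) (at x)" .
        from has_derivative_mult_left[OF this, of "u y"] show ?thesis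
          by (auto simp: fx_def mult.commute intro: has_derivative_at_withinI)
      qed
      show "(\<lambda>y. bump \<delta> (y - x) * u y) integrable_on cbox a b" for x
        by (intro integrable_continuous continuous_intros continuous_on_bump cu)
      show "continuous_on (U \<times> cbox a b) (\<lambda>(x, t). fx x t)"
        using cg unfolding fx_def case_prod_beta
        by (rule bounded_linear.continuous_on[OF bounded_linear_blinfun_inner_left])
    qed (auto simp: U_def)
    moreover have "blinfun_apply (integral (cbox a b) (fx x0)) = (\<lambda>h. h \<bullet> g0 x0)"
    proof -
      have int: "(\<lambda>y. u y *\<^sub>R - bump_grad \<delta> (y - x0)) integrable_on cbox a b"
        by (intro integrable_continuous continuous_intros continuous_on_bump_grad cu)
      have "integral (cbox a b) (fx x0) = blinfun_inner_left (g0 x0)"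
      proof -
        have "x0 \<in> U" by (simp add: U_def)
        then show ?thesis
          unfolding fx_def[abs_def] eq2[OF \<open>x0 \<in> U\<close>]
          by (intro integral_linear[OF int bounded_linear_blinfun_inner_left, unfolded o_def])
      qed
      then show ?thesis by auto
    qed
    ultimately have "((\<lambda>x. integral (cbox a b) (\<lambda>y. bump \<delta> (y - x) * u y)) has_derivative (\<lambda>h. h \<bullet> g0 x0)) (at x0)"
      by (simp add: U_def at_within_open[of x0 "ball x0 1"])
    then have "((\<lambda>x. \<integral>y. bump \<delta> (y - x) * u y \<partial>lborel) has_derivative (\<lambda>h. h \<bullet> g0 x0)) (at x0)"
      by (rule has_derivative_transform_within_open[of _ _ _ _ U]) (auto simp: U_def eq1)
    moreover have "continuous_on U g0"
      using integral_continuous_on_param[OF cg] by (rule continuous_on_eq) (simp add: eq2)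
    then have "continuous (at x0) g0"
      by (simp add: U_def continuous_on_eq_continuous_at)
    ultimately show ?thesis by (simp add: gderiv_def)
  qed
  show ?thesis
  proof (rule that[of "\<lambda>x. (1 / Z) *\<^sub>R g0 x"])
    fix x
    have "mollify \<delta> u = (\<lambda>x. (1 / Z) * (\<integral>y. bump \<delta> (y - x) * u y \<partial>lborel))"
      by (simp add: fun_eq_iff mollify_def shift Z_def)
    moreover have "((\<lambda>x. (1 / Z) * (\<integral>y. bump \<delta> (y - x) * u y \<partial>lborel)) has_derivative (\<lambda>h. (1 / Z) * (h \<bullet> g0 x))) (at x)"
      using local[of x] unfolding gderiv_def by (intro has_derivative_mult_right) auto
    ultimately show "GDERIV (mollify \<delta> u) x :> (1 / Z) *\<^sub>R g0 x"
      by (simp add: gderiv_def)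
  next
    show "continuous_on UNIV (\<lambda>x. (1 / Z) *\<^sub>R g0 x)"
      using local by (intro continuous_intros) (auto simp: continuous_on_eq_continuous_at)
  qed
qed

section \<open>A subsolution of the Hamilton--Jacobi equation\<close>

text \<open>The assumption says that L - p.P + c has nonnegative action on every periodic orbit of
  the torus: \<open>m\<close> is the displacement of the lift over the period \<open>T\<close>, and
  P.p integrates to P.m.\<close>

locale weak_kam = periodic_mechanical \<xi> G K M B
  for \<xi> :: "real ^ 'n \<Rightarrow> real" and G :: "real ^ 'n \<Rightarrow> real ^ 'n" and K M B :: real +
  fixes P :: "real ^ 'n" and c :: real
  assumes periodic_orbit_action: "\<And>T x v m. 0 < T \<Longrightarrow> lattice_vec m \<Longrightarrow> flow T (x, v) = (x + m, v) \<Longrightarrow>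
    0 \<le> action T (x, v) - P \<bullet> m + c * T"
begin

text \<open>The bound of \<open>S_le_straight\<close>, corrected by the terms that P and c add to
  the Lagrangian. It depends explicitly on the endpoints, so short segments can be expanded
  directly.\<close>

definition cost :: "real \<Rightarrow> real ^ 'n \<Rightarrow> real ^ 'n \<Rightarrow> real"
  where "cost t x y = (norm (y - x))\<^sup>2 / (2 * t) - t * \<xi> x + M * t * norm (y - x) - P \<bullet> (y - x) + c * t"

text \<open>Chains may start at any lattice point, all being lifts of one base point of the torus;
  this is what makes the infimum periodic.\<close>

definition chain_costs :: "real ^ 'n \<Rightarrow> real set"
  where "chain_costs y = {(\<Sum>i<N. cost (\<tau> i) (x i) (x (Suc i))) | N \<tau> x.
    0 < N \<and> (\<forall>i. 0 < \<tau> i \<and> \<tau> i \<le> tmax) \<and> lattice_vec (x 0) \<and> x N = y}"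

text \<open>Mane's action potential from the base point, with segment costs in place of minimal
  actions.\<close>

definition potential :: "real ^ 'n \<Rightarrow> real"
  where "potential y = Inf (chain_costs y)"

text \<open>The cost of a closed chain dominates its short-time actions, these dominate the action
  of a periodic orbit with the same displacement and total time, and P.m telescopes over the
  edges.\<close>

lemma closed_chain_cost_nonneg:
  assumes N: "0 < N" and \<tau>: "\<And>i. 0 < \<tau> i" "\<And>i. \<tau> i \<le> tmax" and m: "lattice_vec m"
    and x: "x N = x 0 + m"
  shows "0 \<le> (\<Sum>i<N. cost (\<tau> i) (x i) (x (Suc i)))"
proof -
  obtain z v where orbit: "flow (\<Sum>i<N. \<tau> i) (z, v) = (z + m, v)"
    and le: "action (\<Sum>i<N. \<tau> i) (z, v) \<le> (\<Sum>i<N. S (\<tau> i) (x i) (x (Suc i)))"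
    by (rule periodic_orbit_below_chain[where \<tau>=\<tau>, OF N \<tau> m x])
  have "0 < (\<Sum>i<N. \<tau> i)" using N \<tau>(1) by (intro sum_pos) auto
  then have "0 \<le> action (\<Sum>i<N. \<tau> i) (z, v) - P \<bullet> m + c * (\<Sum>i<N. \<tau> i)"
    using m orbit by (rule periodic_orbit_action)
  also have "\<dots> \<le> (\<Sum>i<N. S (\<tau> i) (x i) (x (Suc i))) - P \<bullet> m + c * (\<Sum>i<N. \<tau> i)"
    using le by simp
  also have "P \<bullet> m = (\<Sum>i<N. P \<bullet> (x (Suc i) - x i))"
    unfolding inner_sum_right[symmetric] sum_lessThan_telescope using x by simp
  also have "(\<Sum>i<N. S (\<tau> i) (x i) (x (Suc i))) - (\<Sum>i<N. P \<bullet> (x (Suc i) - x i)) + c * (\<Sum>i<N. \<tau> i)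
      = (\<Sum>i<N. S (\<tau> i) (x i) (x (Suc i)) - P \<bullet> (x (Suc i) - x i) + c * \<tau> i)"
    by (simp only: sum.distrib sum_subtractf sum_distrib_left)
  also have "\<dots> \<le> (\<Sum>i<N. cost (\<tau> i) (x i) (x (Suc i)))"
  proof (rule sum_mono)
    fix i
    show "S (\<tau> i) (x i) (x (Suc i)) - P \<bullet> (x (Suc i) - x i) + c * \<tau> i \<le> cost (\<tau> i) (x i) (x (Suc i))"
      using S_le_straight[OF \<tau>(1)[of i] \<tau>(2)[of i], of "x i" "x (Suc i)"] by (simp add: cost_def)
  qed
  finally show ?thesis .
qed

lemma chain_costs_append:
  assumes s: "s \<in> chain_costs y" and t: "0 < t" "t \<le> tmax"
  shows "s + cost t y z \<in> chain_costs z"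
proof -
  obtain N \<tau> x where s_eq: "s = (\<Sum>i<N. cost (\<tau> i) (x i) (x (Suc i)))"
    and N: "0 < N" and \<tau>: "\<forall>i. 0 < \<tau> i \<and> \<tau> i \<le> tmax" and x: "lattice_vec (x 0)" "x N = y"
    using s unfolding chain_costs_def by blast
  have "s + cost t y z = (\<Sum>i<Suc N. cost ((\<tau>(N := t)) i) ((x(Suc N := z)) i) ((x(Suc N := z)) (Suc i)))"
    using x by (simp add: s_eq)
  then show ?thesis
    unfolding chain_costs_def using \<tau> t x
    by (intro CollectI exI[of _ "Suc N"] exI[of _ "\<tau>(N := t)"] exI[of _ "x(Suc N := z)"] conjI) auto
qed

lemma chain_costs_nonempty: "chain_costs y \<noteq> {}"
proof -
  have "(\<Sum>i<1. cost tmax ((\<lambda>i. if i = 0 then 0 else y) i) ((\<lambda>i. if i = 0 then 0 else y) (Suc i))) \<in> chain_costs y"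
    unfolding chain_costs_def using tmax_pos
    by (intro CollectI exI[of _ 1] exI[of _ "\<lambda>_. tmax"] exI[of _ "\<lambda>i :: nat. if i = 0 then 0 else y"]) auto
  then show ?thesis by blast
qed

text \<open>One more segment, from \<open>y\<close> to 0, closes the chain on the torus, and a
  closed chain has nonnegative cost. Without this bound the infimum \<open>potential\<close> would
  carry no information.\<close>

lemma chain_costs_lower_bound:
  assumes "s \<in> chain_costs y"
  shows "- cost tmax y 0 \<le> s"
proof -
  have "s + cost tmax y 0 \<in> chain_costs 0"
    using assms tmax_pos by (intro chain_costs_append) auto
  then obtain N \<tau> x where eq: "s + cost tmax y 0 = (\<Sum>i<N. cost (\<tau> i) (x i) (x (Suc i)))"
    and N: "0 < N" and \<tau>: "\<And>i. 0 < \<tau> i" "\<And>i. \<tau> i \<le> tmax" and x: "lattice_vec (x 0)" "x N = 0"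
    unfolding chain_costs_def by blast
  have "0 \<le> s + cost tmax y 0"
    \<comment> \<open>The closed chain runs from the lattice point \<open>x 0\<close> to 0, so its
      displacement is \<open>- x 0\<close>.\<close>
    unfolding eq using x by (intro closed_chain_cost_nonneg[OF N \<tau> lattice_vec_minus[OF x(1)]]) auto
  then show ?thesis by simp
qed

lemma bdd_below_chain_costs: "bdd_below (chain_costs y)"
  using chain_costs_lower_bound by (rule bdd_belowI)

lemma potential_step:
  assumes t: "0 < t" "t \<le> tmax"
  shows "potential z \<le> potential y + cost t y z"
proof -
  have "potential z - cost t y z \<le> Inf (chain_costs y)"
  proof (rule cInf_greatest[OF chain_costs_nonempty])
    fix s assume "s \<in> chain_costs y"
    then have "potential z \<le> s + cost t y z"
      unfolding potential_def by (intro cInf_lower chain_costs_append t bdd_below_chain_costs)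
    then show "potential z - cost t y z \<le> s" by simp
  qed
  then show ?thesis by (simp add: potential_def)
qed

lemma chain_costs_translate:
  assumes "s \<in> chain_costs y" "lattice_vec m"
  shows "s \<in> chain_costs (y + m)"
proof -
  obtain N \<tau> x where s: "s = (\<Sum>i<N. cost (\<tau> i) (x i) (x (Suc i)))"
    and N: "0 < N" and \<tau>: "\<forall>i. 0 < \<tau> i \<and> \<tau> i \<le> tmax" and x: "lattice_vec (x 0)" "x N = y"
    using assms(1) unfolding chain_costs_def by blast
  have "s = (\<Sum>i<N. cost (\<tau> i) (x i + m) (x (Suc i) + m))"
    unfolding s cost_def by (simp add: xi_periodic[OF assms(2)])
  then show ?thesis
    unfolding chain_costs_def using N \<tau> x assms(2)
    by (intro CollectI exI[of _ N] exI[of _ \<tau>] exI[of _ "\<lambda>i. x i + m"]) (auto intro: lattice_vec_add)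
qed

lemma potential_periodic:
  assumes "lattice_vec m"
  shows "potential (y + m) = potential y"
proof -
  have "chain_costs (y + m) = chain_costs y"
    using chain_costs_translate[OF _ assms, of _ y]
      chain_costs_translate[OF _ lattice_vec_minus[OF assms], of _ "y + m"] by auto
  then show ?thesis by (simp add: potential_def)
qed

lemma potential_along_segment:
  assumes "0 < h" "h \<le> tmax"
  shows "potential (y + h *\<^sub>R v) - potential y \<le> h * ((norm v)\<^sup>2 / 2 - \<xi> y + M * h * norm v - P \<bullet> v + c)"
  using potential_step[OF assms, of "y + h *\<^sub>R v" y] assms
  by (simp add: cost_def power_mult_distrib power2_eq_square algebra_simps)

text \<open>Travelling from y to z at unit speed takes time |z - y| and costs at most
  \<open>D\<close> times that. Exchanging y and z bounds the increment on both sides.\<close>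

lemma continuous_on_potential: "continuous_on A potential"
proof -
  define D where "D = 1/2 + B + M * tmax + norm P + \<bar>c\<bar>"
  have step: "potential z - potential y \<le> D * norm (z - y)" if "norm (z - y) \<le> tmax" for y z
  proof (cases "z = y")
    case False
    define r e where "r = norm (z - y)" and "e = (1 / r) *\<^sub>R (z - y)"
    have r: "0 < r" "r \<le> tmax" using False that by (auto simp: r_def)
    have e: "norm e = 1" "y + r *\<^sub>R e = z" using r by (auto simp: e_def r_def)
    have "- (P \<bullet> e) \<le> norm P"
      using Cauchy_Schwarz_ineq2[of P e] e(1) by simp
    moreover have "M * r \<le> M * tmax" using r by (intro mult_left_mono M_nonneg)
    moreover have "- \<xi> y \<le> B" using xi_bound[of y] by linarith
    ultimately have "(norm e)\<^sup>2 / 2 - \<xi> y + M * r * norm e - P \<bullet> e + c \<le> D"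
      unfolding D_def e(1) using abs_ge_self[of c] by simp
    then have "r * ((norm e)\<^sup>2 / 2 - \<xi> y + M * r * norm e - P \<bullet> e + c) \<le> r * D"
      using r by (intro mult_left_mono) auto
    then show ?thesis
      using potential_along_segment[OF r, of y e] e(2) by (simp add: r_def mult.commute)
  qed simp
  have "isCont potential y" for y
    unfolding isCont_def
  proof (rule LIM_zero_cancel, rule Lim_null_comparison)
    show "\<forall>\<^sub>F z in at y. norm (potential z - potential y) \<le> D * norm (z - y)"
      using eventually_at_ball'[OF tmax_pos, of y UNIV]
    proof (rule eventually_mono)
      fix z assume "z \<in> ball y tmax \<and> z \<noteq> y \<and> z \<in> UNIV"
      then have "norm (z - y) \<le> tmax" "norm (y - z) \<le> tmax"
        by (auto simp: dist_norm norm_minus_commute)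
      then show "norm (potential z - potential y) \<le> D * norm (z - y)"
        using step[of z y] step[of y z] by (simp add: abs_le_iff norm_minus_commute)
    qed
    show "((\<lambda>z. D * norm (z - y)) \<longlongrightarrow> 0) (at y)"
      by (auto intro!: tendsto_eq_intros)
  qed
  then show ?thesis by (simp add: continuous_at_imp_continuous_on)
qed

text \<open>Dividing the averaged increment inequality by h and letting h tend to 0 bounds v.g by
  L(x,v) - P.v + c + \<epsilon> for every velocity v. Optimizing over v is the Legendre transform,
  which yields the Hamilton-Jacobi inequality.\<close>

lemma C1_subsolution:
  assumes "0 < \<epsilon>"
  obtains \<phi> g where "\<And>x. GDERIV \<phi> x :> g x" "continuous_on UNIV g"
    "\<And>x m. lattice_vec m \<Longrightarrow> \<phi> (x + m) = \<phi> x"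
    "\<And>x. (norm (g x + P))\<^sup>2 / 2 + \<xi> x \<le> c + \<epsilon>"
proof -
  \<comment> \<open>Over this radius \<xi> varies by at most \<epsilon>; the added 1 keeps the
    quotient meaningful when \<open>M\<close> is 0.\<close>
  define \<delta> where "\<delta> = \<epsilon> / (M + 1)"
  have \<delta>: "0 < \<delta>" using assms M_nonneg by (simp add: \<delta>_def)
  have M\<delta>: "M * \<delta> \<le> \<epsilon>"
    using assms M_nonneg by (simp add: \<delta>_def field_simps)
  define \<phi> where "\<phi> = mollify \<delta> potential"
  obtain g where "\<And>x. GDERIV (mollify \<delta> potential) x :> g x" "continuous_on UNIV g"
    by (rule mollify_C1[OF \<delta> continuous_on_potential]) (rule that)
  note g = this[folded \<phi>_def]
  have step: "\<phi> (x + h *\<^sub>R v) - \<phi> x \<le> h * ((norm v)\<^sup>2 / 2 - \<xi> x + \<epsilon> + M * h * norm v - P \<bullet> v + c)"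
    if h: "0 < h" "h \<le> tmax" for x v h
    unfolding \<phi>_def
  proof (rule mollify_diff_le[OF \<delta> continuous_on_potential])
    fix y :: "real ^ 'n" assume y: "norm y \<le> \<delta>"
    have "M * norm y \<le> M * \<delta>" using y by (intro mult_left_mono M_nonneg)
    then have "\<xi> x - \<xi> (x + y) \<le> \<epsilon>"
      using xi_lipschitz[of x y] M\<delta> by linarith
    then have "h * ((norm v)\<^sup>2 / 2 - \<xi> (x + y) + M * h * norm v - P \<bullet> v + c)
        \<le> h * ((norm v)\<^sup>2 / 2 - \<xi> x + \<epsilon> + M * h * norm v - P \<bullet> v + c)"
      using h by (intro mult_left_mono) auto
    then show "potential (x + h *\<^sub>R v + y) - potential (x + y)
        \<le> h * ((norm v)\<^sup>2 / 2 - \<xi> x + \<epsilon> + M * h * norm v - P \<bullet> v + c)"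
      using potential_along_segment[OF h, of "x + y" v] by (simp add: algebra_simps)
  qed
  have dir: "v \<bullet> g x \<le> (norm v)\<^sup>2 / 2 - \<xi> x + \<epsilon> - P \<bullet> v + c" for x v
  proof (rule tendsto_le[of "at_right 0"])
    have "((\<lambda>h. \<phi> (x + h *\<^sub>R v)) has_real_derivative v \<bullet> g (x + 0 *\<^sub>R v)) (at 0)"
      by (rule GDERIV_along_path[OF g(1)]) (auto intro!: derivative_eq_intros)
    then have "((\<lambda>h. (\<phi> (x + h *\<^sub>R v) - \<phi> x) / h) \<longlongrightarrow> v \<bullet> g x) (at 0)"
      unfolding has_field_derivative_iff by simp
    then show "((\<lambda>h. (\<phi> (x + h *\<^sub>R v) - \<phi> x) / h) \<longlongrightarrow> v \<bullet> g x) (at_right 0)"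
      by (rule filterlim_mono) (auto simp: at_le)
    show "((\<lambda>h. (norm v)\<^sup>2 / 2 - \<xi> x + \<epsilon> + M * h * norm v - P \<bullet> v + c) \<longlongrightarrow>
        (norm v)\<^sup>2 / 2 - \<xi> x + \<epsilon> - P \<bullet> v + c) (at_right 0)"
      by (auto intro!: tendsto_eq_intros)
    show "\<forall>\<^sub>F h in at_right 0. (\<phi> (x + h *\<^sub>R v) - \<phi> x) / h
        \<le> (norm v)\<^sup>2 / 2 - \<xi> x + \<epsilon> + M * h * norm v - P \<bullet> v + c"
    proof (rule eventually_at_rightI[OF _ tmax_pos])
      fix h assume "h \<in> {0<..<tmax}"
      then show "(\<phi> (x + h *\<^sub>R v) - \<phi> x) / h \<le> (norm v)\<^sup>2 / 2 - \<xi> x + \<epsilon> + M * h * norm v - P \<bullet> v + c"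
        using step[of h x v] by (simp add: pos_divide_le_eq mult.commute)
    qed
  qed simp
  show ?thesis
  proof (rule that[OF g])
    show "\<phi> (x + m) = \<phi> x" if "lattice_vec m" for x m
    proof -
      have "potential (x + m + y) = potential (x + y)" for y
        using potential_periodic[OF that, of "x + y"] by (simp add: add_ac)
      then show ?thesis by (simp add: \<phi>_def mollify_def)
    qed
    show "(norm (g x + P))\<^sup>2 / 2 + \<xi> x \<le> c + \<epsilon>" for x
      \<comment> \<open>This velocity is the maximizer in the Legendre transform.\<close>
      using dir[of "g x + P" x] unfolding power2_norm_eq_inner
      by (simp add: algebra_simps inner_commute add_divide_distrib)
  qed
qed

end

section \<open>The torus and its Euler--Lagrange flow\<close>

lemma tproj_eq_iff: "tproj x = tproj y \<longleftrightarrow> lattice_vec (x - y)"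
  by (simp add: torus.abs_eq_iff lattice_rel_def lattice_vec_def)

lemma tproj_add_lattice: "lattice_vec m \<Longrightarrow> tproj (x + m) = tproj x"
  by (simp add: tproj_eq_iff)

lemma tproj_rep [simp]: "tproj (rep_torus x) = x"
  by (rule Quotient3_abs_rep[OF Quotient3_torus])

lemma tproj_cases: obtains y where "x = tproj y"
  by (rule that[OF tproj_rep[symmetric]])

lemma vimage_tproj_open: "open U \<Longrightarrow> open (tproj -` U)"
  by (simp add: open_torus_def)

lemma continuous_on_tproj: "continuous_on A f \<Longrightarrow> continuous_on A (\<lambda>x. tproj (f x))"
  by (rule continuous_on_compose2[of UNIV tproj])
    (auto simp: continuous_on_open_vimage vimage_tproj_open)

text \<open>The saturation of an open set is a union of lattice translates of it.\<close>

lemma open_image_tproj: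
  assumes "open A"
  shows "open (tproj ` A)"
proof -
  have "tproj -` (tproj ` A) = (\<Union>m\<in>{m. lattice_vec m}. (+) m ` A)"
  proof safe
    fix x y assume "tproj x = tproj y" "y \<in> A"
    then show "x \<in> (\<Union>m\<in>{m. lattice_vec m}. (+) m ` A)"
      by (intro UN_I[of "x - y"]) (auto simp: tproj_eq_iff)
  next
    fix m y :: "real ^ 'a" assume "lattice_vec m" "y \<in> A"
    then show "m + y \<in> tproj -` tproj ` A"
      using tproj_add_lattice[of m y] by (auto simp: add.commute intro: image_eqI[of _ _ y])
  qed
  moreover have "open ((+) m ` A)" for m
    using assms by (rule open_translation)
  ultimately show ?thesis by (auto simp: open_torus_def)
qed

definition tproj2 :: "(real ^ 'n) \<times> (real ^ 'n) \<Rightarrow> 'n torus \<times> (real ^ 'n)"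
  where "tproj2 z = (tproj (fst z), snd z)"

lemma tproj2_cases: obtains x p where "z = tproj2 (x, p)"
proof -
  obtain x where "fst z = tproj x" by (rule tproj_cases)
  then show ?thesis using that[of x "snd z"] by (simp add: tproj2_def prod_eq_iff)
qed

lemma continuous_on_tproj2: "continuous_on A f \<Longrightarrow> continuous_on A (\<lambda>x. tproj2 (f x))"
  unfolding tproj2_def by (intro continuous_intros continuous_on_tproj)

lemma open_image_tproj2:
  assumes "open A"
  shows "open (tproj2 ` A)"
proof (rule open_prod_intro)
  fix z assume "z \<in> tproj2 ` A"
  then obtain x p where z: "z = (tproj x, p)" "(x, p) \<in> A" by (auto simp: tproj2_def)
  obtain U V where UV: "open U" "open V" "(x, p) \<in> U \<times> V" "U \<times> V \<subseteq> A"
    using open_prod_elim[OF assms z(2)] .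
  have "tproj ` U \<times> V \<subseteq> tproj2 ` A"
  proof safe
    fix a b assume "a \<in> U" "b \<in> V"
    then have "(a, b) \<in> A" using UV(4) by blast
    then show "(tproj a, b) \<in> tproj2 ` A" by (rule rev_image_eqI) (simp add: tproj2_def)
  qed
  then show "\<exists>A' B. open A' \<and> open B \<and> z \<in> A' \<times> B \<and> A' \<times> B \<subseteq> tproj2 ` A"
    using UV(1-3) z(1) open_image_tproj[OF UV(1)]
    by (intro exI[of _ "tproj ` U"] exI[of _ V]) auto
qed

text \<open>A product of quotient maps need not be a quotient map; here openness of
  \<open>tproj2\<close>, with surjectivity, makes it one.\<close>

lemma continuous_on_tproj2_quotient:
  fixes f :: "'n::finite torus \<times> (real ^ 'n) \<Rightarrow> 'c::topological_space"
  assumes "continuous_on UNIV (\<lambda>z. f (tproj2 z))"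
  shows "continuous_on UNIV f"
  unfolding continuous_on_open_vimage[OF open_UNIV]
proof (intro allI impI)
  fix W :: "'c set" assume "open W"
  then have "open ((\<lambda>z. f (tproj2 z)) -` W \<inter> UNIV)"
    using assms unfolding continuous_on_open_vimage[OF open_UNIV] by blast
  then have "open (tproj2 ` ((\<lambda>z. f (tproj2 z)) -` W))"
    by (simp add: open_image_tproj2)
  moreover have "tproj2 ` ((\<lambda>z. f (tproj2 z)) -` W) = f -` W"
  proof safe
    fix z assume z: "f z \<in> W"
    obtain x p where "z = tproj2 (x, p)" by (rule tproj2_cases)
    then show "z \<in> tproj2 ` ((\<lambda>z. f (tproj2 z)) -` W)" using z by auto
  qed auto
  ultimately show "open (f -` W \<inter> UNIV)" by simp
qed

lemma continuous_on_tproj_quotient: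
  assumes "continuous_on UNIV (\<lambda>z. f (tproj z))"
  shows "continuous_on UNIV f"
  using assms by (auto simp: continuous_on_open_vimage open_torus_def vimage_def)

text \<open>The compact unit cube meets every fibre of the projection.\<close>

lemma bounded_range_torus:
  fixes f :: "'n::finite torus \<Rightarrow> 'b::metric_space"
  assumes "continuous_on UNIV f"
  shows "bounded (range f)"
proof -
  have "continuous_on (cbox 0 1) (\<lambda>x. f (tproj x))"
    by (rule continuous_on_compose2[OF assms continuous_on_tproj[OF continuous_on_id]]) auto
  then have "bounded ((\<lambda>x. f (tproj x)) ` cbox 0 1)"
    by (intro compact_imp_bounded compact_continuous_image compact_cbox)
  moreover have "range f = (\<lambda>x. f (tproj x)) ` cbox 0 1"
  proof safe
    fix z :: "'n torus"
    obtain x where x: "z = tproj x" by (rule tproj_cases)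
    obtain m where m: "lattice_vec m" "x + m \<in> cbox 0 1" by (rule lattice_translate_to_cube)
    then show "f z \<in> (\<lambda>x. f (tproj x)) ` cbox 0 1"
      using tproj_add_lattice[OF m(1), of x] x by (intro image_eqI[of _ _ "x + m"]) auto
  qed auto
  ultimately show ?thesis by simp
qed

lemma torus_bounded_norm:
  fixes f :: "'n::finite torus \<Rightarrow> 'b::real_normed_vector"
  assumes "continuous_on UNIV f"
  obtains C where "0 \<le> C" "\<And>x. norm (f x) \<le> C"
proof -
  obtain C where C: "0 < C" "\<forall>y\<in>range f. norm y \<le> C"
    using bounded_range_torus[OF assms] unfolding bounded_pos by blast
  show ?thesis by (rule that[of C]) (use C in auto)
qed

section \<open>Gradients on the torus\<close>

lemma GDERIV_unique: "GDERIV f x :> D \<Longrightarrow> GDERIV f x :> D' \<Longrightarrow> D = D'"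
proof -
  assume "GDERIV f x :> D" "GDERIV f x :> D'"
  then have "(\<lambda>h. h \<bullet> D) = (\<lambda>h. h \<bullet> D')"
    unfolding gderiv_def by (rule has_derivative_unique)
  then have "\<forall>h. h \<bullet> D = h \<bullet> D'" by (simp add: fun_eq_iff)
  then show "D = D'" using vector_eq_ldot[of D D'] by blast
qed

lemma differentiable_imp_GDERIV:
  fixes f :: "'a::euclidean_space \<Rightarrow> real"
  assumes "f differentiable (at x)"
  obtains D where "GDERIV f x :> D"
proof -
  obtain L where L: "(f has_derivative L) (at x)"
    using assms by (auto simp: differentiable_def)
  interpret bounded_linear L using L by (rule has_derivative_bounded_linear)
  have "L h = h \<bullet> (\<Sum>b\<in>Basis. L b *\<^sub>R b)" for h
  proof -
    have "L h = L (\<Sum>b\<in>Basis. (h \<bullet> b) *\<^sub>R b)" by (simp add: euclidean_representation)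
    also have "\<dots> = h \<bullet> (\<Sum>b\<in>Basis. L b *\<^sub>R b)"
      by (simp add: sum scaleR inner_sum_right mult.commute)
    finally show ?thesis .
  qed
  then have "L = (\<lambda>h. h \<bullet> (\<Sum>b\<in>Basis. L b *\<^sub>R b))" by (rule ext)
  then show ?thesis using L that[of "\<Sum>b\<in>Basis. L b *\<^sub>R b"] unfolding gderiv_def by metis
qed

lemma GDERIV_tproj_translate:
  assumes "tproj y = tproj y'" "GDERIV (\<lambda>z. f (tproj z)) y :> D"
  shows "GDERIV (\<lambda>z. f (tproj z)) y' :> D"
proof -
  have "lattice_vec (y - y')" using assms(1) by (simp add: tproj_eq_iff)
  then have eq: "f (tproj (z + (y - y'))) = f (tproj z)" for z by (simp add: tproj_add_lattice)
  have "((\<lambda>z. z + (y - y')) has_derivative (\<lambda>h. h)) (at y')"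
    by (auto intro!: derivative_eq_intros)
  moreover have "((\<lambda>z. f (tproj z)) has_derivative (\<lambda>h. h \<bullet> D)) (at (y' + (y - y')))"
    using assms(2) by (simp add: gderiv_def)
  ultimately have "((\<lambda>z. f (tproj (z + (y - y')))) has_derivative (\<lambda>h. h \<bullet> D)) (at y')"
    by (rule has_derivative_compose)
  then show ?thesis unfolding eq gderiv_def .
qed

lemma torus_grad_eqI:
  assumes "GDERIV (\<lambda>z. f (tproj z)) y :> D"
  shows "torus_grad f (tproj y) = D"
  unfolding torus_grad_def
proof (rule the_equality)
  show "\<forall>y'. tproj y' = tproj y \<longrightarrow> GDERIV (\<lambda>z. f (tproj z)) y' :> D"
    using GDERIV_tproj_translate[OF _ assms] by metis
  show "D' = D" if "\<forall>y'. tproj y' = tproj y \<longrightarrow> GDERIV (\<lambda>z. f (tproj z)) y' :> D'" for D'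
    using that GDERIV_unique[OF _ assms] by blast
qed

lemma C1_torus_GDERIV:
  assumes "f \<in> C1_torus"
  shows "GDERIV (\<lambda>z. f (tproj z)) y :> torus_grad f (tproj y)"
proof -
  obtain D where D: "GDERIV (\<lambda>z. f (tproj z)) y :> D"
    using assms differentiable_imp_GDERIV unfolding C1_torus_def by blast
  then show ?thesis using torus_grad_eqI[OF D] by simp
qed

lemma C1_torus_continuous_grad: "f \<in> C1_torus \<Longrightarrow> continuous_on UNIV (torus_grad f)"
  by (simp add: C1_torus_def)

lemma C1_torus_continuous:
  assumes "f \<in> C1_torus"
  shows "continuous_on UNIV f"
proof (rule continuous_on_tproj_quotient)
  show "continuous_on UNIV (\<lambda>z. f (tproj z))"
    using C1_torus_GDERIV[OF assms] unfolding gderiv_def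
    by (meson continuous_at_imp_continuous_on has_derivative_continuous)
qed

lemma C1_torus_lipschitz:
  fixes f :: "'n::finite torus \<Rightarrow> real"
  assumes "f \<in> C1_torus"
  obtains C where "0 \<le> C" "\<And>x. norm (torus_grad f x) \<le> C"
    "\<And>x y. \<bar>f (tproj x) - f (tproj y)\<bar> \<le> C * norm (x - y)"
proof -
  obtain C where C: "0 \<le> C" "\<And>x. norm (torus_grad f x) \<le> C"
    by (rule torus_bounded_norm[OF C1_torus_continuous_grad[OF assms]]) (rule that)
  have "norm (f (tproj x) - f (tproj y)) \<le> C * norm (x - y)" for x y
  proof (rule differentiable_bound[OF convex_UNIV])
    show "((\<lambda>x. f (tproj x)) has_derivative (\<lambda>h. h \<bullet> torus_grad f (tproj z))) (at z within UNIV)" for z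
      using C1_torus_GDERIV[OF assms, of z] by (simp add: gderiv_def)
    show "onorm (\<lambda>h. h \<bullet> torus_grad f (tproj z)) \<le> C" for z
    proof (rule onorm_bound[OF C(1)])
      fix h
      have "norm (h \<bullet> torus_grad f (tproj z)) \<le> norm h * norm (torus_grad f (tproj z))"
        by (simp add: Cauchy_Schwarz_ineq2)
      also have "\<dots> \<le> norm h * C" by (intro mult_left_mono C(2)) auto
      finally show "norm (h \<bullet> torus_grad f (tproj z)) \<le> C * norm h" by (simp add: mult.commute)
    qed
  qed auto
  then show ?thesis using that[OF C] by simp
qed

lemma C1_torus_of_periodic:
  fixes \<phi> :: "real ^ 'n \<Rightarrow> real"
  assumes \<phi>: "\<And>x. GDERIV \<phi> x :> g x" and g: "continuous_on UNIV g"
    and per: "\<And>x m. lattice_vec m \<Longrightarrow> \<phi> (x + m) = \<phi> x"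
  shows "(\<lambda>x. \<phi> (rep_torus x)) \<in> C1_torus"
    and "torus_grad (\<lambda>x. \<phi> (rep_torus x)) (tproj y) = g y"
proof -
  have lift: "(\<lambda>z. \<phi> (rep_torus (tproj z))) = \<phi>"
  proof
    fix z :: "real ^ 'n"
    have "lattice_vec (rep_torus (tproj z) - z)" by (simp flip: tproj_eq_iff)
    from per[OF this, of z] show "\<phi> (rep_torus (tproj z)) = \<phi> z" by simp
  qed
  have grad: "torus_grad (\<lambda>x. \<phi> (rep_torus x)) (tproj y) = g y" for y
    by (rule torus_grad_eqI) (simp add: lift \<phi>)
  then show "torus_grad (\<lambda>x. \<phi> (rep_torus x)) (tproj y) = g y" .
  have "continuous_on UNIV (torus_grad (\<lambda>x. \<phi> (rep_torus x)))"
    by (rule continuous_on_tproj_quotient) (simp add: grad g)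
  then show "(\<lambda>x. \<phi> (rep_torus x)) \<in> C1_torus"
    using \<phi> by (auto simp: C1_torus_def lift gderiv_def differentiable_def)
qed

lemma C2_torus_periodic_mechanical:
  fixes \<Xi> :: "'n::finite torus \<Rightarrow> real"
  assumes "\<Xi> \<in> C2_torus"
  obtains K M B where "periodic_mechanical (\<lambda>x. \<Xi> (tproj x)) (\<lambda>x. torus_grad \<Xi> (tproj x)) K M B"
proof -
  have C1: "\<Xi> \<in> C1_torus" and comp: "\<And>i. (\<lambda>x. torus_grad \<Xi> x $ i) \<in> C1_torus"
    using assms by (auto simp: C2_torus_def)
  obtain M where M: "0 \<le> M" "\<And>x. norm (torus_grad \<Xi> x) \<le> M"
    by (rule torus_bounded_norm[OF C1_torus_continuous_grad[OF C1]]) (rule that)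
  obtain B where B: "0 \<le> B" "\<And>x. norm (\<Xi> x) \<le> B"
    by (rule torus_bounded_norm[OF C1_torus_continuous[OF C1]]) (rule that)
  have *: "\<forall>i. \<exists>C\<ge>0. \<forall>x y. \<bar>torus_grad \<Xi> (tproj x) $ i - torus_grad \<Xi> (tproj y) $ i\<bar> \<le> C * norm (x - y)"
  proof
    fix i
    show "\<exists>C\<ge>0. \<forall>x y. \<bar>torus_grad \<Xi> (tproj x) $ i - torus_grad \<Xi> (tproj y) $ i\<bar> \<le> C * norm (x - y)"
      by (rule C1_torus_lipschitz[OF comp[of i]]) blast
  qed
  obtain C where C: "\<And>i. 0 \<le> C i"
    "\<And>i x y. \<bar>torus_grad \<Xi> (tproj x) $ i - torus_grad \<Xi> (tproj y) $ i\<bar> \<le> C i * norm (x - y)"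
  proof -
    obtain C where "\<forall>i. 0 \<le> C i \<and> (\<forall>x y. \<bar>torus_grad \<Xi> (tproj x) $ i - torus_grad \<Xi> (tproj y) $ i\<bar> \<le> C i * norm (x - y))"
      using choice[OF *] by blast
    then show ?thesis using that[of C] by blast
  qed
  \<comment> \<open>The components of the gradient have separate Lipschitz constants, combined
    through the l1 norm; the summand 1 secures \<open>K \<ge> 1\<close>.\<close>
  define K where "K = 1 + (\<Sum>i\<in>UNIV. C i)"
  show ?thesis
  proof (rule that[of K M B], unfold_locales)
    show "1 \<le> K" using C(1) by (simp add: K_def sum_nonneg)
    show "norm (torus_grad \<Xi> (tproj x) - torus_grad \<Xi> (tproj y)) \<le> K * norm (x - y)" for x y
    proof -
      have "norm (torus_grad \<Xi> (tproj x) - torus_grad \<Xi> (tproj y))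
        \<le> (\<Sum>i\<in>UNIV. \<bar>(torus_grad \<Xi> (tproj x) - torus_grad \<Xi> (tproj y)) $ i\<bar>)"
        by (rule norm_le_l1_cart)
      also have "\<dots> \<le> (\<Sum>i\<in>UNIV. C i * norm (x - y))"
        using C(2) by (intro sum_mono) simp
      also have "\<dots> \<le> K * norm (x - y)"
        by (simp add: K_def distrib_right sum_distrib_right)
      finally show ?thesis .
    qed
    show "GDERIV (\<lambda>x. \<Xi> (tproj x)) x :> torus_grad \<Xi> (tproj x)" for x
      by (rule C1_torus_GDERIV[OF C1])
  qed (use M B in \<open>simp_all add: tproj_add_lattice\<close>)
qed

section \<open>The Euler-Lagrange flow as a quotient of the lifted flow\<close>

locale torus_mechanical =
  fixes \<Xi> :: "'n::finite torus \<Rightarrow> real" and K M B :: real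
  assumes C2: "\<Xi> \<in> C2_torus"
    and mechanical: "periodic_mechanical (\<lambda>x. \<Xi> (tproj x)) (\<lambda>x. torus_grad \<Xi> (tproj x)) K M B"
begin

sublocale periodic_mechanical "\<lambda>x. \<Xi> (tproj x)" "\<lambda>x. torus_grad \<Xi> (tproj x)" K M B
  by (rule mechanical)

lemma EL_solution_iff: "EL_solution \<Xi> q v \<longleftrightarrow> ode_solution vfield (\<lambda>t. (q t, v t))"
proof -
  have "((\<lambda>t. (q t, v t)) has_vector_derivative (a, b)) (at t) \<longleftrightarrow>
    (q has_vector_derivative a) (at t) \<and> (v has_vector_derivative b) (at t)" for a b t
    by (auto simp: has_vector_derivative_def intro: has_derivative_Pair
        dest: has_derivative_fst has_derivative_snd)
  then show ?thesis
    by (simp add: EL_solution_def ode_solution_def vfield_def)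
qed

text \<open>The definite description is unambiguous: two lifts of a trajectory start a lattice
  vector apart, and the lifted flow commutes with lattice translations.\<close>

lemma EL_flow_tproj2: "EL_flow \<Xi> t (tproj2 z) = tproj2 (flow t z)"
proof -
  obtain x p where z: "z = (x, p)" by force
  show ?thesis
    unfolding EL_flow_def tproj2_def z prod.case fst_conv snd_conv
  proof (rule the_equality)
    have "EL_solution \<Xi> (\<lambda>t. fst (flow t (x, p))) (\<lambda>t. snd (flow t (x, p)))"
      using ode_solution_flow[of "(x, p)"] by (simp add: EL_solution_iff)
    then show "\<exists>q v. EL_solution \<Xi> q v \<and> tproj (q 0) = tproj x \<and> v 0 = p \<and>
        (tproj (fst (flow t (x, p))), snd (flow t (x, p))) = (tproj (q t), v t)"
      by (intro exI conjI, assumption) auto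
    fix w assume "\<exists>q v. EL_solution \<Xi> q v \<and> tproj (q 0) = tproj x \<and> v 0 = p \<and> w = (tproj (q t), v t)"
    then obtain q v where qv: "EL_solution \<Xi> q v" "tproj (q 0) = tproj x" "v 0 = p" "w = (tproj (q t), v t)"
      by blast
    have m: "lattice_vec (q 0 - x)" using qv(2) by (simp add: tproj_eq_iff)
    have "(q t, v t) = flow t (q 0, v 0)"
      using qv(1) flow_unique[of "\<lambda>t. (q t, v t)" t] by (simp add: EL_solution_iff)
    also have "\<dots> = flow t (x, p) + (q 0 - x, 0)"
      using flow_translate[OF m, of t x p] qv(3) by simp
    finally have "q t = fst (flow t (x, p)) + (q 0 - x)" "v t = snd (flow t (x, p))"
      by (metis fst_add fst_conv, metis snd_add snd_conv add_0_right)
    then show "w = (tproj (fst (flow t (x, p))), snd (flow t (x, p)))"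
      using qv(4) tproj_add_lattice[OF m] by simp
  qed
qed

lemma continuous_on_EL_flow: "continuous_on UNIV (EL_flow \<Xi> t)"
proof (rule continuous_on_tproj2_quotient)
  have "continuous_on UNIV (\<lambda>z. flow t z)"
    by (rule continuous_on_compose2[OF continuous_on_flow[of UNIV], of UNIV "\<lambda>z. (z, t)", simplified])
      (intro continuous_intros)
  then show "continuous_on UNIV (\<lambda>z. EL_flow \<Xi> t (tproj2 z))"
    unfolding EL_flow_tproj2 by (rule continuous_on_tproj2)
qed

lemma EL_flow_measurable [measurable]: "EL_flow \<Xi> t \<in> borel_measurable borel"
  by (intro borel_measurable_continuous_onI continuous_on_EL_flow)

end

section \<open>Invariant measures\<close>

lemma emeasure_lborel_shift:
  fixes X :: "real set"
  assumes "X \<in> sets borel"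
  shows "emeasure lborel {s. s + t \<in> X} = emeasure lborel X"
proof -
  have "emeasure lborel X = emeasure (distr lborel borel ((+) t)) X"
    by (simp add: lborel_distr_plus)
  also have "\<dots> = emeasure lborel ((+) t -` X \<inter> space lborel)"
    using assms by (intro emeasure_distr) auto
  also have "(+) t -` X \<inter> space lborel = {s. s + t \<in> X}"
    by (auto simp: add.commute)
  finally show ?thesis by simp
qed

lemma periodic_int_multiple:
  fixes g :: "real \<Rightarrow> 'b"
  assumes "\<And>s. g (s + T) = g s"
  shows "g (s + of_int k * T) = g s"
proof (induction k rule: int_induct[where k=0])
  case base show ?case by simp
next
  case (step1 i)
  then show ?case using assms[of "s + of_int i * T"] by (simp add: algebra_simps)
next
  case (step2 i)
  then show ?case using assms[of "s + of_int (i - 1) * T"] by (simp add: algebra_simps)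
qed

text \<open>Rotations of a circle of length \<open>T\<close> preserve Lebesgue measure. The shift is
  reduced to its remainder r in [0,T), the window [r,T+r) is cut at T, and the overhanging piece is
  translated back.\<close>

lemma emeasure_periodic_shift:
  fixes E :: "real set"
  assumes T: "0 < T" and E: "E \<in> sets borel" and per: "\<And>s. s + T \<in> E \<longleftrightarrow> s \<in> E"
  shows "emeasure lborel ({0..<T} \<inter> {s. s + t \<in> E}) = emeasure lborel ({0..<T} \<inter> E)"
proof -
  define k where "k = \<lfloor>t / T\<rfloor>"
  define r where "r = t - of_int k * T"
  have r: "0 \<le> r" "r < T"
  proof -
    have "of_int k \<le> t / T" "t / T < of_int k + 1"
      unfolding k_def by linarith+
    then show "0 \<le> r" "r < T" using T by (auto simp: r_def field_simps)
  qed
  have "s + t \<in> E \<longleftrightarrow> s + r \<in> E" for s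
    using periodic_int_multiple[of "\<lambda>s. s \<in> E" T "s + r" k] per by (simp add: r_def)
  then have "{0..<T} \<inter> {s. s + t \<in> E} = {s. s + r \<in> {r..<T + r} \<inter> E}" by auto
  then have "emeasure lborel ({0..<T} \<inter> {s. s + t \<in> E}) = emeasure lborel ({r..<T + r} \<inter> E)"
    using E by (simp only: emeasure_lborel_shift sets.Int atLeastLessThan_borel)
  also have "{r..<T + r} \<inter> E = ({r..<T} \<inter> E) \<union> ({T..<T + r} \<inter> E)" using r by auto
  also have "emeasure lborel \<dots> = emeasure lborel ({r..<T} \<inter> E) + emeasure lborel ({T..<T + r} \<inter> E)"
    using E by (intro plus_emeasure[symmetric]) auto
  also have "emeasure lborel ({T..<T + r} \<inter> E) = emeasure lborel {s. s + T \<in> {T..<T + r} \<inter> E}"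
    using E by (intro emeasure_lborel_shift[symmetric]) auto
  also have "{s. s + T \<in> {T..<T + r} \<inter> E} = {0..<r} \<inter> E" using per by auto
  also have "emeasure lborel ({r..<T} \<inter> E) + emeasure lborel ({0..<r} \<inter> E)
      = emeasure lborel (({r..<T} \<inter> E) \<union> ({0..<r} \<inter> E))"
    using E by (intro plus_emeasure) auto
  also have "({r..<T} \<inter> E) \<union> ({0..<r} \<inter> E) = {0..<T} \<inter> E" using r by auto
  finally show ?thesis .
qed

lemma continuous_torus_integrable:
  fixes f :: "'n::finite torus \<Rightarrow> 'b::{banach, second_countable_topology}"
  assumes "\<mu> \<in> borel_prob_measures" "continuous_on UNIV f"
  shows "integrable \<mu> f"
proof -
  interpret prob_space \<mu> using assms(1) by (simp add: borel_prob_measures_def)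
  have sets: "sets \<mu> = sets borel" using assms(1) by (simp add: borel_prob_measures_def)
  obtain C where "\<And>x. norm (f x) \<le> C" by (rule torus_bounded_norm[OF assms(2)]) (rule that)
  moreover have "f \<in> borel_measurable \<mu>"
    unfolding measurable_cong_sets[OF sets refl] by (rule borel_measurable_continuous_onI[OF assms(2)])
  ultimately show ?thesis by (intro integrable_const_bound[where B=C]) auto
qed

lemma ext_integral_eq_integral:
  assumes "integrable M f"
  shows "ext_integral M f = ereal (\<integral>z. f z \<partial>M)"
proof -
  have "(\<integral>\<^sup>+ z. ennreal (f z) \<partial>M) < \<infinity>" "(\<integral>\<^sup>+ z. ennreal (- f z) \<partial>M) < \<infinity>"
    using assms by (auto simp: real_integrable_def top.not_eq_extremum)
  then show ?thesis
    unfolding ext_integral_def real_lebesgue_integral_def[OF assms]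
    by (cases "\<integral>\<^sup>+ z. ennreal (f z) \<partial>M"; cases "\<integral>\<^sup>+ z. ennreal (- f z) \<partial>M") auto
qed

text \<open>The lower bound makes the integral of the negative part finite on a probability space,
  so an infinite positive part would show up as the value infinity.\<close>

lemma integrable_of_ext_integral:
  assumes M: "prob_space M" and f: "f \<in> borel_measurable M" and lower: "\<And>z. - C \<le> f z"
    and fin: "ext_integral M f \<noteq> \<infinity>"
  shows "integrable M f"
proof -
  interpret prob_space M by (rule M)
  have "(\<integral>\<^sup>+ z. ennreal (- f z) \<partial>M) \<le> (\<integral>\<^sup>+ z. ennreal C \<partial>M)"
    using lower by (intro nn_integral_mono ennreal_leI) (metis minus_le_iff)
  also have "\<dots> < \<infinity>" by (simp add: emeasure_space_1)
  finally have neg: "(\<integral>\<^sup>+ z. ennreal (- f z) \<partial>M) \<noteq> \<infinity>" by simp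
  have "(\<integral>\<^sup>+ z. ennreal (f z) \<partial>M) \<noteq> \<infinity>"
  proof
    assume "(\<integral>\<^sup>+ z. ennreal (f z) \<partial>M) = \<infinity>"
    then have "ext_integral M f = \<infinity>"
      using neg unfolding ext_integral_def
      by (cases "\<integral>\<^sup>+ z. ennreal (- f z) \<partial>M") auto
    then show False using fin by simp
  qed
  then show ?thesis using f neg by (simp add: real_integrable_def)
qed

lemma borel_prob_measures_measurable:
  fixes f :: "'a::topological_space \<Rightarrow> 'b::{second_countable_topology, real_normed_vector}"
  assumes "\<nu> \<in> borel_prob_measures" "continuous_on UNIV f"
  shows "f \<in> borel_measurable \<nu>"
proof -
  have sets: "sets \<nu> = sets borel" using assms(1) by (simp add: borel_prob_measures_def)
  show ?thesis
    unfolding measurable_cong_sets[OF sets refl] by (rule borel_measurable_continuous_onI[OF assms(2)])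
qed

context torus_mechanical
begin

lemma periodic_orbit_measure:
  assumes T: "0 < T" and m: "lattice_vec m" and orbit: "flow T (x, v) = (x + m, v)"
  obtains \<nu> where "\<nu> \<in> invariant_measures \<Xi>"
    "\<And>f :: _ \<Rightarrow> real. continuous_on UNIV f \<Longrightarrow> integrable \<nu> f \<and>
      (\<integral>z. f z \<partial>\<nu>) = integral {0..T} (\<lambda>s. f (tproj2 (flow s (x, v)))) / T"
proof -
  define \<gamma> where "\<gamma> s = tproj2 (flow s (x, v))" for s
  have c\<gamma>: "continuous_on A \<gamma>" for A
    unfolding \<gamma>_def by (intro continuous_on_tproj2 continuous_on_flow_time)
  have m\<gamma> [measurable]: "\<gamma> \<in> borel_measurable borel"
    by (intro borel_measurable_continuous_onI c\<gamma>)
  have per: "\<gamma> (s + T) = \<gamma> s" for s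
  proof -
    have "flow (T + s) (x, v) = flow s (x, v) + (m, 0)"
      by (simp add: flow_add orbit flow_translate[OF m])
    then show ?thesis
      by (simp add: \<gamma>_def tproj2_def add.commute[of s] tproj_add_lattice[OF m])
  qed
  have flow\<gamma>: "EL_flow \<Xi> t (\<gamma> s) = \<gamma> (s + t)" for s t
    by (simp add: \<gamma>_def EL_flow_tproj2 flow_add)
  define U where "U = uniform_measure lborel {0..<T}"
  have U: "prob_space U" unfolding U_def using T by (intro prob_space_uniform_measure) auto
  have sU [simp, measurable_cong]: "sets U = sets borel" by (simp add: U_def)
  define \<nu> where "\<nu> = distr U borel \<gamma>"
  have s\<nu> [simp, measurable_cong]: "sets \<nu> = sets borel" by (simp add: \<nu>_def)
  have p\<nu>: "prob_space \<nu>" unfolding \<nu>_def by (intro prob_space.prob_space_distr U) measurable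
  have em: "emeasure \<nu> A = emeasure lborel ({0..<T} \<inter> \<gamma> -` A) / ennreal T" if A: "A \<in> sets borel" for A
  proof -
    have "\<gamma> -` A \<in> sets borel" using measurable_sets[OF m\<gamma> A] by simp
    then show ?thesis
      using A T by (simp add: \<nu>_def emeasure_distr U_def)
  qed
  have inv: "distr \<nu> borel (EL_flow \<Xi> t) = \<nu>" for t
  proof (rule measure_eqI)
    fix A assume "A \<in> sets (distr \<nu> borel (EL_flow \<Xi> t))"
    then have A: "A \<in> sets borel" by simp
    have A': "EL_flow \<Xi> t -` A \<in> sets borel" using measurable_sets[OF EL_flow_measurable A] by simp
    have "space \<nu> = UNIV" by (simp add: \<nu>_def)
    then have "emeasure (distr \<nu> borel (EL_flow \<Xi> t)) A = emeasure \<nu> (EL_flow \<Xi> t -` A)"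
      using A by (simp add: emeasure_distr)
    also have "\<dots> = emeasure lborel ({0..<T} \<inter> {s. s + t \<in> \<gamma> -` A}) / ennreal T"
      unfolding em[OF A'] by (simp add: vimage_def flow\<gamma>)
    also have "emeasure lborel ({0..<T} \<inter> {s. s + t \<in> \<gamma> -` A}) = emeasure lborel ({0..<T} \<inter> \<gamma> -` A)"
      using measurable_sets[OF m\<gamma> A] per by (intro emeasure_periodic_shift T) auto
    finally show "emeasure (distr \<nu> borel (EL_flow \<Xi> t)) A = emeasure \<nu> A"
      by (simp add: em[OF A])
  qed simp
  have Ud: "U = density lborel (\<lambda>s. ennreal (indicator {0..<T} s / T))"
    unfolding U_def uniform_measure_def using T
    by (intro density_cong) (auto simp: indicator_def divide_ennreal simp flip: ennreal_1 intro!: AE_I2)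
  show ?thesis
  proof (rule that[of \<nu>])
    show "\<nu> \<in> invariant_measures \<Xi>"
      using p\<nu> inv by (simp add: invariant_measures_def borel_prob_measures_def)
    fix f :: "'n torus \<times> (real ^ 'n) \<Rightarrow> real" assume f: "continuous_on UNIV f"
    have mf [measurable]: "f \<in> borel_measurable borel" by (intro borel_measurable_continuous_onI f)
    have cf: "continuous_on A (\<lambda>s. f (\<gamma> s))" for A
      by (rule continuous_on_compose2[OF f c\<gamma>]) auto
    have int: "set_integrable lborel {0..T} (\<lambda>s. f (\<gamma> s))"
      by (intro borel_integrable_atLeastAtMost' cf)
    \<comment> \<open>Invariance uses the half-open period, the action integral the closed one; they
      differ by the null set {T}.\<close>
    have ae: "AE s in lborel. (indicator {0..<T} s / T) * f (\<gamma> s) = (1 / T) * (indicator {0..T} s *\<^sub>R f (\<gamma> s))"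
      using AE_lborel_singleton[of T] by eventually_elim (auto simp: indicator_def)
    have int2: "integrable lborel (\<lambda>s. (1 / T) * (indicator {0..T} s *\<^sub>R f (\<gamma> s)))"
      using int unfolding set_integrable_def by (rule integrable_mult_right)
    have int3: "integrable lborel (\<lambda>s. (indicator {0..<T} s / T) * f (\<gamma> s))"
      using int2
    proof (rule integrable_cong_AE_imp)
      show "AE s in lborel. (1 / T) * (indicator {0..T} s *\<^sub>R f (\<gamma> s)) = (indicator {0..<T} s / T) * f (\<gamma> s)"
        by (rule AE_symmetric[OF ae])
    qed simp
    have "integrable U (\<lambda>s. f (\<gamma> s))"
      unfolding Ud using int3 T by (subst integrable_real_density) auto
    then have "integrable \<nu> f"
      unfolding \<nu>_def by (subst integrable_distr_eq) auto
    moreover have "(\<integral>z. f z \<partial>\<nu>) = integral {0..T} (\<lambda>s. f (\<gamma> s)) / T"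
    proof -
      have "(\<integral>z. f z \<partial>\<nu>) = (\<integral>s. f (\<gamma> s) \<partial>U)"
        unfolding \<nu>_def by (subst integral_distr) auto
      also have "\<dots> = (\<integral>s. (indicator {0..<T} s / T) * f (\<gamma> s) \<partial>lborel)"
        unfolding Ud using T by (subst integral_real_density) auto
      also have "\<dots> = (\<integral>s. (1 / T) * (indicator {0..T} s *\<^sub>R f (\<gamma> s)) \<partial>lborel)"
        using ae by (intro integral_cong_AE) auto
      also have "\<dots> = (1 / T) * (LINT s:{0..T}|lborel. f (\<gamma> s))"
        unfolding set_lebesgue_integral_def by simp
      also have "(LINT s:{0..T}|lborel. f (\<gamma> s)) = integral {0..T} (\<lambda>s. f (\<gamma> s))"
        by (rule set_borel_integral_eq_integral(2)[OF int])
      finally show ?thesis by simp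
    qed
    ultimately show "integrable \<nu> f \<and> (\<integral>z. f z \<partial>\<nu>) = integral {0..T} (\<lambda>s. f (tproj2 (flow s (x, v)))) / T"
      by (simp add: \<gamma>_def)
  qed
qed

text \<open>Linear in the initial speed and uniform in the position: this provides the integrable
  majorant for difference quotients along the flow.\<close>

lemma displacement_bound:
  assumes "0 < t"
  shows "norm (fst (flow t z) - fst z) \<le> t * (norm (snd z) + M * t)"
proof -
  have vb: "norm (snd (flow s z) - snd (flow 0 z)) \<le> M * s - M * 0" if "0 < s" for s
  proof (rule differentiable_bound_general[OF that, where f'="\<lambda>s. - torus_grad \<Xi> (tproj (fst (flow s z)))" and \<phi>'="\<lambda>_. M"])
    show "continuous_on {0..s} (\<lambda>s. snd (flow s z))"
      by (intro continuous_intros continuous_on_flow_time)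
    show "((\<lambda>s. M * s) has_vector_derivative M) (at u)" for u
      by (auto intro!: derivative_eq_intros simp flip: has_real_derivative_iff_has_vector_derivative)
    show "((\<lambda>s. snd (flow s z)) has_vector_derivative - torus_grad \<Xi> (tproj (fst (flow u z)))) (at u)" for u
      by (rule vel_deriv)
    show "norm (- torus_grad \<Xi> (tproj (fst (flow u z)))) \<le> M" for u
      using G_bound by simp
  qed (intro continuous_intros)
  have "norm (fst (flow t z) - fst (flow 0 z)) \<le> t * (norm (snd z) + M * t) - 0 * (norm (snd z) + M * t)"
  proof (rule differentiable_bound_general[OF assms, where f'="\<lambda>s. snd (flow s z)" and \<phi>'="\<lambda>_. norm (snd z) + M * t" and \<phi>="\<lambda>s. s * (norm (snd z) + M * t)"])
    show "continuous_on {0..t} (\<lambda>s. fst (flow s z))"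
      by (intro continuous_intros continuous_on_flow_time)
    show "((\<lambda>s. s * (norm (snd z) + M * t)) has_vector_derivative norm (snd z) + M * t) (at u)" for u
      by (auto intro!: derivative_eq_intros simp flip: has_real_derivative_iff_has_vector_derivative)
    fix s assume s: "0 < s" "s < t"
    have "norm (snd (flow s z)) \<le> norm (snd z) + norm (snd (flow s z) - snd z)"
      by (metis add.commute diff_add_cancel norm_triangle_ineq)
    also have "norm (snd (flow s z) - snd z) \<le> M * s" using vb[OF s(1)] by simp
    also have "M * s \<le> M * t" using s by (intro mult_left_mono M_nonneg) auto
    finally show "norm (snd (flow s z)) \<le> norm (snd z) + M * t" by simp
  next
    show "((\<lambda>s. fst (flow s z)) has_vector_derivative snd (flow u z)) (at u)" for u
      by (rule pos_deriv)
  qed (intro continuous_intros)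
  then show ?thesis by simp
qed

text \<open>Difference quotients of \<open>\<theta>\<close> along the flow have integral zero by invariance. Passing to
  the limit under the integral avoids Fubini's theorem.\<close>

lemma invariant_measure_closed:
  assumes \<nu>: "\<nu> \<in> invariant_measures \<Xi>" and int: "integrable \<nu> (\<lambda>z. norm (snd z))"
    and \<theta>: "\<theta> \<in> C1_torus"
  shows "(\<integral>z. snd z \<bullet> torus_grad \<theta> (fst z) \<partial>\<nu>) = 0"
proof -
  have \<nu>B: "\<nu> \<in> borel_prob_measures" and inv: "\<And>t. distr \<nu> borel (EL_flow \<Xi> t) = \<nu>"
    using \<nu> by (auto simp: invariant_measures_def)
  interpret prob_space \<nu> using \<nu>B by (simp add: borel_prob_measures_def)
  have sets [measurable_cong]: "sets \<nu> = sets borel" using \<nu>B by (simp add: borel_prob_measures_def)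
  obtain C where C: "0 \<le> C" "\<And>x y. \<bar>\<theta> (tproj x) - \<theta> (tproj y)\<bar> \<le> C * norm (x - y)"
    by (rule C1_torus_lipschitz[OF \<theta>]) (rule that)
  obtain b where b: "\<And>x. norm (\<theta> x) \<le> b"
    by (rule torus_bounded_norm[OF C1_torus_continuous[OF \<theta>]]) (rule that)
  have c\<theta>: "continuous_on UNIV (\<lambda>z :: 'n torus \<times> (real ^ 'n). \<theta> (fst z))"
    by (rule continuous_on_compose2[OF C1_torus_continuous[OF \<theta>] continuous_on_fst[OF continuous_on_id]]) auto
  have m\<theta> [measurable]: "(\<lambda>z :: 'n torus \<times> (real ^ 'n). \<theta> (fst z)) \<in> borel_measurable borel"
    by (intro borel_measurable_continuous_onI c\<theta>)
  \<comment> \<open>The steps stay at most 1, so that \<open>C * (norm (snd z) + M)\<close>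
    dominates all difference quotients at once.\<close>
  define h where "h k = 1 / real (Suc k)" for k
  have h: "0 < h k" "h k \<le> 1" for k by (auto simp: h_def)
  have hlim: "h \<longlonglongrightarrow> 0" unfolding h_def by (rule lim_1_over_n[THEN LIMSEQ_Suc])
  define D where "D k z = (\<theta> (fst (EL_flow \<Xi> (h k) z)) - \<theta> (fst z)) / h k" for k z
  have mE [measurable]: "(\<lambda>z. \<theta> (fst (EL_flow \<Xi> t z))) \<in> borel_measurable borel" for t
    using measurable_compose[OF EL_flow_measurable m\<theta>] .
  have mD [measurable]: "D k \<in> borel_measurable borel" for k
    unfolding D_def by measurable
  have D0: "(\<integral>z. D k z \<partial>\<nu>) = 0" for k
  proof -
    have i1: "integrable \<nu> (\<lambda>z. \<theta> (fst z))"
      by (rule integrable_const_bound[where B=b]) (use b in auto)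
    have i2: "integrable \<nu> (\<lambda>z. \<theta> (fst (EL_flow \<Xi> (h k) z)))"
      by (rule integrable_const_bound[where B=b]) (use b in auto)
    have "(\<integral>z. \<theta> (fst z) \<partial>\<nu>) = (\<integral>z. \<theta> (fst z) \<partial>distr \<nu> borel (EL_flow \<Xi> (h k)))"
      by (simp add: inv)
    also have "\<dots> = (\<integral>z. \<theta> (fst (EL_flow \<Xi> (h k) z)) \<partial>\<nu>)"
      by (rule integral_distr) auto
    finally show ?thesis
      unfolding D_def using i1 i2 by simp
  qed
  have lim: "(\<lambda>k. D k z) \<longlonglongrightarrow> snd z \<bullet> torus_grad \<theta> (fst z)" for z
  proof -
    obtain x p where z: "z = tproj2 (x, p)" by (rule tproj2_cases)
    have "((\<lambda>t. \<theta> (tproj (fst (flow t (x, p))))) has_real_derivative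
        snd (flow 0 (x, p)) \<bullet> torus_grad \<theta> (tproj (fst (flow 0 (x, p))))) (at 0)"
      by (rule GDERIV_along_path[OF C1_torus_GDERIV[OF \<theta>] pos_deriv])
    then have "((\<lambda>t. (\<theta> (tproj (fst (flow t (x, p)))) - \<theta> (tproj x)) / t) \<longlongrightarrow> p \<bullet> torus_grad \<theta> (tproj x)) (at 0)"
      unfolding has_field_derivative_iff by simp
    moreover have "h k \<noteq> 0" for k using h(1)[of k] by simp
    then have "filterlim h (at 0) sequentially"
      using hlim by (simp add: filterlim_at)
    ultimately have "(\<lambda>k. (\<theta> (tproj (fst (flow (h k) (x, p)))) - \<theta> (tproj x)) / h k) \<longlonglongrightarrow> p \<bullet> torus_grad \<theta> (tproj x)"
      by (rule filterlim_compose)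
    then show ?thesis
      unfolding D_def z EL_flow_tproj2 by (simp add: tproj2_def)
  qed
  have bound: "norm (D k z) \<le> C * (norm (snd z) + M)" for k z
  proof -
    obtain x p where z: "z = tproj2 (x, p)" by (rule tproj2_cases)
    have "\<bar>\<theta> (tproj (fst (flow (h k) (x, p)))) - \<theta> (tproj x)\<bar> \<le> C * norm (fst (flow (h k) (x, p)) - x)"
      by (rule C(2))
    also have "\<dots> \<le> C * (h k * (norm p + M * h k))"
      using displacement_bound[OF h(1), of k "(x, p)"] C(1) by (intro mult_left_mono) auto
    also have "\<dots> \<le> C * (h k * (norm p + M))"
      using h(1)[of k] C(1) mult_left_mono[OF h(2)[of k] M_nonneg] by (intro mult_left_mono add_left_mono) simp_all
    finally show ?thesis
      using h(1)[of k] unfolding D_def z EL_flow_tproj2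
      by (simp add: tproj2_def pos_divide_le_eq mult.commute mult.left_commute)
  qed
  have c: "continuous_on UNIV (\<lambda>z :: 'n torus \<times> (real ^ 'n). snd z \<bullet> torus_grad \<theta> (fst z))"
    by (intro continuous_intros continuous_on_compose2[OF C1_torus_continuous_grad[OF \<theta>]]) auto
  have "(\<lambda>k. \<integral>z. D k z \<partial>\<nu>) \<longlonglongrightarrow> (\<integral>z. snd z \<bullet> torus_grad \<theta> (fst z) \<partial>\<nu>)"
  proof (rule integral_dominated_convergence[where w="\<lambda>z. C * (norm (snd z) + M)"])
    show "(\<lambda>z. snd z \<bullet> torus_grad \<theta> (fst z)) \<in> borel_measurable \<nu>"
      by (rule borel_prob_measures_measurable[OF \<nu>B c])
    show "integrable \<nu> (\<lambda>z. C * (norm (snd z) + M))"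
      using int by simp
  qed (use lim bound in auto)
  then have "(\<lambda>k :: nat. 0) \<longlonglongrightarrow> (\<integral>z. snd z \<bullet> torus_grad \<theta> (fst z) \<partial>\<nu>)"
    unfolding D0 .
  from LIMSEQ_unique[OF this tendsto_const] show ?thesis .
qed

end

section \<open>Mather measures\<close>

text \<open>The weight 1/4, instead of 1/2, leaves a quarter of |p|^2 in |p|^2/2 - p.P, which keeps
  the shifted Lagrangian coercive.\<close>

lemma inner_le_quarter: "(p :: 'a::real_inner) \<bullet> P \<le> (norm p)\<^sup>2 / 4 + (norm P)\<^sup>2"
proof -
  have "0 \<le> ((1/2) *\<^sub>R p - P) \<bullet> ((1/2) *\<^sub>R p - P)" by simp
  then show ?thesis
    unfolding power2_norm_eq_inner by (simp add: algebra_simps inner_commute)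
qed

lemma young_inner: "(p :: 'a::real_inner) \<bullet> w \<le> (norm p)\<^sup>2 / 2 + (norm w)\<^sup>2 / 2"
proof -
  have "0 \<le> (p - w) \<bullet> (p - w)" by simp
  then show ?thesis
    unfolding power2_norm_eq_inner by (simp add: algebra_simps inner_commute)
qed

lemma integrable_norm_of_norm_square:
  assumes "prob_space M" "g \<in> borel_measurable M" "integrable M (\<lambda>z. (norm (g z))\<^sup>2)"
  shows "integrable M (\<lambda>z. norm (g z))"
proof -
  interpret prob_space M by fact
  have "integrable M (\<lambda>z. 1 + (norm (g z))\<^sup>2)" using assms(3) by simp
  then show ?thesis
  proof (rule Bochner_Integration.integrable_bound)
    show "(\<lambda>z. norm (g z)) \<in> borel_measurable M" using assms(2) by measurable
    have "norm (norm (g z)) \<le> norm (1 + (norm (g z))\<^sup>2)" for z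
    proof -
      have "0 \<le> (norm (g z) - 1/2)\<^sup>2" by simp
      then show ?thesis by (simp add: power2_eq_square algebra_simps)
    qed
    then show "AE z in M. norm (norm (g z)) \<le> norm (1 + (norm (g z))\<^sup>2)" by simp
  qed
qed

context torus_mechanical
begin

lemma Xi_continuous: "continuous_on UNIV \<Xi>"
  using C2 by (intro C1_torus_continuous) (simp add: C2_torus_def)

lemma Xi_bound: "\<bar>\<Xi> x\<bar> \<le> B"
  using xi_bound[of "rep_torus x"] by simp

lemma continuous_on_Xi_fst: "continuous_on UNIV (\<lambda>z :: 'n torus \<times> (real ^ 'n). \<Xi> (fst z))"
  by (rule continuous_on_compose2[OF Xi_continuous continuous_on_fst[OF continuous_on_id]]) auto

lemma Xi_fst_integrable:
  assumes "\<nu> \<in> borel_prob_measures"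
  shows "integrable \<nu> (\<lambda>z :: 'n torus \<times> (real ^ 'n). \<Xi> (fst z))"
proof -
  interpret prob_space \<nu> using assms by (simp add: borel_prob_measures_def)
  show ?thesis
    by (rule integrable_const_bound[where B=B])
      (auto simp: Xi_bound borel_prob_measures_measurable[OF assms continuous_on_Xi_fst])
qed

lemma continuous_on_lagrangian:
  "continuous_on UNIV (\<lambda>z :: 'n torus \<times> (real ^ 'n). lagrangian \<Xi> (snd z) (fst z) - snd z \<bullet> Q)"
  unfolding lagrangian_def by (intro continuous_intros continuous_on_Xi_fst) simp_all

lemma lagrangian_lower_bound: "(norm p)\<^sup>2 / 4 - (B + (norm Q)\<^sup>2) \<le> lagrangian \<Xi> p x - p \<bullet> Q"
  using inner_le_quarter[of p Q] Xi_bound[of x] by (simp add: lagrangian_def)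

text \<open>Coercivity turns finite action into a finite second moment of the velocity. It is
  applied with \<open>Q\<close> equal to \<open>P\<close> for the Mather measure and with
  \<open>Q\<close> equal to 0 for competitors of prescribed rotation vector.\<close>

lemma finite_action_integrable:
  assumes \<nu>: "\<nu> \<in> borel_prob_measures"
    and fin: "ext_integral \<nu> (\<lambda>z. lagrangian \<Xi> (snd z) (fst z) - snd z \<bullet> Q) \<noteq> \<infinity>"
  shows "integrable \<nu> (\<lambda>z. lagrangian \<Xi> (snd z) (fst z) - snd z \<bullet> Q)"
    and "integrable \<nu> (\<lambda>z. (norm (snd z))\<^sup>2)"
    and "integrable \<nu> (\<lambda>z. norm (snd z))" and "integrable \<nu> snd"
proof -
  have ps: "prob_space \<nu>" using \<nu> by (simp add: borel_prob_measures_def)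
  interpret prob_space \<nu> by (rule ps)
  have snd: "snd \<in> borel_measurable \<nu>"
    by (rule borel_prob_measures_measurable[OF \<nu>]) (rule continuous_on_snd[OF continuous_on_id])
  show 1: "integrable \<nu> (\<lambda>z. lagrangian \<Xi> (snd z) (fst z) - snd z \<bullet> Q)"
  proof (rule integrable_of_ext_integral[OF ps _ _ fin, where C="B + (norm Q)\<^sup>2"])
    show "(\<lambda>z. lagrangian \<Xi> (snd z) (fst z) - snd z \<bullet> Q) \<in> borel_measurable \<nu>"
      by (rule borel_prob_measures_measurable[OF \<nu> continuous_on_lagrangian])
    show "- (B + (norm Q)\<^sup>2) \<le> lagrangian \<Xi> (snd z) (fst z) - snd z \<bullet> Q" for z :: "'n torus \<times> (real ^ 'n)"
      using lagrangian_lower_bound[of "snd z" Q "fst z"] zero_le_power2[of "norm (snd z)"] by linarith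
  qed
  have "integrable \<nu> (\<lambda>z. 4 * ((lagrangian \<Xi> (snd z) (fst z) - snd z \<bullet> Q) + (B + (norm Q)\<^sup>2)))"
    using 1 by (intro integrable_mult_right Bochner_Integration.integrable_add) auto
  then show 2: "integrable \<nu> (\<lambda>z. (norm (snd z))\<^sup>2)"
  proof (rule Bochner_Integration.integrable_bound)
    show "(\<lambda>z. (norm (snd z))\<^sup>2) \<in> borel_measurable \<nu>" using snd by measurable
    have "norm ((norm (snd z))\<^sup>2) \<le> norm (4 * ((lagrangian \<Xi> (snd z) (fst z) - snd z \<bullet> Q) + (B + (norm Q)\<^sup>2)))"
      for z :: "'n torus \<times> (real ^ 'n)"
      using lagrangian_lower_bound[of "snd z" Q "fst z"] by simp
    then show "AE z in \<nu>. norm ((norm (snd z))\<^sup>2) \<le> norm (4 * ((lagrangian \<Xi> (snd z) (fst z) - snd z \<bullet> Q) + (B + (norm Q)\<^sup>2)))"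
      by simp
  qed
  show 3: "integrable \<nu> (\<lambda>z. norm (snd z))"
    by (rule integrable_norm_of_norm_square[OF ps snd 2])
  then show "integrable \<nu> snd" using snd by (simp add: integrable_norm_iff)
qed

text \<open>P.p is the derivative of P.q along the orbit, so it integrates to P times the
  displacement of the lift.\<close>

lemma periodic_orbit_average_action:
  assumes T: "0 < T" and orbit: "flow T (x, v) = (x + m, v)"
  shows "integral {0..T} (\<lambda>s. lag (fst (flow s (x, v))) (snd (flow s (x, v))) - snd (flow s (x, v)) \<bullet> P)
    = action T (x, v) - P \<bullet> m"
proof -
  have d: "((\<lambda>s. fst (flow s (x, v)) \<bullet> P) has_real_derivative snd (flow s (x, v)) \<bullet> P) (at s)" for s
    using has_real_derivative_inner[OF pos_deriv[of "(x, v)" s] has_vector_derivative_const[of P]] by simp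
  have "((\<lambda>s. snd (flow s (x, v)) \<bullet> P) has_integral fst (flow T (x, v)) \<bullet> P - fst (flow 0 (x, v)) \<bullet> P) {0..T}"
    using T d by (intro fundamental_theorem_of_calculus)
      (auto simp: has_real_derivative_iff_has_vector_derivative has_vector_derivative_at_within)
  then have "((\<lambda>s. snd (flow s (x, v)) \<bullet> P) has_integral P \<bullet> m) {0..T}"
    by (simp add: orbit inner_add_left inner_add_right inner_commute)
  from has_integral_diff[OF integrable_integral[OF lag_flow_integrable] this]
  show ?thesis unfolding action_def by (rule integral_unique)
qed

end

section \<open>Consequences of minimality\<close>

context
  fixes \<Xi> :: "'n::finite torus \<Rightarrow> real" and P :: "real ^ 'n"
    and \<nu> :: "('n torus \<times> (real ^ 'n)) measure"
  assumes C2: "\<Xi> \<in> C2_torus" and mather: "mather_measure \<Xi> P \<nu>"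
begin

lemma mather_measure_borel: "\<nu> \<in> borel_prob_measures"
  and mather_measure_invariant: "\<nu> \<in> invariant_measures \<Xi>"
  using mather by (auto simp: mather_measure_def invariant_measures_def)

text \<open>These facts are proved together because they share one choice of the constants
  \<open>K\<close>, \<open>M\<close>, \<open>B\<close>, which do not occur in the
  statements.\<close>

lemma mather_integrable_lagrangian: "integrable \<nu> (\<lambda>z. lagrangian \<Xi> (snd z) (fst z) - snd z \<bullet> P)"
    and mather_integrable_square: "integrable \<nu> (\<lambda>z. (norm (snd z))\<^sup>2)"
    and mather_integrable_velocity: "integrable \<nu> snd"
    and mather_closed: "\<And>\<theta>. \<theta> \<in> C1_torus \<Longrightarrow> (\<integral>z. snd z \<bullet> torus_grad \<theta> (fst z) \<partial>\<nu>) = 0"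
    and mather_subsolution: "\<And>\<epsilon>. 0 < \<epsilon> \<Longrightarrow> \<exists>\<phi>\<in>C1_torus. \<forall>x. (norm (torus_grad \<phi> x + P))\<^sup>2 / 2 + \<Xi> x
      \<le> - (\<integral>z. lagrangian \<Xi> (snd z) (fst z) - snd z \<bullet> P \<partial>\<nu>) + \<epsilon>"
proof -
  obtain K M B where "periodic_mechanical (\<lambda>x. \<Xi> (tproj x)) (\<lambda>x. torus_grad \<Xi> (tproj x)) K M B"
    by (rule C2_torus_periodic_mechanical[OF C2])
  then interpret torus_mechanical \<Xi> K M B
    by (intro torus_mechanical.intro C2)
  let ?L = "\<lambda>z. lagrangian \<Xi> (snd z) (fst z) - snd z \<bullet> P"
  have minimal: "ext_integral \<nu> ?L \<le> ereal ((action T (x, v) - P \<bullet> m) / T)"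
    if T: "0 < T" and m: "lattice_vec m" and orbit: "flow T (x, v) = (x + m, v)" for T x v m
  proof -
    obtain \<xi> where \<xi>: "\<xi> \<in> invariant_measures \<Xi>"
      and f: "\<And>f :: _ \<Rightarrow> real. continuous_on UNIV f \<Longrightarrow> integrable \<xi> f \<and>
        (\<integral>z. f z \<partial>\<xi>) = integral {0..T} (\<lambda>s. f (tproj2 (flow s (x, v)))) / T"
      by (rule periodic_orbit_measure[OF T m orbit]) (rule that)
    have "ext_integral \<nu> ?L \<le> ext_integral \<xi> ?L"
      using mather \<xi> unfolding mather_measure_def case_prod_beta by blast
    also have "\<dots> = ereal (\<integral>z. ?L z \<partial>\<xi>)"
      using f[OF continuous_on_lagrangian] by (intro ext_integral_eq_integral) auto
    also have "(\<integral>z. ?L z \<partial>\<xi>) = integral {0..T} (\<lambda>s. ?L (tproj2 (flow s (x, v)))) / T"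
      using f[OF continuous_on_lagrangian] by blast
    also have "integral {0..T} (\<lambda>s. ?L (tproj2 (flow s (x, v)))) = action T (x, v) - P \<bullet> m"
      using periodic_orbit_average_action[OF T orbit, of P]
      by (simp add: tproj2_def lagrangian_def lag_def)
    finally show ?thesis .
  qed
  \<comment> \<open>A closed chain with a single constant edge yields some closed orbit. Its finite
    action, by minimality, excludes infinite action of \<open>\<nu>\<close>.\<close>
  obtain x v where "flow (\<Sum>i<1::nat. tmax) (x, v) = (x + 0, v)"
    by (rule periodic_orbit_below_chain[of 1 "\<lambda>_. tmax" 0 "\<lambda>_. 0"]) (auto simp: tmax_pos)
  then have "flow tmax (x, v) = (x + 0, v)" by simp
  from minimal[OF tmax_pos lattice_vec_0 this] have fin: "ext_integral \<nu> ?L \<noteq> \<infinity>" by auto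
  note facts = finite_action_integrable[OF mather_measure_borel fin]
  show "integrable \<nu> ?L" "integrable \<nu> (\<lambda>z. (norm (snd z))\<^sup>2)" "integrable \<nu> snd"
    by (rule facts)+
  show "(\<integral>z. snd z \<bullet> torus_grad \<theta> (fst z) \<partial>\<nu>) = 0" if "\<theta> \<in> C1_torus" for \<theta>
    by (rule invariant_measure_closed[OF mather_measure_invariant facts(3) that])
  show "\<exists>\<phi>\<in>C1_torus. \<forall>x. (norm (torus_grad \<phi> x + P))\<^sup>2 / 2 + \<Xi> x \<le> - (\<integral>z. ?L z \<partial>\<nu>) + \<epsilon>" if \<epsilon>: "0 < \<epsilon>" for \<epsilon>
  proof -
    \<comment> \<open>With c minus the minimal action, the assumption of the locale is
      \<open>minimal\<close> multiplied by the period.\<close>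
    interpret weak_kam "\<lambda>x. \<Xi> (tproj x)" "\<lambda>x. torus_grad \<Xi> (tproj x)" K M B P "- (\<integral>z. ?L z \<partial>\<nu>)"
    proof
      fix T x v m
      assume "0 < T" "lattice_vec m" "flow T (x, v) = (x + m, v)"
      from minimal[OF this] have "(\<integral>z. ?L z \<partial>\<nu>) \<le> (action T (x, v) - P \<bullet> m) / T"
        unfolding ext_integral_eq_integral[OF facts(1)] by simp
      then show "0 \<le> action T (x, v) - P \<bullet> m + - (\<integral>z. ?L z \<partial>\<nu>) * T"
        using \<open>0 < T\<close> by (simp add: pos_le_divide_eq)
    qed
    obtain \<phi> g where \<phi>: "\<And>x. GDERIV \<phi> x :> g x" "continuous_on UNIV g"
      "\<And>x m. lattice_vec m \<Longrightarrow> \<phi> (x + m) = \<phi> x"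
      and sub: "\<And>x. (norm (g x + P))\<^sup>2 / 2 + \<Xi> (tproj x) \<le> - (\<integral>z. ?L z \<partial>\<nu>) + \<epsilon>"
      by (rule C1_subsolution[OF \<epsilon>]) (rule that)
    note C1 = C1_torus_of_periodic[of \<phi> g, OF \<phi>]
    have "(norm (torus_grad (\<lambda>x. \<phi> (rep_torus x)) x + P))\<^sup>2 / 2 + \<Xi> x \<le> - (\<integral>z. ?L z \<partial>\<nu>) + \<epsilon>" for x
      using sub[of "rep_torus x"] C1(2)[of "rep_torus x"] by simp
    then show ?thesis using C1(1) by blast
  qed
qed

end

section \<open>Weak duality between closed measures and gradients\<close>

lemma F_fun_le:
  assumes "\<phi> \<in> C1_torus"
  shows "F_fun \<mu> P \<le> (\<integral>x. (norm (torus_grad \<phi> x + P))\<^sup>2 / 2 \<partial>\<mu>)"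
proof -
  have "(INF \<phi>\<in>C1_torus. \<integral>x. (norm (torus_grad \<phi> x + P))\<^sup>2 \<partial>\<mu>) \<le> (\<integral>x. (norm (torus_grad \<phi> x + P))\<^sup>2 \<partial>\<mu>)"
    using assms by (intro cINF_lower bdd_belowI[of _ 0]) auto
  then show ?thesis by (simp add: F_fun_def)
qed

lemma F_fun_ge:
  assumes "C1_torus \<noteq> ({} :: ('n::finite torus \<Rightarrow> real) set)"
    and "\<And>\<phi> :: 'n torus \<Rightarrow> real. \<phi> \<in> C1_torus \<Longrightarrow> a \<le> (\<integral>x. (norm (torus_grad \<phi> x + P))\<^sup>2 / 2 \<partial>\<mu>)"
  shows "a \<le> F_fun \<mu> P"
proof -
  have "2 * a \<le> (INF \<phi>\<in>C1_torus. \<integral>x. (norm (torus_grad \<phi> x + P))\<^sup>2 \<partial>\<mu>)"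
  proof (rule cINF_greatest[OF assms(1)])
    fix \<phi> :: "'n torus \<Rightarrow> real" assume "\<phi> \<in> C1_torus"
    from assms(2)[OF this] show "2 * a \<le> (\<integral>x. (norm (torus_grad \<phi> x + P))\<^sup>2 \<partial>\<mu>)" by simp
  qed
  then show ?thesis by (simp add: F_fun_def)
qed

lemma continuous_on_shifted_grad_square:
  assumes "\<phi> \<in> C1_torus"
  shows "continuous_on UNIV (\<lambda>x. (norm (torus_grad \<phi> x + P))\<^sup>2 / 2)"
  by (intro continuous_intros C1_torus_continuous_grad[OF assms]) simp_all

lemma torus_marginal_integral:
  fixes f :: "'n::finite torus \<Rightarrow> real"
  assumes "\<xi> \<in> borel_prob_measures" "continuous_on UNIV f"
  shows "(\<integral>x. f x \<partial>torus_marginal \<xi>) = (\<integral>z. f (fst z) \<partial>\<xi>)"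
proof -
  have sets: "sets \<xi> = sets borel" using assms(1) by (simp add: borel_prob_measures_def)
  have "fst \<in> borel_measurable \<xi>"
    unfolding measurable_cong_sets[OF sets refl]
    by (intro borel_measurable_continuous_onI continuous_on_fst continuous_on_id)
  then show ?thesis
    unfolding torus_marginal_def
    by (rule integral_distr) (intro borel_measurable_continuous_onI assms(2))
qed

lemma torus_marginal_borel:
  assumes "\<xi> \<in> borel_prob_measures"
  shows "torus_marginal \<xi> \<in> borel_prob_measures"
proof -
  have sets: "sets \<xi> = sets borel" using assms(1) by (simp add: borel_prob_measures_def)
  have "fst \<in> borel_measurable \<xi>"
    unfolding measurable_cong_sets[OF sets refl]
    by (intro borel_measurable_continuous_onI continuous_on_fst continuous_on_id)
  then show ?thesis
    using assms by (simp add: torus_marginal_def borel_prob_measures_def prob_space.prob_space_distr)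
qed

lemma velocity_integrable:
  fixes \<xi> :: "('n::finite torus \<times> (real ^ 'n)) measure"
  assumes \<xi>: "\<xi> \<in> borel_prob_measures" and sq: "integrable \<xi> (\<lambda>z. (norm (snd z))\<^sup>2)"
  shows "integrable \<xi> snd"
    and "\<phi> \<in> C1_torus \<Longrightarrow> integrable \<xi> (\<lambda>z. snd z \<bullet> torus_grad \<phi> (fst z))"
proof -
  have ps: "prob_space \<xi>" using \<xi> by (simp add: borel_prob_measures_def)
  have snd: "snd \<in> borel_measurable \<xi>"
    by (rule borel_prob_measures_measurable[OF \<xi>]) (rule continuous_on_snd[OF continuous_on_id])
  have norm: "integrable \<xi> (\<lambda>z. norm (snd z))"
    by (rule integrable_norm_of_norm_square[OF ps snd sq])
  then show "integrable \<xi> snd" using snd by (simp add: integrable_norm_iff)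
  assume \<phi>: "\<phi> \<in> C1_torus"
  obtain C where C: "0 \<le> C" "\<And>x. norm (torus_grad \<phi> x) \<le> C"
    by (rule torus_bounded_norm[OF C1_torus_continuous_grad[OF \<phi>]]) (rule that)
  have c: "continuous_on UNIV (\<lambda>z :: 'n torus \<times> (real ^ 'n). snd z \<bullet> torus_grad \<phi> (fst z))"
    by (intro continuous_intros continuous_on_compose2[OF C1_torus_continuous_grad[OF \<phi>]]) auto
  have "integrable \<xi> (\<lambda>z. C * norm (snd z))" using norm by simp
  then show "integrable \<xi> (\<lambda>z. snd z \<bullet> torus_grad \<phi> (fst z))"
  proof (rule Bochner_Integration.integrable_bound)
    show "(\<lambda>z. snd z \<bullet> torus_grad \<phi> (fst z)) \<in> borel_measurable \<xi>"
      by (rule borel_prob_measures_measurable[OF \<xi> c])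
    have "norm (snd z \<bullet> torus_grad \<phi> (fst z)) \<le> norm (C * norm (snd z))" for z :: "'n torus \<times> (real ^ 'n)"
    proof -
      have "\<bar>snd z \<bullet> torus_grad \<phi> (fst z)\<bar> \<le> norm (snd z) * norm (torus_grad \<phi> (fst z))"
        by (rule Cauchy_Schwarz_ineq2)
      also have "\<dots> \<le> norm (snd z) * C" by (intro mult_left_mono C(2)) auto
      finally show ?thesis using C(1) by (simp add: mult.commute)
    qed
    then show "AE z in \<xi>. norm (snd z \<bullet> torus_grad \<phi> (fst z)) \<le> norm (C * norm (snd z))" by simp
  qed
qed

lemma Lambda_set_D:
  assumes "\<xi> \<in> Lambda_set \<mu>"
  shows "\<xi> \<in> borel_prob_measures" "torus_marginal \<xi> = \<mu>" "integrable \<xi> (\<lambda>z. (norm (snd z))\<^sup>2)"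
    "\<theta> \<in> C1_torus \<Longrightarrow> (\<integral>z. snd z \<bullet> torus_grad \<theta> (fst z) \<partial>\<xi>) = 0"
  using assms unfolding Lambda_set_def case_prod_beta' by blast+

text \<open>Weak duality: integrate \<open>p \<bullet> (torus_grad \<phi> + P) \<le> norm p\<^sup>2 / 2 + norm (torus_grad \<phi> + P)\<^sup>2 / 2\<close>.\<close>

lemma Lambda_set_duality:
  fixes \<mu> :: "'n::finite torus measure"
  assumes \<xi>: "\<xi> \<in> Lambda_set \<mu>" and \<phi>: "\<phi> \<in> C1_torus"
  shows "- (\<integral>z. (norm (snd z))\<^sup>2 / 2 - snd z \<bullet> P \<partial>\<xi>) \<le> (\<integral>x. (norm (torus_grad \<phi> x + P))\<^sup>2 / 2 \<partial>\<mu>)"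
proof -
  note L = Lambda_set_D[OF \<xi>]
  note grad = velocity_integrable(2)[OF L(1,3) \<phi>]
  have c: "continuous_on UNIV (\<lambda>x. (norm (torus_grad \<phi> x + P))\<^sup>2 / 2)"
    by (rule continuous_on_shifted_grad_square[OF \<phi>])
  interpret prob_space \<xi> using L(1) by (simp add: borel_prob_measures_def)
  obtain C where C: "\<And>x. norm ((norm (torus_grad \<phi> x + P))\<^sup>2 / 2) \<le> C"
    by (rule torus_bounded_norm[OF c]) (rule that)
  have i1: "integrable \<xi> (\<lambda>z. (norm (torus_grad \<phi> (fst z) + P))\<^sup>2 / 2)"
  proof (rule integrable_const_bound[where B=C])
    show "(\<lambda>z. (norm (torus_grad \<phi> (fst z) + P))\<^sup>2 / 2) \<in> borel_measurable \<xi>"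
      by (intro borel_prob_measures_measurable[OF L(1)] continuous_on_compose2[OF c] continuous_intros) auto
  qed (use C in simp)
  have i2: "integrable \<xi> (\<lambda>z. (norm (snd z))\<^sup>2 / 2 - snd z \<bullet> P)"
    using L(3) velocity_integrable(1)[OF L(1,3)] by simp
  have "0 = (\<integral>z. snd z \<bullet> torus_grad \<phi> (fst z) \<partial>\<xi>)" using L(4)[OF \<phi>] by simp
  also have "\<dots> \<le> (\<integral>z. ((norm (snd z))\<^sup>2 / 2 - snd z \<bullet> P) + (norm (torus_grad \<phi> (fst z) + P))\<^sup>2 / 2 \<partial>\<xi>)"
  proof (rule integral_mono[OF grad Bochner_Integration.integrable_add[OF i2 i1]])
    fix z
    show "snd z \<bullet> torus_grad \<phi> (fst z) \<le> ((norm (snd z))\<^sup>2 / 2 - snd z \<bullet> P) + (norm (torus_grad \<phi> (fst z) + P))\<^sup>2 / 2"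
      using young_inner[of "snd z" "torus_grad \<phi> (fst z) + P"] by (simp add: inner_add_right)
  qed
  also have "\<dots> = (\<integral>z. (norm (snd z))\<^sup>2 / 2 - snd z \<bullet> P \<partial>\<xi>) + (\<integral>z. (norm (torus_grad \<phi> (fst z) + P))\<^sup>2 / 2 \<partial>\<xi>)"
    by (rule Bochner_Integration.integral_add[OF i2 i1])
  also have "(\<integral>z. (norm (torus_grad \<phi> (fst z) + P))\<^sup>2 / 2 \<partial>\<xi>) = (\<integral>x. (norm (torus_grad \<phi> x + P))\<^sup>2 / 2 \<partial>\<mu>)"
    using torus_marginal_integral[OF L(1) c] L(2) by simp
  finally show ?thesis by linarith
qed

theorem theorem4p3:
  fixes \<Xi> :: "'n::finite torus \<Rightarrow> real" and P J :: "real ^ 'n"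
    and \<nu> :: "('n torus \<times> (real ^ 'n)) measure" and \<mu> :: "'n torus measure"
  assumes "\<Xi> \<in> C2_torus"
    and "mather_measure \<Xi> P \<nu>"
    and "\<mu> = torus_marginal \<nu>"
    and "J = rotation_vector \<nu>"
  shows "weak_solution \<mu> P \<nu>
    \<and> (\<mu> \<in> borel_prob_measures \<and> H_hat \<Xi> P = (\<integral>x. \<Xi> x \<partial>\<mu>) + F_fun \<mu> P)
    \<and> (\<nu> \<in> invariant_measures_rot \<Xi> J \<and>
       (\<forall>\<xi>\<in>invariant_measures_rot \<Xi> J.
          ext_integral \<nu> (\<lambda>(x, p). lagrangian \<Xi> p x)
            \<le> ext_integral \<xi> (\<lambda>(x, p). lagrangian \<Xi> p x)))"
proof -
  note \<nu> = assms(1,2)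
  note \<nu>B = mather_measure_borel[OF \<nu>]
  note sq = mather_integrable_square[OF \<nu>]
  note vel = mather_integrable_velocity[OF \<nu>]
  \<comment> \<open>The candidate for \<open>H_hat \<Xi> P\<close>, and the constant for which
    almost-subsolutions exist.\<close>
  define c where "c = - (\<integral>z. lagrangian \<Xi> (snd z) (fst z) - snd z \<bullet> P \<partial>\<nu>)"
  obtain K M B where "periodic_mechanical (\<lambda>x. \<Xi> (tproj x)) (\<lambda>x. torus_grad \<Xi> (tproj x)) K M B"
    by (rule C2_torus_periodic_mechanical[OF assms(1)])
  then interpret torus_mechanical \<Xi> K M B
    by (intro torus_mechanical.intro assms(1))
  have sub: "\<exists>\<phi>\<in>C1_torus. \<forall>x. (norm (torus_grad \<phi> x + P))\<^sup>2 / 2 + \<Xi> x \<le> c + \<epsilon>" if "0 < \<epsilon>" for \<epsilon>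
    using mather_subsolution[OF \<nu> that] by (simp add: c_def)
  have C1_ne: "C1_torus \<noteq> ({} :: ('n torus \<Rightarrow> real) set)" using sub[of 1] by auto
  have \<mu>: "\<mu> \<in> borel_prob_measures" using torus_marginal_borel[OF \<nu>B] assms(3) by simp
  have \<nu>\<Lambda>: "\<nu> \<in> Lambda_set \<mu>"
    using \<nu>B sq mather_closed[OF \<nu>] assms(3) unfolding Lambda_set_def case_prod_beta' by blast
  have kinetic: "(\<integral>z. (norm (snd z))\<^sup>2 / 2 - snd z \<bullet> P \<partial>\<nu>) = (\<integral>x. \<Xi> x \<partial>\<mu>) - c"
  proof -
    have "(\<integral>z. (norm (snd z))\<^sup>2 / 2 - snd z \<bullet> P \<partial>\<nu>)
      = (\<integral>z. (lagrangian \<Xi> (snd z) (fst z) - snd z \<bullet> P) + \<Xi> (fst z) \<partial>\<nu>)"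
      by (simp add: lagrangian_def algebra_simps)
    also have "\<dots> = (\<integral>z. lagrangian \<Xi> (snd z) (fst z) - snd z \<bullet> P \<partial>\<nu>) + (\<integral>z. \<Xi> (fst z) \<partial>\<nu>)"
      by (rule Bochner_Integration.integral_add[OF mather_integrable_lagrangian[OF \<nu>] Xi_fst_integrable[OF \<nu>B]])
    finally show ?thesis
      using torus_marginal_integral[OF \<nu>B Xi_continuous] assms(3) by (simp add: c_def)
  qed
  \<comment> \<open>A pointwise subsolution inequality may be integrated against every probability
    measure; this gives the upper bound for \<open>H_hat\<close> and, with the marginal of
    \<open>\<nu>\<close>, the bound needed for the weak solution.\<close>
  have grad_bound: "(\<integral>x. \<Xi> x \<partial>\<mu>') + (\<integral>x. (norm (torus_grad \<phi> x + P))\<^sup>2 / 2 \<partial>\<mu>') \<le> c + \<epsilon>"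
    if \<mu>': "\<mu>' \<in> borel_prob_measures" and \<phi>: "\<phi> \<in> C1_torus"
      and le: "\<forall>x. (norm (torus_grad \<phi> x + P))\<^sup>2 / 2 + \<Xi> x \<le> c + \<epsilon>" for \<mu>' \<phi> \<epsilon>
  proof -
    interpret \<mu>': prob_space \<mu>' using \<mu>' by (simp add: borel_prob_measures_def)
    note i1 = continuous_torus_integrable[OF \<mu>' Xi_continuous]
    note i2 = continuous_torus_integrable[OF \<mu>' continuous_on_shifted_grad_square[OF \<phi>, of P]]
    have "(\<integral>x. \<Xi> x \<partial>\<mu>') + (\<integral>x. (norm (torus_grad \<phi> x + P))\<^sup>2 / 2 \<partial>\<mu>')
      = (\<integral>x. \<Xi> x + (norm (torus_grad \<phi> x + P))\<^sup>2 / 2 \<partial>\<mu>')"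
      by (rule Bochner_Integration.integral_add[OF i1 i2, symmetric])
    also have "\<dots> \<le> (\<integral>x. c + \<epsilon> \<partial>\<mu>')"
      using le by (intro integral_mono Bochner_Integration.integrable_add i1 i2) (auto simp: add.commute)
    also have "\<dots> = c + \<epsilon>" by (simp add: \<mu>'.prob_space)
    finally show ?thesis .
  qed
  have "weak_solution \<mu> P \<nu>"
    unfolding weak_solution_def case_prod_beta
  proof (intro conjI ballI \<nu>\<Lambda>)
    fix \<xi> assume \<xi>: "\<xi> \<in> Lambda_set \<mu>"
    show "(\<integral>z. (norm (snd z))\<^sup>2 / 2 - snd z \<bullet> P \<partial>\<nu>) \<le> (\<integral>z. (norm (snd z))\<^sup>2 / 2 - snd z \<bullet> P \<partial>\<xi>)"
    proof (rule field_le_epsilon)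
      fix \<epsilon> :: real assume "0 < \<epsilon>"
      then obtain \<phi> where \<phi>: "\<phi> \<in> C1_torus" "\<forall>x. (norm (torus_grad \<phi> x + P))\<^sup>2 / 2 + \<Xi> x \<le> c + \<epsilon>"
        using sub by blast
      \<comment> \<open>Duality bounds the value of \<open>\<xi>\<close> below by minus the gradient
        integral, hence by the integral of \<Xi> minus c + \<epsilon>, because \<open>\<xi>\<close>
        has the same marginal \<open>\<mu>\<close>. By \<open>kinetic\<close> this is the value of
        \<open>\<nu>\<close> minus \<epsilon>.\<close>
      show "(\<integral>z. (norm (snd z))\<^sup>2 / 2 - snd z \<bullet> P \<partial>\<nu>) \<le> (\<integral>z. (norm (snd z))\<^sup>2 / 2 - snd z \<bullet> P \<partial>\<xi>) + \<epsilon>"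
        using Lambda_set_duality[OF \<xi> \<phi>(1), of P] grad_bound[OF \<mu> \<phi>] kinetic by linarith
    qed
  qed
  moreover have "H_hat \<Xi> P = (\<integral>x. \<Xi> x \<partial>\<mu>) + F_fun \<mu> P"
  proof -
    have upper: "(\<integral>x. \<Xi> x \<partial>\<mu>') + F_fun \<mu>' P \<le> c" if \<mu>': "\<mu>' \<in> borel_prob_measures" for \<mu>'
    proof (rule field_le_epsilon)
      fix \<epsilon> :: real assume "0 < \<epsilon>"
      then obtain \<phi> where \<phi>: "\<phi> \<in> C1_torus" "\<forall>x. (norm (torus_grad \<phi> x + P))\<^sup>2 / 2 + \<Xi> x \<le> c + \<epsilon>"
        using sub by blast
      show "(\<integral>x. \<Xi> x \<partial>\<mu>') + F_fun \<mu>' P \<le> c + \<epsilon>"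
        using grad_bound[OF \<mu>' \<phi>] F_fun_le[OF \<phi>(1), of \<mu>' P] by linarith
    qed
    \<comment> \<open>Here \<open>\<nu>\<close> is itself the closed measure in the duality: its
      value is exactly the integral of \<Xi> minus c, so no gradient does better and the upper bound
      c is attained at \<open>\<mu>\<close>.\<close>
    have "c - (\<integral>x. \<Xi> x \<partial>\<mu>) \<le> F_fun \<mu> P"
    proof (rule F_fun_ge[OF C1_ne])
      fix \<phi> :: "'n torus \<Rightarrow> real" assume "\<phi> \<in> C1_torus"
      from Lambda_set_duality[OF \<nu>\<Lambda> this, of P] kinetic
      show "c - (\<integral>x. \<Xi> x \<partial>\<mu>) \<le> (\<integral>x. (norm (torus_grad \<phi> x + P))\<^sup>2 / 2 \<partial>\<mu>)" by linarith
    qed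
    then have c: "(\<integral>x. \<Xi> x \<partial>\<mu>) + F_fun \<mu> P = c" using upper[OF \<mu>] by linarith
    have "H_hat \<Xi> P \<le> c"
      unfolding H_hat_def using \<mu> upper by (intro cSUP_least) auto
    moreover have "(\<integral>x. \<Xi> x \<partial>\<mu>) + F_fun \<mu> P \<le> H_hat \<Xi> P"
      unfolding H_hat_def using \<mu> upper by (intro cSUP_upper bdd_aboveI[of _ c]) auto
    ultimately show ?thesis using c by linarith
  qed
  moreover have "\<nu> \<in> invariant_measures_rot \<Xi> J"
    using mather_measure_invariant[OF \<nu>] vel assms(4)
    by (simp add: invariant_measures_rot_def case_prod_beta')
  moreover have "ext_integral \<nu> (\<lambda>(x, p). lagrangian \<Xi> p x) \<le> ext_integral \<xi> (\<lambda>(x, p). lagrangian \<Xi> p x)"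
    if \<xi>: "\<xi> \<in> invariant_measures_rot \<Xi> J" for \<xi>
  proof -
    have \<xi>I: "\<xi> \<in> invariant_measures \<Xi>" and \<xi>i: "integrable \<xi> snd" and \<xi>J: "(\<integral>z. snd z \<partial>\<xi>) = J"
      using \<xi> by (auto simp: invariant_measures_rot_def rotation_vector_def case_prod_beta')
    have \<xi>B: "\<xi> \<in> borel_prob_measures" using \<xi>I by (simp add: invariant_measures_def)
    have \<nu>J: "(\<integral>z. snd z \<partial>\<nu>) = J"
      using assms(4) by (simp add: rotation_vector_def case_prod_beta')
    \<comment> \<open>Among measures with rotation vector \<open>J\<close> the term p.P has the
      constant integral J.P, so minimality with and without that term is the same, once both
      integrals are finite.\<close>
    have split: "integrable \<eta> (\<lambda>z. lagrangian \<Xi> (snd z) (fst z)) \<and>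
        (\<integral>z. lagrangian \<Xi> (snd z) (fst z) \<partial>\<eta>) = (\<integral>z. lagrangian \<Xi> (snd z) (fst z) - snd z \<bullet> P \<partial>\<eta>) + J \<bullet> P"
      if i: "integrable \<eta> (\<lambda>z. lagrangian \<Xi> (snd z) (fst z) - snd z \<bullet> P)"
        and v: "integrable \<eta> snd" "(\<integral>z. snd z \<partial>\<eta>) = J" for \<eta> :: "('n torus \<times> (real ^ 'n)) measure"
    proof -
      have vP: "integrable \<eta> (\<lambda>z. snd z \<bullet> P)" using v(1) by simp
      have "integrable \<eta> (\<lambda>z. (lagrangian \<Xi> (snd z) (fst z) - snd z \<bullet> P) + snd z \<bullet> P)"
        using i vP by (rule Bochner_Integration.integrable_add)
      moreover have "(\<integral>z. (lagrangian \<Xi> (snd z) (fst z) - snd z \<bullet> P) + snd z \<bullet> P \<partial>\<eta>)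
        = (\<integral>z. lagrangian \<Xi> (snd z) (fst z) - snd z \<bullet> P \<partial>\<eta>) + (\<integral>z. snd z \<bullet> P \<partial>\<eta>)"
        using i vP by (rule Bochner_Integration.integral_add)
      moreover have "(\<integral>z. snd z \<bullet> P \<partial>\<eta>) = J \<bullet> P" using v by simp
      ultimately show ?thesis by simp
    qed
    show ?thesis
    proof (cases "ext_integral \<xi> (\<lambda>z. lagrangian \<Xi> (snd z) (fst z)) = \<infinity>")
      case False
      \<comment> \<open>\<open>Q\<close> is 0 here: the competitor has finite action for L, and
        integrability of the shifted Lagrangian then follows from that of the velocity.\<close>
      then have fin: "ext_integral \<xi> (\<lambda>z. lagrangian \<Xi> (snd z) (fst z) - snd z \<bullet> 0) \<noteq> \<infinity>" by simp
      have "integrable \<xi> (\<lambda>z. lagrangian \<Xi> (snd z) (fst z))"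
        using finite_action_integrable(1)[OF \<xi>B fin] by simp
      then have i: "integrable \<xi> (\<lambda>z. lagrangian \<Xi> (snd z) (fst z) - snd z \<bullet> P)"
        using \<xi>i by simp
      have "ext_integral \<nu> (\<lambda>z. lagrangian \<Xi> (snd z) (fst z) - snd z \<bullet> P)
          \<le> ext_integral \<xi> (\<lambda>z. lagrangian \<Xi> (snd z) (fst z) - snd z \<bullet> P)"
        using assms(2) \<xi>I unfolding mather_measure_def case_prod_beta by blast
      then have "(\<integral>z. lagrangian \<Xi> (snd z) (fst z) - snd z \<bullet> P \<partial>\<nu>) \<le> (\<integral>z. lagrangian \<Xi> (snd z) (fst z) - snd z \<bullet> P \<partial>\<xi>)"
        using ext_integral_eq_integral[OF i] ext_integral_eq_integral[OF mather_integrable_lagrangian[OF \<nu>]] by simp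
      then show ?thesis
        using split[OF i \<xi>i \<xi>J] split[OF mather_integrable_lagrangian[OF \<nu>] vel \<nu>J]
        by (simp add: case_prod_beta' ext_integral_eq_integral)
    qed (simp add: case_prod_beta')
  qed
  ultimately show ?thesis using \<mu> by blast
qed

end
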